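(* Let $t_\star := \frac{2}{\pi^2} n^2\log n$. The continuous-time Glauber dynamics for the discrete Gaussian free field (DGFF) on $\Lambda_n$ with zero boundary conditions and initializations $\vec h(0)$ satisfying $\|\vec h(0)\|_\infty\le n$ exhibits cutoff at time $t_\star$ with window $O(n^2\log\log n)$. That is, there is a sequence $s_n = O(n^2\log\log n)$ such that $$\lim_{\lambda\to\infty}\liminf_{n\to\infty} d_{\mathrm{TV}}^{(n)}(t_\star-\lambda s_n)=1 \qquad\text{and}\qquad \lim_{\lambda\to\infty}\limsup_{n\to\infty} d_{\mathrm{TV}}^{(n)}(t_\star+\lambda s_n)=0,$$ where $d_{\mathrm{TV}}^{(n)}(t)=\max_{\vec h(0):\,\|\vec h(0)\|_\infty\le n}\|P_t\delta_{\vec h(0)}-\pi_n\|_{\mathrm{TV}}$.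
   Context: $\Lambda_n=\{1,\dots,n-1\}^2\subset\mathbb Z^2$ with nearest-neighbor edges; $x\sim y$ means $d(x,y)=1$; $\partial\Lambda_n=\{v\in\mathbb Z^2\setminus\Lambda_n: d(v,\Lambda_n)=1\}$. A height function is $\vec h=(h(x))_{x\in\Lambda_n}\in\mathbb R^{\Lambda_n}$, extended by $h=0$ on $\partial\Lambda_n$ (zero boundary conditions). $\pi_n$ is the DGFF law on $\mathbb R^{\Lambda_n}$ with zero boundary conditions: the probability measure with density proportional to $\exp\big(-\frac18\sum (h(x)-h(y))^2\big)$, where the sum runs over nearest-neighbor pairs $x\sim y$ in $\Lambda_n\cup\partial\Lambda_n$, each edge counted once (so that, conditionally on all other heights, $h(x)$ is Gaussian with variance $1$ and mean the average of its four neighbors). Glauber dynamics: each $x\in\Lambda_n$ has an independent rate-1 Poisson clock; when the clock at $x$ rings at time $t$, the heights at all other sites are unchanged and $h(x,t)$ is set to $\frac14\sum_{y\sim x}h(y,t^-)$ plus an independent standard Gaussian. $P_t\delta_{\vec h(0)}$ is the law of $\vec h(t)=(h(x,t))_{x\in\Lambda_n}$ started from $\vec h(0)$. $\|\cdot\|_{\mathrm{TV}}$ is total-variation distance; the max over initial states is understood as a supremum. A window $s_n$ in the definition of cutoff at time $t_n$ is required to satisfy $s_n=o(t_n)$. *)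

theory Defs
  imports "HOL-Probability.Probability" "HOL-Library.Landau_Symbols"
begin

type_synonym site = "int \<times> int"
type_synonym height = "site \<Rightarrow> real"

definition lat_box :: "nat \<Rightarrow> site set" where
  "lat_box n = {1..int n - 1} \<times> {1..int n - 1}"

text \<open>The graph distance of the nearest-neighbour lattice.  It is at least 1 between a site of the
  box and one outside, so being at distance 1 from the box means that some site of the box is at
  distance 1.\<close>

definition lat_dist :: "site \<Rightarrow> site \<Rightarrow> int" where
  "lat_dist x y = \<bar>fst x - fst y\<bar> + \<bar>snd x - snd y\<bar>"

definition adj :: "site \<Rightarrow> site \<Rightarrow> bool" (infix \<open>\<sim>\<^sub>\<int>\<close> 50) where
  "x \<sim>\<^sub>\<int> y \<longleftrightarrow> lat_dist x y = 1"

definition bdry :: "nat \<Rightarrow> site set" where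
  "bdry n = {v. v \<notin> lat_box n \<and> (\<exists>x \<in> lat_box n. lat_dist v x = 1)}"

definition zero_ext :: "nat \<Rightarrow> height \<Rightarrow> height" where
  "zero_ext n h = (\<lambda>x. if x \<in> lat_box n then h x else 0)"

text \<open>The state space \<open>\<real>\<^bsup>lat_box n\<^esup>\<close> consists of the functions on \<open>site\<close> that are
  extensional on \<open>lat_box n\<close>; as everywhere for \<^const>\<open>PiM\<close>, the value outside is \<^const>\<open>undefined\<close>,
  so neighbours outside the box are always read through \<^const>\<open>zero_ext\<close>.\<close>

abbreviation height_space :: "nat \<Rightarrow> height measure" where
  "height_space n \<equiv> PiM (lat_box n) (\<lambda>_. borel)"


subsection \<open>The discrete Gaussian free field\<close>

text \<open>The double sum runs over ordered pairs and meets every edge twice, hence the division by 2.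
  Edges between two boundary vertices contribute 0.\<close>

definition dirichlet_energy :: "nat \<Rightarrow> height \<Rightarrow> real" where
  "dirichlet_energy n h =
     (\<Sum>x \<in> lat_box n \<union> bdry n. \<Sum>y \<in> {y \<in> lat_box n \<union> bdry n. x \<sim>\<^sub>\<int> y}.
        (zero_ext n h x - zero_ext n h y)\<^sup>2) / 2"

definition gibbs_weight :: "nat \<Rightarrow> height \<Rightarrow> ennreal" where
  "gibbs_weight n h = ennreal (exp (- (1/8) * dirichlet_energy n h))"

definition dgff :: "nat \<Rightarrow> height measure" where
  "dgff n = density (PiM (lat_box n) (\<lambda>_. lborel))
     (\<lambda>h. gibbs_weight n h / (\<integral>\<^sup>+ g. gibbs_weight n g \<partial>PiM (lat_box n) (\<lambda>_. lborel)))"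


subsection \<open>Glauber dynamics\<close>

text \<open>The event \<open>(x, k)\<close> is the ring number \<open>k\<close> (counted from 0) of the clock at \<open>x\<close>.  A rate-1
  Poisson clock has independent exponential waiting times, \<open>\<tau> (x, k)\<close> being the waiting time
  between the rings \<open>k - 1\<close> and \<open>k\<close>; the Gaussian used at the ring \<open>(x, k)\<close> is \<open>\<zeta> (x, k)\<close>.\<close>

type_synonym ring = "site \<times> nat"

definition ring_time :: "(ring \<Rightarrow> real) \<Rightarrow> ring \<Rightarrow> real" where
  "ring_time \<tau> = (\<lambda>(x, k). \<Sum>j\<le>k. \<tau> (x, j))"

definition rings_until :: "nat \<Rightarrow> (ring \<Rightarrow> real) \<Rightarrow> real \<Rightarrow> ring set" where
  "rings_until n \<tau> t = {e \<in> lat_box n \<times> UNIV. ring_time \<tau> e \<le> t}"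

definition is_ring_history :: "nat \<Rightarrow> (ring \<Rightarrow> real) \<Rightarrow> real \<Rightarrow> ring list \<Rightarrow> bool" where
  "is_ring_history n \<tau> t es \<longleftrightarrow>
     set es = rings_until n \<tau> t \<and> sorted_wrt (\<lambda>e e'. ring_time \<tau> e < ring_time \<tau> e') es"

text \<open>Almost surely there are finitely many rings until time \<open>t\<close>, at distinct times, so that a
  history exists, and it is always unique.  The default value is used on a null set only.\<close>

definition ring_history :: "nat \<Rightarrow> (ring \<Rightarrow> real) \<Rightarrow> real \<Rightarrow> ring list" where
  "ring_history n \<tau> t =
     (if \<exists>es. is_ring_history n \<tau> t es then THE es. is_ring_history n \<tau> t es else [])"

definition heat_bath :: "nat \<Rightarrow> site \<Rightarrow> real \<Rightarrow> height \<Rightarrow> height" where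
  "heat_bath n x z h = h(x := (1/4) * (\<Sum>y \<in> {y. y \<sim>\<^sub>\<int> x}. zero_ext n h y) + z)"

definition glauber_state ::
  "nat \<Rightarrow> height \<Rightarrow> (ring \<Rightarrow> real) \<Rightarrow> (ring \<Rightarrow> real) \<Rightarrow> real \<Rightarrow> height" where
  "glauber_state n h\<^sub>0 \<tau> \<zeta> t =
     fold (\<lambda>e h. heat_bath n (fst e) (\<zeta> e) h) (ring_history n \<tau> t) h\<^sub>0"

definition waiting_times :: "nat \<Rightarrow> (ring \<Rightarrow> real) measure" where
  "waiting_times n = PiM (lat_box n \<times> UNIV) (\<lambda>_. density lborel (exponential_density 1))"

definition noise :: "nat \<Rightarrow> (ring \<Rightarrow> real) measure" where
  "noise n = PiM (lat_box n \<times> UNIV) (\<lambda>_. density lborel std_normal_density)"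

definition glauber_law :: "nat \<Rightarrow> height \<Rightarrow> real \<Rightarrow> height measure" where
  "glauber_law n h\<^sub>0 t =
     distr (waiting_times n \<Otimes>\<^sub>M noise n) (height_space n)
       (\<lambda>(\<tau>, \<zeta>). glauber_state n h\<^sub>0 \<tau> \<zeta> t)"


subsection \<open>Cutoff\<close>

definition tv_dist :: "'a measure \<Rightarrow> 'a measure \<Rightarrow> real" where
  "tv_dist \<mu> \<nu> = (SUP A \<in> sets \<mu>. \<bar>measure \<mu> A - measure \<nu> A\<bar>)"

definition bounded_heights :: "nat \<Rightarrow> height set" where
  "bounded_heights n = {h \<in> space (height_space n). \<forall>x \<in> lat_box n. \<bar>h x\<bar> \<le> real n}"

definition d_TV :: "nat \<Rightarrow> real \<Rightarrow> real" where
  "d_TV n t = (SUP h\<^sub>0 \<in> bounded_heights n. tv_dist (glauber_law n h\<^sub>0 t) (dgff n))"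

definition cutoff :: "(nat \<Rightarrow> real \<Rightarrow> real) \<Rightarrow> (nat \<Rightarrow> real) \<Rightarrow> (nat \<Rightarrow> real) \<Rightarrow> bool" where
  "cutoff d t s \<longleftrightarrow>
     s \<in> o(t) \<and>
     ((\<lambda>c. liminf (\<lambda>n. ereal (d n (t n - c * s n)))) \<longlongrightarrow> 1) at_top \<and>
     ((\<lambda>c. limsup (\<lambda>n. ereal (d n (t n + c * s n)))) \<longlongrightarrow> 0) at_top"

definition t_star :: "nat \<Rightarrow> real" where
  "t_star n = 2 / pi\<^sup>2 * (real n)\<^sup>2 * ln (real n)"

end

theory Submission
  imports Defs "HOL-Real_Asymp.Real_Asymp"
begin

text \<open>
  Given the clocks, the dynamics is a random product of averaging maps applied to the initial field,
  plus a Gaussian part that does not depend on it. The word of ring sites until time \<open>t\<close> is a word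
  of Poisson length with independent uniform letters, so expectations over the clocks are governed by one-step recursions.
  The positive eigenfunction \<open>sine\<close> of the averaging map \<open>P\<close> has eigenvalue \<open>cos (pi / n)\<close>; used as
  weight in Schur's test it shows that \<open>P\<close> contracts the Euclidean norm by this factor.

  Upper bound: start a second copy from the stationary law, with the same clocks. Until shortly after
  \<open>t_star\<close> let the difference of the two fields contract by itself; its squared norm is then
  at most \<open>n\<^sup>2\<close> divided by a power of \<open>ln n\<close>. Now shift the Gaussians of one copy so that every update
  damps the difference by an additional factor \<open>1 - \<delta>\<close> with \<open>\<delta> = 2 ln n / n\<^sup>2\<close>, during time \<open>n\<^sup>2\<close>, and
  finally so that every update removes the difference, until all sites have rung. The sum of the squared
  shifts is small, and it controls the total variation distance.

  Lower bound: start from \<open>n * sine\<close> and test with the overlap with \<open>sine\<close>. Its mean decays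
  like \<open>exp (- (1 - cos (pi / n)) * t)\<close>, its fluctuations due to the clocks are bounded by the initial
  Dirichlet energy, and its Gaussian fluctuations by those under the stationary law.
\<close>

section \<open>Measure-theoretic preliminaries\<close>

text \<open>A field bounded by n has squared norm up to n^4, and a unit of time multiplies the mean
  squared norm of a difference by about exp (- (pi / n)^2), so that \<open>t_star\<close> gains only
  n^(-2). Removing a difference outright costs about ln n times its squared norm, which at that
  moment is still far too large. Damping is cheaper, because a shift enters the cost quadratically:
  spread over time n^2, another factor n^(-2) costs only about (ln n)^2 / n^2 times the squared
  norm, and removal is then affordable. What is left, (ln n)^2 from damping and one more ln n from
  Markov's inequality for the cost, is beaten by a factor (ln n)^(-4). Gaining it takes time of
  order n^2 ln ln n, which is the window.

  In the lower bound the squared mean of the overlap starts at order n^6 and its stationary variance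
  has order n^4; with the decay rate pi^2 / n^2 of the squared mean, the two meet at
  \<open>t_star\<close> as well.

  Estimates are made for a fixed number of updates. Averaging over the Poisson number of updates
  turns powers of one-step factors into exponentials of time.\<close>

text \<open>Independence of one coordinate: as \<open>f\<close> ignores coordinate \<open>i\<close>
  of its second argument, that coordinate can be drawn separately. This takes one waiting time off
  the clocks and one Gaussian off the noise.\<close>

lemma nn_integral_PiM_peel:
  fixes M :: "'i \<Rightarrow> 'a measure"
  assumes M: "\<And>j. prob_space (M j)" and i: "i \<in> I"
    and f[measurable]: "f \<in> borel_measurable (M i \<Otimes>\<^sub>M PiM I M)"
    and indep: "\<And>v \<tau> a. f (v, \<tau>(i := a)) = f (v, \<tau>)"
  shows "(\<integral>\<^sup>+\<tau>. f (\<tau> i, \<tau>) \<partial>PiM I M) = (\<integral>\<^sup>+v. \<integral>\<^sup>+\<tau>. f (v, \<tau>) \<partial>PiM I M \<partial>M i)"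
proof -
  define J where "J = I - {i}"
  have I: "I = insert i J" using i by (auto simp: J_def)
  interpret Mi: prob_space "M i" by (rule M)
  interpret J: prob_space "PiM J M" using M by (intro prob_space_PiM) auto
  interpret P: pair_sigma_finite "M i" "PiM J M" ..
  have eq: "PiM I M = distr (M i \<Otimes>\<^sub>M PiM J M) (PiM I M) (\<lambda>(x, X). X(i := x))"
    using distr_pair_PiM_eq_PiM[of J M i] M unfolding I by auto
  have upd[measurable]: "(\<lambda>(x, X). X(i := x)) \<in> measurable (M i \<Otimes>\<^sub>M PiM J M) (PiM I M)"
    unfolding I by measurable
  have int: "(\<integral>\<^sup>+\<tau>. g \<tau> \<partial>PiM I M) = (\<integral>\<^sup>+x. \<integral>\<^sup>+X. g (X(i := x)) \<partial>PiM J M \<partial>M i)"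
    if g[measurable]: "g \<in> borel_measurable (PiM I M)" for g :: "_ \<Rightarrow> ennreal"
  proof -
    have "(\<integral>\<^sup>+\<tau>. g \<tau> \<partial>PiM I M) = (\<integral>\<^sup>+(x, X). g (X(i := x)) \<partial>(M i \<Otimes>\<^sub>M PiM J M))"
      by (subst eq, subst nn_integral_distr) (auto simp: case_prod_beta')
    also have "\<dots> = (\<integral>\<^sup>+x. \<integral>\<^sup>+X. g (X(i := x)) \<partial>PiM J M \<partial>M i)"
      using measurable_compose[OF upd g]
      by (subst J.nn_integral_fst[symmetric]) (auto simp: case_prod_beta')
    finally show ?thesis .
  qed
  have mi[measurable]: "(\<lambda>\<tau>. \<tau> i) \<in> measurable (PiM I M) (M i)"
    using i by measurable
  have "(\<integral>\<^sup>+v. \<integral>\<^sup>+\<tau>. f (v, \<tau>) \<partial>PiM I M \<partial>M i) = (\<integral>\<^sup>+v. \<integral>\<^sup>+x. \<integral>\<^sup>+X. f (v, X(i := x)) \<partial>PiM J M \<partial>M i \<partial>M i)"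
    by (intro nn_integral_cong int) simp
  also have "\<dots> = (\<integral>\<^sup>+v. \<integral>\<^sup>+x. \<integral>\<^sup>+X. f (v, X(i := v)) \<partial>PiM J M \<partial>M i \<partial>M i)"
    by (intro nn_integral_cong) (metis fun_upd_upd indep)
  also have "\<dots> = (\<integral>\<^sup>+v. \<integral>\<^sup>+X. f (v, X(i := v)) \<partial>PiM J M \<partial>M i)"
    by (simp add: Mi.emeasure_space_1)
  also have "\<dots> = (\<integral>\<^sup>+\<tau>. f (\<tau> i, \<tau>) \<partial>PiM I M)"
    by (subst int) auto
  finally show ?thesis by simp
qed

text \<open>One-dimensional substitutions, coordinate by coordinate. The Gibbs measure is studied
  through three instances in place of its covariance matrix: a translation along the eigenfunction,
  the reflection \<open>c = -1\<close>, and the scaling \<open>c = sqrt 2\<close>.\<close>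

lemma nn_integral_PiM_lborel_affine:
  fixes f :: "('i \<Rightarrow> real) \<Rightarrow> ennreal"
  assumes "finite I" "c \<noteq> 0" "f \<in> borel_measurable (PiM I (\<lambda>_. lborel))"
  shows "(\<integral>\<^sup>+h. f h \<partial>PiM I (\<lambda>_. lborel)) =
    ennreal (\<bar>c\<bar> ^ card I) * (\<integral>\<^sup>+h. f (\<lambda>i\<in>I. v i + c * h i) \<partial>PiM I (\<lambda>_. lborel))"
  using assms(1,3)
proof (induction I arbitrary: f)
  case empty
  interpret product_sigma_finite "\<lambda>_::'i. lborel :: real measure" ..
  show ?case unfolding PiM_empty by (simp add: nn_integral_count_space_finite restrict_def)
next
  case (insert i I)
  let ?P = "PiM I (\<lambda>_. lborel :: real measure)" and ?Q = "PiM (insert i I) (\<lambda>_. lborel :: real measure)"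
  interpret product_sigma_finite "\<lambda>_::'i. lborel :: real measure" ..
  note insert.prems[measurable] insert.hyps(1)[simp]
  interpret F: sigma_finite_measure ?P by (rule sigma_finite) simp
  interpret P: pair_sigma_finite "lborel :: real measure" ?P ..
  have [measurable]: "(\<lambda>(y, h). \<lambda>j\<in>insert i I. v j + c * (h(i := y)) j) \<in>
      measurable (lborel \<Otimes>\<^sub>M ?P) ?Q"
    unfolding case_prod_beta
  proof (rule measurable_restrict)
    fix j assume "j \<in> insert i I"
    then show "(\<lambda>w. v j + c * ((snd w)(i := fst w)) j) \<in> measurable (lborel \<Otimes>\<^sub>M ?P) lborel"
      by (cases "j = i") (simp_all add: fun_upd_def)
  qed
  let ?g = "\<lambda>y h. f ((\<lambda>j\<in>I. v j + c * h j)(i := y))"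
  have e: "(\<lambda>j\<in>I. v j + c * h j)(i := v i + c * y) = (\<lambda>j\<in>insert i I. v j + c * (h(i := y)) j)" for h y
    using insert.hyps by (auto simp: fun_eq_iff)
  have u: "(\<lambda>w. (\<lambda>j\<in>I. v j + c * snd w j)(i := fst w)) \<in>
      measurable (lborel \<Otimes>\<^sub>M ?P) ?Q"
    by (intro measurable_fun_upd[where J=I] measurable_restrict) auto
  have mg: "(\<lambda>(y, h). ?g y h) \<in> borel_measurable (lborel \<Otimes>\<^sub>M ?P)"
    using measurable_compose[OF u insert.prems] by (simp add: case_prod_beta')
  note mg[measurable]
  have "(\<integral>\<^sup>+h. f h \<partial>?Q) = (\<integral>\<^sup>+y. \<integral>\<^sup>+h. f (h(i := y)) \<partial>?P \<partial>lborel)"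
    using insert by (intro product_nn_integral_insert_rev) auto
  also have "\<dots> = (\<integral>\<^sup>+y. ennreal (\<bar>c\<bar> ^ card I) * (\<integral>\<^sup>+h. ?g y h \<partial>?P) \<partial>lborel)"
    by (intro nn_integral_cong insert.IH measurable_compose[OF _ insert.prems] measurable_fun_upd[where J=I]) auto
  also have "\<dots> = ennreal (\<bar>c\<bar> ^ card I) * (\<integral>\<^sup>+y. (\<integral>\<^sup>+h. ?g y h \<partial>?P) \<partial>lborel)"
    by (intro nn_integral_cmult) measurable
  also have "(\<integral>\<^sup>+y. (\<integral>\<^sup>+h. ?g y h \<partial>?P) \<partial>lborel) =
      ennreal \<bar>c\<bar> * (\<integral>\<^sup>+y. (\<integral>\<^sup>+h. ?g (v i + c * y) h \<partial>?P) \<partial>lborel)"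
    using \<open>c \<noteq> 0\<close> by (intro nn_integral_real_affine) simp_all
  also have "(\<integral>\<^sup>+y. (\<integral>\<^sup>+h. ?g (v i + c * y) h \<partial>?P) \<partial>lborel) =
     (\<integral>\<^sup>+h. f (\<lambda>j\<in>insert i I. v j + c * h j) \<partial>?Q)"
    unfolding e using insert.hyps by (subst product_nn_integral_insert_rev) auto
  finally show ?case using insert.hyps
    by (simp add: ennreal_mult' mult_ac del: restrict_apply insert_iff)
qed

abbreviation std_gauss :: "real measure" where
  "std_gauss \<equiv> density lborel (\<lambda>z. ennreal (std_normal_density z))"

text \<open>The Cameron--Martin formula in dimension one: the exponential is the ratio of the normal
  densities at \<open>z + u\<close> and at \<open>z\<close>.\<close>

lemma nn_integral_std_gauss_shift:
  assumes [measurable]: "g \<in> borel_measurable borel"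
  shows "(\<integral>\<^sup>+z. g z \<partial>std_gauss) = (\<integral>\<^sup>+z. g (z + u) * ennreal (exp (- u * z - u\<^sup>2 / 2)) \<partial>std_gauss)"
proof -
  have "std_normal_density (u + z) = std_normal_density z * exp (- u * z - u\<^sup>2 / 2)" for z
    by (simp add: normal_density_def exp_add[symmetric] power2_eq_square field_simps)
  then have "ennreal (std_normal_density (u + z)) = ennreal (std_normal_density z) * ennreal (exp (- u * z - u\<^sup>2 / 2))" for z
    by (simp add: ennreal_mult)
  then show ?thesis
    by (simp add: nn_integral_density)
      (subst nn_integral_real_affine[where c=1 and t=u], simp_all add: add.commute mult_ac)
qed

lemma prob_space_std_gauss: "prob_space std_gauss"
  by (rule prob_space_normal_density) simp

lemma emeasure_std_gauss_UNIV[simp]: "emeasure std_gauss UNIV = 1"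
  using prob_space.emeasure_space_1[OF prob_space_std_gauss] by simp

text \<open>Squaring the likelihood ratio of the shift \<open>u\<close> gives
  \<open>exp (u^2)\<close> times that of the shift \<open>2 * u\<close>, which has mean 1. Hence a
  shift is charged its full square in \<open>cost\<close>.\<close>

lemma nn_integral_std_gauss_likelihood_square:
  "(\<integral>\<^sup>+z. (ennreal (exp (- u * z - u\<^sup>2 / 2)))\<^sup>2 \<partial>std_gauss) = ennreal (exp (u\<^sup>2))"
proof -
  interpret prob_space std_gauss by (rule prob_space_std_gauss)
  have e: "(ennreal (exp (- u * z - u\<^sup>2 / 2)))\<^sup>2 = ennreal (exp (u\<^sup>2)) * ennreal (exp (- (2 * u) * z - (2 * u)\<^sup>2 / 2))" for z
    by (simp add: ennreal_power ennreal_mult[symmetric] exp_add[symmetric] exp_double[symmetric] power2_eq_square algebra_simps)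
  have "(\<integral>\<^sup>+z. 1 * ennreal (exp (- (2 * u) * z - (2 * u)\<^sup>2 / 2)) \<partial>std_gauss) = 1"
    using nn_integral_std_gauss_shift[of "\<lambda>_. 1" "2 * u"] emeasure_space_1 by simp
  then show ?thesis
    unfolding e by (subst nn_integral_cmult) auto
qed

text \<open>Domination holds on every set and on its complement, and both total masses are 1, so
  nothing can be lost. Lower bounds on atoms therefore suffice to identify a law.\<close>

lemma prob_dominating_pmf:
  fixes H :: "'a :: countable measure" and Q :: "'a pmf"
  assumes H: "prob_space H" "sets H = UNIV" and le: "\<And>x. ennreal (pmf Q x) \<le> emeasure H {x}"
  shows "H = measure_pmf Q"
proof -
  interpret prob_space H by fact
  have sp: "space H = UNIV" using H(2) by (metis sets_eq_imp_space_eq sets_measure_pmf space_measure_pmf)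
  have dom: "emeasure (measure_pmf Q) A \<le> emeasure H A" for A
  proof -
    have "emeasure (measure_pmf Q) A = (\<integral>\<^sup>+x. ennreal (pmf Q x) * indicator A x \<partial>count_space UNIV)"
      by (subst nn_integral_measure_pmf[symmetric]) simp
    also have "\<dots> \<le> (\<integral>\<^sup>+x. emeasure H {x} * indicator A x \<partial>count_space UNIV)"
      by (intro nn_integral_mono mult_right_mono le) auto
    also have "\<dots> = (\<integral>\<^sup>+x. emeasure H {x} \<partial>count_space A)"
      by (simp add: nn_integral_count_space_indicator)
    also have "\<dots> = emeasure H A"
      using H(2) by (intro emeasure_countable_singleton[symmetric]) auto
    finally show ?thesis .
  qed
  show ?thesis
  proof (rule measure_eqI)
    fix A
    have "prob A \<ge> measure (measure_pmf Q) A" "prob (- A) \<ge> measure (measure_pmf Q) (- A)"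
      using dom[of A] dom[of "-A"] by (auto simp: emeasure_eq_measure measure_pmf.emeasure_eq_measure)
    moreover have "prob (- A) = 1 - prob A" using prob_compl[of A] H(2) sp by (simp add: Compl_eq_Diff_UNIV)
    moreover have "measure (measure_pmf Q) (- A) = 1 - measure (measure_pmf Q) A"
      using measure_pmf.prob_compl[of A Q] by (simp add: Compl_eq_Diff_UNIV)
    ultimately show "emeasure H A = emeasure (measure_pmf Q) A"
      by (simp add: emeasure_eq_measure measure_pmf.emeasure_eq_measure)
  qed (simp add: H(2))
qed

section \<open>Poisson variables and words of uniform letters\<close>

lemma nn_integral_power_poisson:
  assumes "0 < a" "0 \<le> z"
  shows "(\<integral>\<^sup>+k. ennreal (z ^ k) \<partial>measure_pmf (poisson_pmf a)) = ennreal (exp (a * (z - 1)))"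
proof -
  have "(\<integral>\<^sup>+k. ennreal (z ^ k) \<partial>measure_pmf (poisson_pmf a)) =
      (\<integral>\<^sup>+k. ennreal (exp (- a) * ((a * z) ^ k /\<^sub>R fact k)) \<partial>count_space UNIV)"
    using assms by (simp add: nn_integral_measure_pmf ennreal_mult[symmetric] power_mult_distrib field_simps)
  also have "\<dots> = (\<Sum>k. ennreal (exp (- a) * ((a * z) ^ k /\<^sub>R fact k)))"
    by (rule nn_integral_count_space_nat)
  also have "\<dots> = ennreal (\<Sum>k. exp (- a) * ((a * z) ^ k /\<^sub>R fact k))"
    using assms summable_exp_generic[of "a * z"] by (intro suminf_ennreal2 summable_mult) auto
  also have "(\<Sum>k. exp (- a) * ((a * z) ^ k /\<^sub>R fact k)) = exp (- a) * exp (a * z)"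
    using summable_exp_generic[of "a * z"] by (simp only: suminf_mult exp_def)
  finally show ?thesis by (simp add: exp_add[symmetric] algebra_simps)
qed

lemma pmf_replicate_uniform:
  assumes "finite B" "B \<noteq> {}"
  shows "pmf (replicate_pmf k (pmf_of_set B)) w = (if length w = k \<and> set w \<subseteq> B then (1 / card B) ^ k else 0)"
proof (induction k arbitrary: w)
  case 0 show ?case by (auto simp: pmf_return)
next
  case (Suc k)
  show ?case
  proof (cases w)
    case Nil
    then show ?thesis
      by (auto simp: pmf_eq_0_set_pmf set_replicate_pmf simp del: replicate_pmf.simps)
  next
    case (Cons x u)
    have "pmf (replicate_pmf (Suc k) (pmf_of_set B)) (x # u) =
        pmf (map_pmf (\<lambda>(x, xs). x # xs) (pair_pmf (pmf_of_set B) (replicate_pmf k (pmf_of_set B)))) ((\<lambda>(x, xs). x # xs) (x, u))"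
      by (simp add: pair_pmf_def map_bind_pmf map_pmf_def bind_assoc_pmf bind_return_pmf)
    also have "\<dots> = pmf (pair_pmf (pmf_of_set B) (replicate_pmf k (pmf_of_set B))) (x, u)"
      by (intro pmf_map_inj') (auto intro!: injI)
    also have "\<dots> = pmf (pmf_of_set B) x * pmf (replicate_pmf k (pmf_of_set B)) u"
      by (simp add: pmf_pair)
    finally show ?thesis unfolding Cons Suc using assms by (auto simp: indicator_def)
  qed
qed

text \<open>Chernoff's bound, with \<open>exp (- \<theta>)\<close> replaced by its second Taylor
  polynomial, an upper bound for nonnegative arguments. The parameter stays free until the
  asymptotic choice.\<close>

lemma poisson_lower_tail:
  assumes "0 < a" "0 \<le> \<theta>"
  shows "emeasure (measure_pmf (poisson_pmf a)) {..<K} \<le> ennreal (exp (\<theta> * K - \<theta> * a + \<theta>\<^sup>2 * a / 2))"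
proof -
  have "emeasure (measure_pmf (poisson_pmf a)) {..<K} = (\<integral>\<^sup>+k. indicator {..<K} k \<partial>measure_pmf (poisson_pmf a))"
    by simp
  also have "\<dots> \<le> (\<integral>\<^sup>+k. ennreal (exp (\<theta> * K)) * ennreal (exp (- \<theta>) ^ k) \<partial>measure_pmf (poisson_pmf a))"
  proof (intro nn_integral_mono)
    fix k
    have "1 \<le> exp (\<theta> * (real K - real k))" if "k < K" using that assms by simp
    moreover have "exp (\<theta> * (real K - real k)) = exp (\<theta> * K) * exp (- \<theta>) ^ k"
      by (simp add: exp_of_nat_mult[symmetric] exp_add[symmetric] algebra_simps)
    ultimately show "indicator {..<K} k \<le> ennreal (exp (\<theta> * K)) * ennreal (exp (- \<theta>) ^ k)"
      by (auto simp: indicator_def ennreal_mult[symmetric] ennreal_1[symmetric] simp del: ennreal_1)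
  qed
  also have "\<dots> = ennreal (exp (\<theta> * K)) * ennreal (exp (a * (exp (- \<theta>) - 1)))"
    using assms by (simp add: nn_integral_cmult nn_integral_power_poisson)
  also have "\<dots> = ennreal (exp (\<theta> * K + a * (exp (- \<theta>) - 1)))"
    by (simp add: ennreal_mult[symmetric] exp_add)
  also have "\<dots> \<le> ennreal (exp (\<theta> * K - \<theta> * a + \<theta>\<^sup>2 * a / 2))"
  proof (intro ennreal_leI)
    have "exp (- \<theta>) \<le> 1 - \<theta> + \<theta>\<^sup>2 / 2"
    proof -
      have "1 - 0 + 0\<^sup>2 / 2 - exp (- 0) \<le> 1 - \<theta> + \<theta>\<^sup>2 / 2 - exp (- \<theta>)"
      proof (rule DERIV_nonneg_imp_nondecreasing[OF assms(2)])
        fix x :: real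
        have "((\<lambda>x. 1 - x + x\<^sup>2 / 2 - exp (- x)) has_real_derivative (x - 1 + exp (- x))) (at x)"
          by (auto intro!: derivative_eq_intros)
        moreover have "0 \<le> x - 1 + exp (- x)" using exp_ge_add_one_self[of "- x"] by simp
        ultimately show "\<exists>y. ((\<lambda>x. 1 - x + x\<^sup>2 / 2 - exp (- x)) has_real_derivative y) (at x) \<and> 0 \<le> y" by blast
      qed
      then show ?thesis by simp
    qed
    then have "a * (exp (- \<theta>) - 1) \<le> a * (- \<theta> + \<theta>\<^sup>2 / 2)"
      using assms by (intro mult_left_mono) auto
    then show "exp (\<theta> * K + a * (exp (- \<theta>) - 1)) \<le> exp (\<theta> * K - \<theta> * a + \<theta>\<^sup>2 * a / 2)"
      by (simp add: algebra_simps)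
  qed
  finally show ?thesis .
qed

lemma nat_ceiling_le: "0 \<le> r \<Longrightarrow> real (nat \<lceil>r\<rceil>) \<le> r + 1"
  by linarith

section \<open>Total variation distance\<close>

text \<open>A one-sided bound for all sets is enough: applied to the complement it gives the other
  side.\<close>

lemma tv_dist_le:
  assumes "prob_space \<mu>" "prob_space \<nu>" "sets \<mu> = sets \<nu>"
    and le: "\<And>A. A \<in> sets \<mu> \<Longrightarrow> emeasure \<mu> A \<le> emeasure \<nu> A + ennreal e" and "0 \<le> e"
  shows "tv_dist \<mu> \<nu> \<le> e"
proof -
  interpret M: prob_space \<mu> by fact
  interpret N: prob_space \<nu> by fact
  have one: "measure \<mu> A \<le> measure \<nu> A + e" if "A \<in> sets \<mu>" for A
    using le[OF that] \<open>0 \<le> e\<close> by (simp add: M.emeasure_eq_measure N.emeasure_eq_measure flip: ennreal_plus)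
  have "\<bar>measure \<mu> A - measure \<nu> A\<bar> \<le> e" if A: "A \<in> sets \<mu>" for A
  proof -
    have sp: "space \<mu> = space \<nu>" using assms(3) by (rule sets_eq_imp_space_eq)
    have "measure \<mu> (space \<mu> - A) = 1 - measure \<mu> A" using A by (rule M.prob_compl)
    moreover have "measure \<nu> (space \<mu> - A) = 1 - measure \<nu> A" using A N.prob_compl[of A] by (simp add: assms(3) sp)
    ultimately show ?thesis using one[OF A] one[of "space \<mu> - A"] A by auto
  qed
  then show ?thesis unfolding tv_dist_def by (intro cSUP_least) auto
qed

lemma tv_dist_bdd:
  assumes "prob_space \<mu>" "prob_space \<nu>"
  shows "bdd_above ((\<lambda>A. \<bar>measure \<mu> A - measure \<nu> A\<bar>) ` sets \<mu>)" "\<bar>measure \<mu> A - measure \<nu> A\<bar> \<le> 1"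
proof -
  interpret M: prob_space \<mu> by fact
  interpret N: prob_space \<nu> by fact
  have *: "\<bar>measure \<mu> A - measure \<nu> A\<bar> \<le> 1" for A
    using M.prob_le_1[of A] N.prob_le_1[of A] measure_nonneg[of \<mu> A] measure_nonneg[of \<nu> A] by linarith
  then show "\<bar>measure \<mu> A - measure \<nu> A\<bar> \<le> 1" .
  show "bdd_above ((\<lambda>A. \<bar>measure \<mu> A - measure \<nu> A\<bar>) ` sets \<mu>)" using * by (intro bdd_aboveI[where M=1]) auto
qed

lemma tv_dist_bounds:
  assumes "prob_space \<mu>" "prob_space \<nu>"
  shows "0 \<le> tv_dist \<mu> \<nu>" "tv_dist \<mu> \<nu> \<le> 1" "A \<in> sets \<mu> \<Longrightarrow> measure \<mu> A - measure \<nu> A \<le> tv_dist \<mu> \<nu>"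
proof -
  have up: "\<bar>measure \<mu> A - measure \<nu> A\<bar> \<le> tv_dist \<mu> \<nu>" if "A \<in> sets \<mu>" for A
    unfolding tv_dist_def using tv_dist_bdd(1)[OF assms] that by (intro cSUP_upper)
  from up[of "{}"] show "0 \<le> tv_dist \<mu> \<nu>" by simp
  show "tv_dist \<mu> \<nu> \<le> 1"
    unfolding tv_dist_def using tv_dist_bdd(2)[OF assms] by (intro cSUP_least) auto
  show "measure \<mu> A - measure \<nu> A \<le> tv_dist \<mu> \<nu>" if "A \<in> sets \<mu>" using up[OF that] by simp
qed

section \<open>Averaging maps with a positive eigenfunction\<close>

text \<open>These are the only properties of the lattice that the probabilistic argument sees. In
  the box, \<open>p\<close> is simple random walk killed on leaving it, which encodes the zero
  boundary condition.\<close>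

locale heat_bath_kernel =
  fixes B :: "'a set" and p :: "'a \<Rightarrow> 'a \<Rightarrow> real" and \<phi> :: "'a \<Rightarrow> real" and \<mu> :: real
  assumes finite_B: "finite B" and B_nonempty: "B \<noteq> {}"
    and p_sym: "p x y = p y x" and p_nonneg: "0 \<le> p x y" and p_diag: "p x x = 0"
    and \<phi>_pos: "x \<in> B \<Longrightarrow> 0 < \<phi> x" and \<phi>_le_1: "x \<in> B \<Longrightarrow> \<phi> x \<le> 1"
    and \<phi>_eigen: "x \<in> B \<Longrightarrow> (\<Sum>y\<in>B. p x y * \<phi> y) = \<mu> * \<phi> x"
    and \<mu>_nonneg: "0 \<le> \<mu>" and \<mu>_less_1: "\<mu> < 1"
begin

definition avg :: "('a \<Rightarrow> real) \<Rightarrow> 'a \<Rightarrow> real" where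
  "avg d x = (\<Sum>y\<in>B. p x y * d y)"

definition norm_sq :: "('a \<Rightarrow> real) \<Rightarrow> real" where
  "norm_sq d = (\<Sum>x\<in>B. (d x)\<^sup>2)"

text \<open>The quadratic form of the identity minus \<open>avg\<close>; in the box it is a quarter
  of the Dirichlet energy.\<close>

definition energy :: "('a \<Rightarrow> real) \<Rightarrow> real" where
  "energy d = (\<Sum>x\<in>B. d x * (d x - avg d x))"

definition overlap :: "('a \<Rightarrow> real) \<Rightarrow> real" where
  "overlap d = (\<Sum>x\<in>B. \<phi> x * d x)"

text \<open>\<open>b = 1\<close> is the heat-bath update without its Gaussian, as felt by the
  difference of two fields with common noise; \<open>b = 0\<close> removes the difference at
  \<open>x\<close>.\<close>

definition damp :: "real \<Rightarrow> 'a \<Rightarrow> ('a \<Rightarrow> real) \<Rightarrow> ('a \<Rightarrow> real)" where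
  "damp b x d = d(x := b * avg d x)"

lemma card_B_pos: "0 < card B"
  using finite_B B_nonempty by (simp add: card_gt_0_iff)

lemma norm_sq_nonneg: "0 \<le> norm_sq d"
  by (simp add: norm_sq_def sum_nonneg)

lemma sum_avg_sym: "(\<Sum>x\<in>B. f x * avg d x) = (\<Sum>x\<in>B. avg f x * d x)"
  unfolding avg_def sum_distrib_left sum_distrib_right
  by (subst sum.swap) (simp add: p_sym mult_ac)

lemma avg_eigen: "x \<in> B \<Longrightarrow> avg \<phi> x = \<mu> * \<phi> x"
  by (simp add: avg_def \<phi>_eigen)

lemma overlap_avg: "(\<Sum>x\<in>B. \<phi> x * avg d x) = \<mu> * overlap d"
  unfolding sum_avg_sym overlap_def sum_distrib_left
  by (intro sum.cong refl) (simp add: avg_eigen mult_ac)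

lemma overlap_residual: "(\<Sum>x\<in>B. \<phi> x * (d x - avg d x)) = (1 - \<mu>) * overlap d"
  using overlap_avg[of d] by (simp add: right_diff_distrib sum_subtractf overlap_def[of d] algebra_simps)

text \<open>Schur's test with the positive eigenfunction as weight.\<close>

lemma avg_sq_le:
  assumes "x \<in> B"
  shows "(avg d x)\<^sup>2 \<le> \<mu> * \<phi> x * (\<Sum>y\<in>B. p x y * ((d y)\<^sup>2 / \<phi> y))"
proof -
  let ?u = "\<lambda>y. sqrt (p x y * \<phi> y)" and ?v = "\<lambda>y. sqrt (p x y / \<phi> y) * d y"
  have "avg d x = (\<Sum>y\<in>B. ?u y * ?v y)"
    unfolding avg_def
  proof (intro sum.cong refl)
    fix y assume "y \<in> B"
    then have "0 < \<phi> y" by (rule \<phi>_pos)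
    have "sqrt (p x y * \<phi> y) * sqrt (p x y / \<phi> y) = sqrt ((p x y)\<^sup>2)"
      using \<open>0 < \<phi> y\<close> unfolding real_sqrt_mult[symmetric] by (simp add: power2_eq_square)
    then show "p x y * d y = ?u y * ?v y"
      using p_nonneg[of x y] by (simp add: mult.assoc[symmetric])
  qed
  then have "(avg d x)\<^sup>2 \<le> (\<Sum>y\<in>B. (?u y)\<^sup>2) * (\<Sum>y\<in>B. (?v y)\<^sup>2)"
    using Cauchy_Schwarz_ineq_sum[of ?u ?v B] by simp
  also have "(\<Sum>y\<in>B. (?u y)\<^sup>2) = \<mu> * \<phi> x"
    unfolding \<phi>_eigen[OF assms, symmetric]
    by (intro sum.cong refl) (simp add: p_nonneg \<phi>_pos less_imp_le)
  also have "(\<Sum>y\<in>B. (?v y)\<^sup>2) = (\<Sum>y\<in>B. p x y * ((d y)\<^sup>2 / \<phi> y))"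
    by (intro sum.cong refl) (simp add: power_mult_distrib p_nonneg \<phi>_pos less_imp_le)
  finally show ?thesis by simp
qed

text \<open>The pointwise bound carries one factor \<mu>. The second one appears on summing over
  \<open>x\<close>, where by symmetry of \<open>p\<close> the weight \<phi> meets \<open>avg\<close>
  as an eigenfunction once more.\<close>

lemma norm_sq_avg_le: "norm_sq (avg d) \<le> \<mu>\<^sup>2 * norm_sq d"
proof -
  have "norm_sq (avg d) \<le> (\<Sum>x\<in>B. \<mu> * \<phi> x * (\<Sum>y\<in>B. p x y * ((d y)\<^sup>2 / \<phi> y)))"
    unfolding norm_sq_def by (intro sum_mono avg_sq_le)
  also have "\<dots> = \<mu> * (\<Sum>x\<in>B. \<phi> x * avg (\<lambda>y. (d y)\<^sup>2 / \<phi> y) x)"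
    by (simp add: avg_def sum_distrib_left mult_ac)
  also have "\<dots> = \<mu> * (\<mu> * (\<Sum>y\<in>B. \<phi> y * ((d y)\<^sup>2 / \<phi> y)))"
    by (simp add: overlap_avg overlap_def)
  also have "(\<Sum>y\<in>B. \<phi> y * ((d y)\<^sup>2 / \<phi> y)) = norm_sq d"
    unfolding norm_sq_def by (intro sum.cong refl) (use \<phi>_pos in force)
  finally show ?thesis by (simp add: power2_eq_square)
qed

text \<open>The spectral gap inequality, by Cauchy--Schwarz from the contraction of
  \<open>avg\<close>.\<close>

lemma energy_ge: "(1 - \<mu>) * norm_sq d \<le> energy d"
proof -
  have "(\<Sum>x\<in>B. d x * avg d x)\<^sup>2 \<le> norm_sq d * norm_sq (avg d)"
    using Cauchy_Schwarz_ineq_sum[of d "avg d" B] by (simp add: norm_sq_def)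
  also have "\<dots> \<le> norm_sq d * (\<mu>\<^sup>2 * norm_sq d)"
    by (intro mult_left_mono norm_sq_avg_le norm_sq_nonneg)
  finally have "(\<Sum>x\<in>B. d x * avg d x)\<^sup>2 \<le> (\<mu> * norm_sq d)\<^sup>2"
    by (simp add: power2_eq_square mult_ac)
  then have "(\<Sum>x\<in>B. d x * avg d x) \<le> \<mu> * norm_sq d"
    by (rule power2_le_imp_le) (intro mult_nonneg_nonneg \<mu>_nonneg norm_sq_nonneg)
  then show ?thesis
    by (simp add: energy_def norm_sq_def right_diff_distrib sum_subtractf power2_eq_square algebra_simps)
qed

lemma energy_nonneg: "0 \<le> energy d"
  using energy_ge[of d] norm_sq_nonneg[of d] \<mu>_less_1
  by (meson diff_gt_0_iff_gt less_imp_le mult_nonneg_nonneg order_trans)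

section \<open>The effect of a single update\<close>

lemma sum_upd:
  assumes "x \<in> B"
  shows "(\<Sum>y\<in>B. g y ((d(x := v)) y)) = (\<Sum>y\<in>B. g y (d y)) - g x (d x) + (g x v :: real)"
proof -
  have "(\<Sum>y\<in>B. g y ((d(x := v)) y)) = g x v + (\<Sum>y\<in>B - {x}. g y (d y))"
    using assms finite_B by (subst sum.remove[of B x]) (auto intro!: sum.cong)
  moreover have "(\<Sum>y\<in>B. g y (d y)) = g x (d x) + (\<Sum>y\<in>B - {x}. g y (d y))"
    using assms finite_B by (rule sum.remove[rotated])
  ultimately show ?thesis by simp
qed

lemma norm_sq_damp:
  "x \<in> B \<Longrightarrow> norm_sq (damp b x d) = norm_sq d - (d x)\<^sup>2 + b\<^sup>2 * (avg d x)\<^sup>2"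
  unfolding norm_sq_def damp_def by (subst sum_upd) (simp_all add: power_mult_distrib)

lemma overlap_damp:
  "x \<in> B \<Longrightarrow> overlap (damp 1 x d) = overlap d - \<phi> x * (d x - avg d x)"
  unfolding overlap_def damp_def by (subst sum_upd) (simp_all add: algebra_simps)

lemma avg_upd: "x \<in> B \<Longrightarrow> avg (d(x := v)) y = avg d y + p y x * (v - d x)"
  unfolding avg_def by (subst sum_upd) (simp_all add: algebra_simps)

text \<open>In one coordinate the energy is a quadratic polynomial with leading coefficient 1, since
  \<open>p x x = 0\<close>, and with its minimum at the average. This yields both the energy drop at
  an update and the conditional law of a single height under the Gibbs measure.\<close>

lemma energy_upd:
  assumes "x \<in> B"
  shows "energy (d(x := d x + e)) = energy d + 2 * e * (d x - avg d x) + e\<^sup>2"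
proof -
  have "energy (d(x := d x + e)) = (\<Sum>y\<in>B. (d(x := d x + e)) y * ((d(x := d x + e)) y - avg d y - p y x * e))"
    unfolding energy_def using assms by (simp add: avg_upd diff_diff_eq)
  also have "\<dots> = (\<Sum>y\<in>B. d y * (d y - avg d y - p y x * e)) - d x * (d x - avg d x) + (d x + e) * (d x + e - avg d x)"
    by (subst sum_upd[OF assms, of "\<lambda>y z. z * (z - avg d y - p y x * e)"]) (simp add: p_diag)
  also have "(\<Sum>y\<in>B. d y * (d y - avg d y - p y x * e)) = energy d - e * avg d x"
    unfolding energy_def avg_def[of d x] sum_distrib_left sum_subtractf[symmetric]
    by (intro sum.cong refl) (simp add: p_sym[of x] algebra_simps)
  also have "energy d - e * avg d x - d x * (d x - avg d x) + (d x + e) * (d x + e - avg d x) =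
      energy d + 2 * e * (d x - avg d x) + e\<^sup>2"
    by (simp add: power2_eq_square algebra_simps)
  finally show ?thesis .
qed

lemma energy_damp:
  assumes "x \<in> B"
  shows "energy (damp 1 x d) = energy d - (d x - avg d x)\<^sup>2"
  using energy_upd[OF assms, of d "avg d x - d x"]
  by (simp add: damp_def power2_eq_square algebra_simps)

text \<open>In \<open>(x, b)\<close>, the difference of two fields is multiplied by \<open>b\<close> at the update of \<open>x\<close>; the cost is
  the sum of the squares of the shifts of the Gaussians that achieve this.\<close>

primrec damped :: "('a \<times> real) list \<Rightarrow> ('a \<Rightarrow> real) \<Rightarrow> ('a \<Rightarrow> real)" where
  "damped [] d = d"
| "damped (c # cs) d = damped cs (damp (snd c) (fst c) d)"

primrec cost :: "('a \<times> real) list \<Rightarrow> ('a \<Rightarrow> real) \<Rightarrow> real" where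
  "cost [] d = 0"
| "cost (c # cs) d = ((1 - snd c) * avg d (fst c))\<^sup>2 + cost cs (damp (snd c) (fst c) d)"

abbreviation const_damping :: "real \<Rightarrow> 'a list \<Rightarrow> ('a \<times> real) list" where
  "const_damping b w \<equiv> map (\<lambda>x. (x, b)) w"

lemma damped_append: "damped (cs @ cs') d = damped cs' (damped cs d)"
  by (induction cs arbitrary: d) auto

lemma cost_append: "cost (cs @ cs') d = cost cs d + cost cs' (damped cs d)"
  by (induction cs arbitrary: d) auto

lemma cost_nonneg: "0 \<le> cost cs d"
  by (induction cs arbitrary: d) (auto intro: add_nonneg_nonneg)

lemma cost_undamped: "cost (const_damping 1 w) d = 0"
  by (induction w arbitrary: d) auto

lemma damped_0: "damped (const_damping 0 w) d y = (if y \<in> set w then 0 else d y)"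
  by (induction w arbitrary: d) (auto simp: damp_def)

lemma damped_zero: "(\<And>x. x \<in> B \<Longrightarrow> d x = 0) \<Longrightarrow> x \<in> B \<Longrightarrow> damped cs d x = 0"
  by (induction cs arbitrary: d) (auto simp: damp_def avg_def)

lemma damped_nonneg:
  assumes "\<And>x. x \<in> B \<Longrightarrow> 0 \<le> d x" "x \<in> B"
  shows "0 \<le> damped (const_damping 1 w) d x"
  using assms(1)
proof (induction w arbitrary: d)
  case (Cons y w)
  have "0 \<le> damp 1 y d z" if "z \<in> B" for z
    using Cons.prems that by (auto simp: damp_def avg_def intro!: sum_nonneg mult_nonneg_nonneg p_nonneg)
  then show ?case by (simp add: Cons.IH)
qed (use assms(2) in simp)

lemma avg_linear: "avg (\<lambda>y. a * d y + c * d' y) x = a * avg d x + c * avg d' x"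
  by (simp add: avg_def sum.distrib sum_distrib_left algebra_simps)

lemma damped_linear:
  "damped cs (\<lambda>y. a * d y + c * d' y) = (\<lambda>y. a * damped cs d y + c * damped cs d' y)"
proof (induction cs arbitrary: d d')
  case (Cons k cs)
  have "damp b x (\<lambda>y. a * d y + c * d' y) = (\<lambda>y. a * damp b x d y + c * damp b x d' y)" for b x
    by (auto simp: damp_def fun_eq_iff avg_linear algebra_simps)
  then show ?case by (simp add: Cons)
qed simp

section \<open>Expectations over words of independent uniform letters\<close>

abbreviation evolved :: "'a list \<Rightarrow> ('a \<Rightarrow> real) \<Rightarrow> ('a \<Rightarrow> real)" where
  "evolved w \<equiv> damped (const_damping 1 w)"

abbreviation words :: "nat \<Rightarrow> 'a list pmf" where
  "words k \<equiv> replicate_pmf k (pmf_of_set B)"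

abbreviation mean_words :: "nat \<Rightarrow> ('a list \<Rightarrow> ennreal) \<Rightarrow> ennreal" where
  "mean_words k f \<equiv> \<integral>\<^sup>+w. f w \<partial>measure_pmf (words k)"

lemma nn_integral_words_Suc:
  "mean_words (Suc k) (\<lambda>w. f w) =
    (\<Sum>x\<in>B. mean_words k (\<lambda>w. f (x # w))) / card B"
  using finite_B B_nonempty by (simp add: nn_integral_pmf_of_set)

lemma nn_integral_words_add:
  "mean_words (k + l) (\<lambda>w. f w) =
    mean_words k (\<lambda>u. mean_words l (\<lambda>v. f (u @ v)))"
  by (simp add: replicate_pmf_distrib)

lemma mean_ennreal:
  assumes "\<And>x. x \<in> B \<Longrightarrow> 0 \<le> g x"
  shows "(\<Sum>x\<in>B. ennreal (g x)) / card B = ennreal ((\<Sum>x\<in>B. g x) / card B)"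
  using assms card_B_pos by (simp add: sum_nonneg divide_ennreal ennreal_of_nat_eq_real_of_nat)

text \<open>A supermartingale argument: \<open>g k d\<close> bounds what is still to come with
  \<open>k\<close> letters left, \<open>r\<close> is what the next letter adds, and
  \<open>le\<close> is the one-step inequality. Conditioning on the first letter moves the starting
  field, so the induction is over all \<open>d\<close>.\<close>

lemma nn_integral_words_le:
  fixes g :: "nat \<Rightarrow> ('a \<Rightarrow> real) \<Rightarrow> real" and r :: "'a \<Rightarrow> ('a \<Rightarrow> real) \<Rightarrow> real"
  assumes nonneg: "\<And>k d. 0 \<le> g k d" and base: "\<And>d. f [] d \<le> ennreal (g 0 d)"
    and step: "\<And>x w d. f (x # w) d \<le> ennreal (r x d) + f w (damp b x d)"
    and r: "\<And>x d. 0 \<le> r x d"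
    and le: "\<And>k d. (\<Sum>x\<in>B. r x d + g k (damp b x d)) \<le> card B * g (Suc k) d"
  shows "mean_words k (\<lambda>w. f w d) \<le> ennreal (g k d)"
proof (induction k arbitrary: d)
  case 0 show ?case by (simp add: base)
next
  case (Suc k)
  have "mean_words (Suc k) (\<lambda>w. f w d) =
      (\<Sum>x\<in>B. mean_words k (\<lambda>w. f (x # w) d)) / card B"
    by (rule nn_integral_words_Suc)
  also have "\<dots> \<le> (\<Sum>x\<in>B. ennreal (r x d + g k (damp b x d))) / card B"
  proof (intro divide_right_mono_ennreal sum_mono)
    fix x
    have "mean_words k (\<lambda>w. f (x # w) d) \<le>
        mean_words k (\<lambda>w. ennreal (r x d) + f w (damp b x d))"
      by (intro nn_integral_mono step)
    also have "\<dots> = ennreal (r x d) + mean_words k (\<lambda>w. f w (damp b x d))"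
      by (subst nn_integral_add) auto
    also have "\<dots> \<le> ennreal (r x d) + ennreal (g k (damp b x d))"
      by (intro add_left_mono Suc.IH)
    finally show "mean_words k (\<lambda>w. f (x # w) d) \<le> ennreal (r x d + g k (damp b x d))"
      using nonneg r by simp
  qed
  also have "\<dots> = ennreal ((\<Sum>x\<in>B. r x d + g k (damp b x d)) / card B)"
    using nonneg r by (intro mean_ennreal) (auto intro: add_nonneg_nonneg)
  also have "\<dots> \<le> ennreal (g (Suc k) d)"
    using le[of d k] card_B_pos by (intro ennreal_leI) (simp add: divide_le_eq mult_ac)
  finally show ?case .
qed

lemma sum_norm_sq_damp:
  "(\<Sum>x\<in>B. norm_sq (damp b x d)) \<le> (card B - (1 - b\<^sup>2 * \<mu>\<^sup>2)) * norm_sq d"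
proof -
  have "(\<Sum>x\<in>B. norm_sq (damp b x d)) = card B * norm_sq d - norm_sq d + b\<^sup>2 * norm_sq (avg d)"
    by (simp add: norm_sq_damp sum.distrib sum_subtractf norm_sq_def[of d] norm_sq_def[of "avg d"] sum_distrib_left)
  moreover have "b\<^sup>2 * norm_sq (avg d) \<le> b\<^sup>2 * (\<mu>\<^sup>2 * norm_sq d)"
    by (intro mult_left_mono norm_sq_avg_le) auto
  ultimately show ?thesis by (simp add: algebra_simps)
qed

text \<open>The mean factor of the squared norm per update: the updated site is uniform, so a share
  \<open>1 / card B\<close> of the total is replaced.\<close>

definition contraction :: "real \<Rightarrow> real" where
  "contraction b = 1 - (1 - b\<^sup>2 * \<mu>\<^sup>2) / card B"

lemma contraction_bounds:
  assumes "0 \<le> b" "b \<le> 1"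
  shows "0 \<le> contraction b" "contraction b \<le> 1"
proof -
  have "b\<^sup>2 * \<mu>\<^sup>2 \<le> 1 * 1"
    using assms \<mu>_nonneg \<mu>_less_1 by (intro mult_mono power_le_one) auto
  then show "contraction b \<le> 1" using card_B_pos by (simp add: contraction_def)
  have "(1 - b\<^sup>2 * \<mu>\<^sup>2) / card B \<le> 1" using card_B_pos
    by (simp add: divide_le_eq) (smt (verit) mult_nonneg_nonneg of_nat_1 of_nat_mono card_B_pos Suc_leI One_nat_def zero_le_power2)
  then show "0 \<le> contraction b" by (simp add: contraction_def)
qed

lemma expected_norm_sq:
  assumes "0 \<le> b" "b \<le> 1"
  shows "mean_words k (\<lambda>w. ennreal (norm_sq (damped (const_damping b w) d)))
    \<le> ennreal (contraction b ^ k * norm_sq d)"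
proof (rule nn_integral_words_le[where r="\<lambda>_ _. 0" and b=b and g="\<lambda>k d. contraction b ^ k * norm_sq d"])
  fix k d
  have "(\<Sum>x\<in>B. contraction b ^ k * norm_sq (damp b x d)) \<le> contraction b ^ k * ((card B - (1 - b\<^sup>2 * \<mu>\<^sup>2)) * norm_sq d)"
    unfolding sum_distrib_left[symmetric] using assms
    by (intro mult_left_mono sum_norm_sq_damp zero_le_power contraction_bounds)
  also have "card B - (1 - b\<^sup>2 * \<mu>\<^sup>2) = card B * contraction b"
    using card_B_pos by (simp add: contraction_def field_simps)
  finally show "(\<Sum>x\<in>B. 0 + contraction b ^ k * norm_sq (damp b x d)) \<le> card B * (contraction b ^ Suc k * norm_sq d)"
    by (simp add: mult_ac)
qed (use assms in \<open>auto intro!: mult_nonneg_nonneg zero_le_power contraction_bounds norm_sq_nonneg\<close>)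

text \<open>An update costs at most \<open>(1 - b)^2 / card B\<close> times the squared norm on
  average, and the mean squared norm does not grow. Its decay meanwhile is given away, leaving a
  bound linear in \<open>k\<close>.\<close>

lemma expected_cost:
  assumes "0 \<le> b" "b \<le> 1"
  shows "mean_words k (\<lambda>w. ennreal (cost (const_damping b w) d))
    \<le> ennreal ((1 - b)\<^sup>2 * k / card B * norm_sq d)"
proof (rule nn_integral_words_le[where b=b and r="\<lambda>x d. ((1 - b) * avg d x)\<^sup>2"
      and g="\<lambda>k d. (1 - b)\<^sup>2 * k / card B * norm_sq d"])
  fix k :: nat and d
  have 1: "(\<Sum>x\<in>B. ((1 - b) * avg d x)\<^sup>2) \<le> (1 - b)\<^sup>2 * norm_sq d"
  proof -
    have "\<mu>\<^sup>2 * norm_sq d \<le> 1 * norm_sq d"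
      using \<mu>_nonneg \<mu>_less_1 by (intro mult_right_mono power_le_one norm_sq_nonneg) auto
    with norm_sq_avg_le[of d] have "norm_sq (avg d) \<le> norm_sq d" by simp
    then have "(1 - b)\<^sup>2 * norm_sq (avg d) \<le> (1 - b)\<^sup>2 * norm_sq d"
      by (intro mult_left_mono) auto
    then show ?thesis by (simp add: power_mult_distrib norm_sq_def sum_distrib_left)
  qed
  have "b\<^sup>2 * \<mu>\<^sup>2 \<le> 1 * 1"
    using assms \<mu>_nonneg \<mu>_less_1 by (intro mult_mono power_le_one) auto
  then have "(card B - (1 - b\<^sup>2 * \<mu>\<^sup>2)) * norm_sq d \<le> card B * norm_sq d"
    by (intro mult_right_mono norm_sq_nonneg) auto
  with sum_norm_sq_damp[of b d] have "(\<Sum>x\<in>B. norm_sq (damp b x d)) \<le> card B * norm_sq d" by simp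
  then have 2: "(\<Sum>x\<in>B. (1 - b)\<^sup>2 * k / card B * norm_sq (damp b x d)) \<le> (1 - b)\<^sup>2 * k / card B * (card B * norm_sq d)"
    unfolding sum_distrib_left[symmetric] by (intro mult_left_mono) auto
  show "(\<Sum>x\<in>B. ((1 - b) * avg d x)\<^sup>2 + (1 - b)\<^sup>2 * k / card B * norm_sq (damp b x d))
      \<le> card B * ((1 - b)\<^sup>2 * Suc k / card B * norm_sq d)"
    unfolding sum.distrib using card_B_pos
    by (intro order.trans[OF add_mono[OF 1 2]]) (simp add: field_simps)
qed (auto intro!: mult_nonneg_nonneg divide_nonneg_nonneg norm_sq_nonneg simp flip: ennreal_plus simp: cost_nonneg)

lemma nonvisit_prob:
  assumes "x \<in> B"
  shows "emeasure (measure_pmf (words k)) {w. x \<notin> set w} = ennreal ((1 - 1 / card B) ^ k)"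
proof (induction k)
  case (Suc k)
  have *: "indicator {w. x \<notin> set w} (y # w) = (indicator (- {x}) y * indicator {w. x \<notin> set w} w :: ennreal)" for y w
    by (auto simp: indicator_def)
  have "emeasure (measure_pmf (words (Suc k))) {w. x \<notin> set w} =
     mean_words (Suc k) (\<lambda>w. indicator {w. x \<notin> set w} w)" by simp
  also have "\<dots> = (\<Sum>y\<in>B. ennreal (indicator (- {x}) y * (1 - 1 / card B) ^ k)) / card B"
    unfolding nn_integral_words_Suc *
    by (subst nn_integral_cmult) (auto simp: Suc indicator_def intro!: arg_cong2[where f="(/)"] sum.cong)
  also have "\<dots> = ennreal ((\<Sum>y\<in>B. indicator (- {x}) y * (1 - 1 / card B) ^ k) / card B)"
    using card_B_pos by (intro mean_ennreal) (auto simp: indicator_def)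
  also have "(\<Sum>y\<in>B. indicator (- {x}) y * (1 - 1 / card B) ^ k) = (card B - 1) * (1 - 1 / card B) ^ k"
  proof -
    have "(\<Sum>y\<in>B. indicator (- {x}) y :: real) = card (B - {x})"
      using finite_B by (simp add: indicator_def sum.If_cases Diff_eq Compl_eq)
    then show ?thesis using finite_B assms by (simp add: sum_distrib_right[symmetric])
  qed
  finally show ?case using card_B_pos by (simp add: field_simps of_nat_diff)
qed simp

text \<open>The union bound of the coupon collector problem.\<close>

lemma noncover_prob:
  "emeasure (measure_pmf (words k)) {w. \<not> B \<subseteq> set w} \<le> ennreal (card B * (1 - 1 / card B) ^ k)"
proof -
  have "emeasure (measure_pmf (words k)) {w. \<not> B \<subseteq> set w} = emeasure (measure_pmf (words k)) (\<Union>x\<in>B. {w. x \<notin> set w})"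
    by (intro arg_cong2[where f=emeasure]) auto
  also have "\<dots> \<le> (\<Sum>x\<in>B. emeasure (measure_pmf (words k)) {w. x \<notin> set w})"
    by (intro emeasure_subadditive_finite finite_B) auto
  also have "\<dots> = ennreal (card B * (1 - 1 / card B) ^ k)"
    using card_B_pos by (simp add: nonvisit_prob ennreal_mult ennreal_of_nat_eq_real_of_nat)
  finally show ?thesis .
qed

text \<open>The overlap is linear and \<phi> is an eigenfunction of the symmetric
  \<open>avg\<close>, so one uniform update multiplies the mean by a fixed factor. Nonnegative
  fields keep the overlap nonnegative, so that \<open>ennreal\<close> does not truncate it.\<close>

lemma expected_overlap:
  assumes "\<And>x. x \<in> B \<Longrightarrow> 0 \<le> d x"
  shows "mean_words k (\<lambda>w. ennreal (overlap (evolved w d)))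
    = ennreal ((1 - (1 - \<mu>) / card B) ^ k * overlap d)"
  using assms
proof (induction k arbitrary: d)
  case (Suc k)
  let ?c = "1 - (1 - \<mu>) / card B"
  have c: "0 \<le> ?c" using card_B_pos \<mu>_nonneg
    by (simp add: divide_le_eq)
  have nn: "0 \<le> damp 1 x d y" if "x \<in> B" "y \<in> B" for x y
    using damped_nonneg[of d y "[x]"] Suc.prems that by simp
  have nno: "0 \<le> overlap (damp 1 x d)" if "x \<in> B" for x
    unfolding overlap_def using nn[OF that] \<phi>_pos by (intro sum_nonneg mult_nonneg_nonneg) (auto intro: less_imp_le)
  have "mean_words (Suc k) (\<lambda>w. ennreal (overlap (evolved w d))) =
      (\<Sum>x\<in>B. ennreal (?c ^ k * overlap (damp 1 x d))) / card B"
    unfolding nn_integral_words_Suc using Suc.IH nn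
    by (intro arg_cong2[where f="(/)"] sum.cong refl) simp
  also have "\<dots> = ennreal ((\<Sum>x\<in>B. ?c ^ k * overlap (damp 1 x d)) / card B)"
    using nno c by (intro mean_ennreal) auto
  also have "(\<Sum>x\<in>B. ?c ^ k * overlap (damp 1 x d)) = ?c ^ k * (\<Sum>x\<in>B. overlap d - \<phi> x * (d x - avg d x))"
    by (simp add: sum_distrib_left overlap_damp)
  also have "(\<Sum>x\<in>B. overlap d - \<phi> x * (d x - avg d x)) = card B * (?c * overlap d)"
    unfolding sum_subtractf overlap_residual using card_B_pos by (simp add: field_simps)
  finally show ?case using card_B_pos by (simp add: mult_ac)
qed simp

text \<open>An update at \<open>x\<close> lowers the energy by \<open>(d x - avg d x)\<^sup>2\<close>, which pays for the fluctuation of the overlap.\<close>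

lemma expected_overlap_sq:
  assumes "2 \<le> card B"
  shows "mean_words k (\<lambda>w. ennreal ((overlap (evolved w d))\<^sup>2 + energy (evolved w d)))
    \<le> ennreal ((1 - 2 * (1 - \<mu>) / card B) ^ k * (overlap d)\<^sup>2 + energy d)"
proof -
  let ?c = "1 - 2 * (1 - \<mu>) / card B"
  \<comment> \<open>With two sites or more, twice the gap is at most \<open>card B\<close>; this is
    what keeps the factor nonnegative.\<close>
  have c: "0 \<le> ?c" "?c \<le> 1" using card_B_pos \<mu>_nonneg \<mu>_less_1 assms by (auto simp: divide_le_eq)
  show ?thesis
  proof (rule nn_integral_words_le[where r="\<lambda>_ _. 0" and b=1 and g="\<lambda>k d. ?c ^ k * (overlap d)\<^sup>2 + energy d"])
    fix k d
    let ?\<beta> = "\<Sum>x\<in>B. (d x - avg d x)\<^sup>2"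
    have "(\<Sum>x\<in>B. (overlap (damp 1 x d))\<^sup>2) \<le>
        (\<Sum>x\<in>B. (overlap d)\<^sup>2 - 2 * overlap d * (\<phi> x * (d x - avg d x)) + (d x - avg d x)\<^sup>2)"
    proof (intro sum_mono)
      fix x assume x: "x \<in> B"
      have "(\<phi> x)\<^sup>2 * (d x - avg d x)\<^sup>2 \<le> 1 * (d x - avg d x)\<^sup>2"
        using \<phi>_le_1[OF x] \<phi>_pos[OF x] by (intro mult_right_mono power_le_one) auto
      then show "(overlap (damp 1 x d))\<^sup>2 \<le> (overlap d)\<^sup>2 - 2 * overlap d * (\<phi> x * (d x - avg d x)) + (d x - avg d x)\<^sup>2"
        unfolding overlap_damp[OF x] power2_diff power_mult_distrib by (simp add: algebra_simps)
    qed
    also have "\<dots> = card B * (overlap d)\<^sup>2 - 2 * overlap d * (\<Sum>x\<in>B. \<phi> x * (d x - avg d x)) + ?\<beta>"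
      by (simp add: sum.distrib sum_subtractf sum_distrib_left)
    also note overlap_residual
    also have "card B * (overlap d)\<^sup>2 - 2 * overlap d * ((1 - \<mu>) * overlap d) + ?\<beta> = card B * ?c * (overlap d)\<^sup>2 + ?\<beta>"
      using card_B_pos by (simp add: power2_eq_square field_simps)
    finally have "?c ^ k * (\<Sum>x\<in>B. (overlap (damp 1 x d))\<^sup>2) \<le> ?c ^ k * (card B * ?c * (overlap d)\<^sup>2 + ?\<beta>)"
      using c by (intro mult_left_mono) auto
    \<comment> \<open>As \<open>?c ^ k\<close> is at most 1, at most \<open>?\<beta>\<close> is left
      over, and exactly this is what the energies lose in the next claim.\<close>
    also have "\<dots> \<le> card B * (?c ^ Suc k * (overlap d)\<^sup>2) + ?\<beta>"
    proof -
      have "?c ^ k * ?\<beta> \<le> 1 * ?\<beta>" using c by (intro mult_right_mono power_le_one sum_nonneg) auto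
      then show ?thesis by (simp add: algebra_simps)
    qed
    finally have 1: "?c ^ k * (\<Sum>x\<in>B. (overlap (damp 1 x d))\<^sup>2) \<le> card B * (?c ^ Suc k * (overlap d)\<^sup>2) + ?\<beta>" .
    have 2: "(\<Sum>x\<in>B. energy (damp 1 x d)) = card B * energy d - ?\<beta>"
      by (simp add: energy_damp sum_subtractf)
    show "(\<Sum>x\<in>B. 0 + (?c ^ k * (overlap (damp 1 x d))\<^sup>2 + energy (damp 1 x d))) \<le> card B * (?c ^ Suc k * (overlap d)\<^sup>2 + energy d)"
      using 1 2 by (simp add: sum.distrib sum_distrib_left[symmetric] distrib_left)
  qed (use c in \<open>auto intro!: add_nonneg_nonneg mult_nonneg_nonneg energy_nonneg\<close>)
qed

section \<open>The Gibbs measure\<close>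

abbreviation fields :: "('a \<Rightarrow> real) measure" where
  "fields \<equiv> PiM B (\<lambda>_. borel)"

abbreviation flat :: "('a \<Rightarrow> real) measure" where
  "flat \<equiv> PiM B (\<lambda>_. lborel)"

definition weight :: "('a \<Rightarrow> real) \<Rightarrow> real" where
  "weight h = exp (- energy h / 2)"

definition partition_fun :: ennreal where
  "partition_fun = (\<integral>\<^sup>+h. ennreal (weight h) \<partial>flat)"

definition gibbs :: "('a \<Rightarrow> real) measure" where
  "gibbs = density flat (\<lambda>h. ennreal (weight h) / partition_fun)"

text \<open>The stationary variance of the overlap: the covariance is the inverse of the identity
  minus \<open>avg\<close>, which acts on \<phi> as division by \<open>1 - \<mu>\<close>.\<close>

definition overlap_var :: real where
  "overlap_var = norm_sq \<phi> / (1 - \<mu>)"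

lemma sets_flat[measurable_cong]: "sets flat = sets fields"
  by (intro sets_PiM_cong) simp_all

lemma sets_gibbs[measurable_cong, simp]: "sets gibbs = sets fields"
  by (simp add: gibbs_def sets_flat)

lemma space_gibbs[simp]: "space gibbs = space fields"
  by (simp add: gibbs_def space_PiM)

lemma component_measurable: "x \<in> B \<Longrightarrow> (\<lambda>h. h x) \<in> borel_measurable fields"
  by measurable

lemma avg_measurable[measurable]: "(\<lambda>h. avg h x) \<in> borel_measurable fields"
  unfolding avg_def by (intro borel_measurable_sum borel_measurable_times component_measurable) auto

lemma energy_measurable[measurable]: "energy \<in> borel_measurable fields"
  unfolding energy_def[abs_def]
  by (intro borel_measurable_sum borel_measurable_times borel_measurable_diff component_measurable avg_measurable) auto

lemma overlap_measurable[measurable]: "overlap \<in> borel_measurable fields"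
  unfolding overlap_def[abs_def]
  by (intro borel_measurable_sum borel_measurable_times component_measurable) auto

lemma norm_sq_measurable[measurable]: "norm_sq \<in> borel_measurable fields"
  unfolding norm_sq_def[abs_def]
  by (intro borel_measurable_sum borel_measurable_power component_measurable) auto

lemma weight_measurable[measurable]: "weight \<in> borel_measurable fields"
  unfolding weight_def[abs_def] by measurable

lemma nn_integral_gaussian_weight_finite:
  assumes "0 < (l :: real)"
  shows "(\<integral>\<^sup>+z. ennreal (exp (- l * z\<^sup>2 / 2)) \<partial>lborel) < \<infinity>"
proof -
  let ?\<sigma> = "1 / sqrt l"
  interpret prob_space "density lborel (normal_density 0 ?\<sigma>)"
    using assms by (intro prob_space_normal_density) simp
  have "exp (- l * z\<^sup>2 / 2) = sqrt (2 * pi * ?\<sigma>\<^sup>2) * normal_density 0 ?\<sigma> z" for z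
    using assms by (simp add: normal_density_def power_divide field_simps)
  then have "(\<integral>\<^sup>+z. ennreal (exp (- l * z\<^sup>2 / 2)) \<partial>lborel) =
      (\<integral>\<^sup>+z. ennreal (sqrt (2 * pi * ?\<sigma>\<^sup>2)) * ennreal (normal_density 0 ?\<sigma> z) \<partial>lborel)"
    by (simp add: ennreal_mult)
  also have "\<dots> = ennreal (sqrt (2 * pi * ?\<sigma>\<^sup>2)) * (\<integral>\<^sup>+z. ennreal (normal_density 0 ?\<sigma> z) \<partial>lborel)"
    by (rule nn_integral_cmult) simp
  also have "(\<integral>\<^sup>+z. ennreal (normal_density 0 ?\<sigma> z) \<partial>lborel) = 1"
    using emeasure_space_1 by (simp add: emeasure_density)
  finally show ?thesis by (simp add: ennreal_mult_less_top)
qed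

text \<open>The spectral gap inequality dominates the weight by a product of one-dimensional
  Gaussian weights.\<close>

lemma partition_fun_finite: "partition_fun < \<infinity>"
proof -
  interpret product_sigma_finite "\<lambda>_::'a. lborel :: real measure" ..
  have "partition_fun \<le> (\<integral>\<^sup>+h. (\<Prod>x\<in>B. ennreal (exp (- (1 - \<mu>) * (h x)\<^sup>2 / 2))) \<partial>flat)"
    unfolding partition_fun_def
  proof (intro nn_integral_mono)
    fix h :: "'a \<Rightarrow> real"
    have "weight h \<le> exp (- ((1 - \<mu>) * norm_sq h) / 2)"
      using energy_ge[of h] by (simp add: weight_def)
    also have "- ((1 - \<mu>) * norm_sq h) / 2 = (\<Sum>x\<in>B. - (1 - \<mu>) * (h x)\<^sup>2 / 2)"
      by (simp add: norm_sq_def sum_distrib_left sum_negf[symmetric] sum_divide_distrib algebra_simps)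
    also have "exp \<dots> = (\<Prod>x\<in>B. exp (- (1 - \<mu>) * (h x)\<^sup>2 / 2))"
      by (simp add: exp_sum finite_B)
    finally show "ennreal (weight h) \<le> (\<Prod>x\<in>B. ennreal (exp (- (1 - \<mu>) * (h x)\<^sup>2 / 2)))"
      by (simp add: prod_ennreal ennreal_leI)
  qed
  also have "\<dots> = (\<Prod>x\<in>B. \<integral>\<^sup>+z. ennreal (exp (- (1 - \<mu>) * z\<^sup>2 / 2)) \<partial>lborel)"
    by (intro product_nn_integral_prod finite_B) simp
  also have "\<dots> < \<infinity>"
    using nn_integral_gaussian_weight_finite[of "1 - \<mu>"] \<mu>_less_1
    by (simp add: ennreal_prod_eq_top power_less_top_ennreal)
  finally show ?thesis .
qed

lemma partition_fun_pos: "partition_fun \<noteq> 0"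
proof
  interpret product_sigma_finite "\<lambda>_::'a. lborel :: real measure" ..
  assume "partition_fun = 0"
  then have "AE h in flat. ennreal (weight h) = 0"
    unfolding partition_fun_def by (subst (asm) nn_integral_0_iff_AE) auto
  then have "AE h in flat. False"
    by (simp add: weight_def)
  then have "emeasure flat (space flat) = 0"
    by (simp add: AE_iff_measurable[OF sets.top])
  moreover have "emeasure flat (space flat) = (\<Prod>x\<in>B. emeasure lborel (UNIV :: real set))"
    unfolding space_PiM using emeasure_PiM[OF finite_B, of "\<lambda>_. UNIV"] by simp
  ultimately show False by (simp add: finite_B)
qed

lemma nn_integral_gibbs:
  assumes [measurable]: "f \<in> borel_measurable fields"
  shows "(\<integral>\<^sup>+h. f h \<partial>gibbs) = (\<integral>\<^sup>+h. f h * ennreal (weight h) \<partial>flat) / partition_fun"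
proof -
  have "(\<integral>\<^sup>+h. f h \<partial>gibbs) = (\<integral>\<^sup>+h. f h * ennreal (weight h) / partition_fun \<partial>flat)"
    unfolding gibbs_def by (subst nn_integral_density) (auto simp: ennreal_times_divide mult_ac)
  also have "\<dots> = (\<integral>\<^sup>+h. f h * ennreal (weight h) \<partial>flat) / partition_fun"
    by (rule nn_integral_divide) measurable
  finally show ?thesis .
qed

lemma prob_space_gibbs: "prob_space gibbs"
proof
  have "emeasure gibbs (space gibbs) = (\<integral>\<^sup>+h. 1 \<partial>gibbs)" by simp
  also have "\<dots> = 1"
    unfolding nn_integral_gibbs[OF borel_measurable_const]
    using partition_fun_finite partition_fun_pos by (simp add: partition_fun_def[symmetric])
  finally show "emeasure gibbs (space gibbs) = 1" .
qed

lemma avg_cong: "(\<And>x. x \<in> B \<Longrightarrow> d x = d' x) \<Longrightarrow> avg d x = avg d' x"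
  by (simp add: avg_def)

lemma energy_cong: "(\<And>x. x \<in> B \<Longrightarrow> d x = d' x) \<Longrightarrow> energy d = energy d'"
  unfolding energy_def by (intro sum.cong refl) (simp add: avg_cong[of d d'])

lemma energy_scale: "energy (\<lambda>x. c * d x) = c\<^sup>2 * energy d"
proof -
  have "avg (\<lambda>x. c * d x) x = c * avg d x" for x
    using avg_linear[of c d 0 d x] by simp
  then show ?thesis
    by (simp add: energy_def sum_distrib_left power2_eq_square algebra_simps)
qed

lemma energy_add_eigen:
  "energy (\<lambda>x. a * \<phi> x + d x) = energy d + (1 - \<mu>) * (2 * a * overlap d + a\<^sup>2 * norm_sq \<phi>)"
proof -
  have avg: "avg (\<lambda>x. a * \<phi> x + d x) x = a * (\<mu> * \<phi> x) + avg d x" if "x \<in> B" for x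
    using avg_linear[of a \<phi> 1 d x] that by (simp add: avg_eigen)
  have "energy (\<lambda>x. a * \<phi> x + d x) = (\<Sum>x\<in>B. (a * \<phi> x + d x) * (a * \<phi> x + d x - a * (\<mu> * \<phi> x) - avg d x))"
    unfolding energy_def by (intro sum.cong refl) (simp add: avg)
  also have "\<dots> = (\<Sum>x\<in>B. d x * (d x - avg d x) + a * (1 - \<mu>) * (\<phi> x * d x) + a * (\<phi> x * (d x - avg d x)) + (1 - \<mu>) * a\<^sup>2 * (\<phi> x)\<^sup>2)"
    by (intro sum.cong refl) (simp add: power2_eq_square algebra_simps)
  also have "\<dots> = energy d + a * (1 - \<mu>) * overlap d + a * ((1 - \<mu>) * overlap d) + (1 - \<mu>) * a\<^sup>2 * norm_sq \<phi>"
    unfolding sum.distrib sum_distrib_left[symmetric] overlap_residual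
    by (simp add: energy_def overlap_def norm_sq_def)
  finally show ?thesis by (simp add: algebra_simps)
qed

lemma gibbs_symmetric:
  assumes [measurable]: "f \<in> borel_measurable fields"
  shows "(\<integral>\<^sup>+h. f h \<partial>gibbs) = (\<integral>\<^sup>+h. f (\<lambda>x\<in>B. - h x) \<partial>gibbs)"
proof -
  have [measurable]: "(\<lambda>h. \<lambda>x\<in>B. - h x) \<in> measurable fields fields"
    by (intro measurable_restrict borel_measurable_uminus component_measurable)
  have w: "weight (\<lambda>x\<in>B. - h x) = weight h" for h
    using energy_scale[of "-1" h] energy_cong[of "\<lambda>x\<in>B. - h x" "\<lambda>x. - h x"] by (simp add: weight_def)
  have "(\<integral>\<^sup>+h. f h * ennreal (weight h) \<partial>flat) = (\<integral>\<^sup>+h. f (\<lambda>x\<in>B. - h x) * ennreal (weight h) \<partial>flat)"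
    by (subst nn_integral_PiM_lborel_affine[where c="-1" and v="\<lambda>_. 0"]) (simp_all add: finite_B w[simplified])
  moreover have "(\<lambda>h. f (\<lambda>x\<in>B. - h x)) \<in> borel_measurable fields" by measurable
  ultimately show ?thesis using assms by (simp add: nn_integral_gibbs)
qed

text \<open>Completing the square: a translation of the partition integral along \<phi> changes the
  energy by a multiple of the overlap and a constant, because \<phi> is an eigenfunction. So the
  exponential moment is read off from translation invariance.\<close>

lemma gibbs_overlap_mgf:
  "(\<integral>\<^sup>+h. ennreal (exp (\<theta> * overlap h)) \<partial>gibbs) = ennreal (exp (\<theta>\<^sup>2 * overlap_var / 2))"
proof -
  \<comment> \<open>With this coefficient the term linear in \<open>h\<close> contributes
    \<open>exp (\<theta> * overlap h)\<close> to the translated weight.\<close>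
  define a where "a = - \<theta> / (1 - \<mu>)"
  have l: "0 < 1 - \<mu>" using \<mu>_less_1 by simp
  have e: "energy (\<lambda>x\<in>B. a * \<phi> x + 1 * h x) = energy h - 2 * \<theta> * overlap h + \<theta>\<^sup>2 * overlap_var" for h
  proof -
    have "energy (\<lambda>x\<in>B. a * \<phi> x + 1 * h x) = energy (\<lambda>x. a * \<phi> x + h x)"
      by (rule energy_cong) simp
    also have "\<dots> = energy h - 2 * \<theta> * overlap h + \<theta>\<^sup>2 * overlap_var"
    proof -
      have al: "(1 - \<mu>) * a = - \<theta>" using l by (simp add: a_def)
      have "(1 - \<mu>) * (2 * a * overlap h + a\<^sup>2 * norm_sq \<phi>) = 2 * ((1 - \<mu>) * a) * overlap h + ((1 - \<mu>) * a) * a * norm_sq \<phi>"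
        by (simp add: power2_eq_square algebra_simps)
      also have "\<dots> = - 2 * \<theta> * overlap h + \<theta>\<^sup>2 * overlap_var"
        unfolding al by (simp add: a_def overlap_var_def power2_eq_square)
      finally show ?thesis by (simp add: energy_add_eigen)
    qed
    finally show ?thesis .
  qed
  have w: "weight (\<lambda>x\<in>B. a * \<phi> x + 1 * h x) = exp (- (\<theta>\<^sup>2 * overlap_var / 2)) * (exp (\<theta> * overlap h) * weight h)" for h
    unfolding weight_def e exp_add[symmetric] by (simp add: algebra_simps diff_divide_distrib add_divide_distrib)
  have "partition_fun = (\<integral>\<^sup>+h. ennreal (weight (\<lambda>x\<in>B. a * \<phi> x + 1 * h x)) \<partial>flat)"
    unfolding partition_fun_def
    by (subst nn_integral_PiM_lborel_affine[where c=1 and v="\<lambda>x. a * \<phi> x"]) (simp_all add: finite_B)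
  also have "\<dots> = ennreal (exp (- (\<theta>\<^sup>2 * overlap_var / 2))) * (\<integral>\<^sup>+h. ennreal (exp (\<theta> * overlap h)) * ennreal (weight h) \<partial>flat)"
    unfolding w by (subst nn_integral_cmult[symmetric]) (simp_all add: ennreal_mult weight_def)
  finally have Z: "partition_fun = ennreal (exp (- (\<theta>\<^sup>2 * overlap_var / 2))) * (\<integral>\<^sup>+h. ennreal (exp (\<theta> * overlap h)) * ennreal (weight h) \<partial>flat)" .
  have "ennreal (exp (\<theta>\<^sup>2 * overlap_var / 2)) * partition_fun = (\<integral>\<^sup>+h. ennreal (exp (\<theta> * overlap h)) * ennreal (weight h) \<partial>flat)"
    unfolding Z mult.assoc[symmetric] ennreal_mult[OF exp_ge_zero exp_ge_zero, symmetric] exp_add[symmetric] by simp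
  then show ?thesis
    using partition_fun_finite partition_fun_pos
    by (subst nn_integral_gibbs) (simp_all add: ennreal_mult_divide_eq flip: \<open>ennreal (exp (\<theta>\<^sup>2 * overlap_var / 2)) * partition_fun = _\<close>)
qed

lemma overlap_var_pos: "0 < overlap_var"
  unfolding overlap_var_def norm_sq_def
  by (intro divide_pos_pos sum_pos zero_less_power \<phi>_pos finite_B B_nonempty) (use \<mu>_less_1 in auto)

lemma gibbs_overlap_tail:
  assumes "\<bar>s\<bar> = 1" "0 \<le> K"
  shows "emeasure gibbs {h \<in> space fields. K \<le> s * overlap h} \<le> ennreal (exp (- (K\<^sup>2 / (2 * overlap_var))))"
proof -
  \<comment> \<open>The minimiser of the Chernoff exponent
    \<open>- \<theta> * K + \<theta>^2 * overlap_var / 2\<close>.\<close>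
  define \<theta> where "\<theta> = K / overlap_var"
  have s2: "s\<^sup>2 = 1" using assms(1) by (metis power2_abs power_one)
  have \<theta>: "0 \<le> \<theta>" using assms overlap_var_pos by (simp add: \<theta>_def)
  have "emeasure gibbs {h \<in> space fields. K \<le> s * overlap h} = (\<integral>\<^sup>+h. indicator {h \<in> space fields. K \<le> s * overlap h} h \<partial>gibbs)"
    by (subst nn_integral_indicator) simp_all
  also have "\<dots> \<le> (\<integral>\<^sup>+h. ennreal (exp (- \<theta> * K)) * ennreal (exp (s * \<theta> * overlap h)) \<partial>gibbs)"
  proof (intro nn_integral_mono)
    fix h
    have "1 \<le> ennreal (exp (\<theta> * (s * overlap h - K)))" if "K \<le> s * overlap h"
      using that \<theta> by simp
    then show "indicator {h \<in> space fields. K \<le> s * overlap h} h \<le> ennreal (exp (- \<theta> * K)) * ennreal (exp (s * \<theta> * overlap h))"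
      by (auto simp: indicator_def ennreal_mult[symmetric] exp_add[symmetric] algebra_simps)
  qed
  also have "\<dots> = ennreal (exp (- \<theta> * K)) * ennreal (exp ((s * \<theta>)\<^sup>2 * overlap_var / 2))"
    unfolding gibbs_overlap_mgf[symmetric] by (rule nn_integral_cmult) simp
  also have "\<dots> = ennreal (exp (- \<theta> * K + \<theta>\<^sup>2 * overlap_var / 2))"
    by (simp add: ennreal_mult[symmetric] exp_add[symmetric] power_mult_distrib s2)
  also have "- \<theta> * K + \<theta>\<^sup>2 * overlap_var / 2 = - (K\<^sup>2 / (2 * overlap_var))"
    using overlap_var_pos by (simp add: \<theta>_def power2_eq_square field_simps)
  finally show ?thesis .
qed

text \<open>Against the weight, \<open>exp (energy h / 4)\<close> leaves half of the exponent;
  scaling by \<open>sqrt 2\<close> restores it and the Jacobian is \<open>sqrt 2 ^ card B\<close>.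
  Markov's inequality and the spectral gap turn this moment into a tail of the norm.\<close>

lemma gibbs_norm_tail:
  "emeasure gibbs {h \<in> space fields. R \<le> norm_sq h} \<le> ennreal (exp (- (1 - \<mu>) * R / 4) * sqrt 2 ^ card B)"
proof -
  have w: "weight (\<lambda>x\<in>B. 0 + sqrt 2 * h x) = weight h * weight h" for h
    using energy_scale[of "sqrt 2" h] energy_cong[of "\<lambda>x\<in>B. sqrt 2 * h x" "\<lambda>x. sqrt 2 * h x"]
    by (simp add: weight_def exp_add[symmetric])
  let ?g = "\<lambda>h. exp (energy h / 4)"
  have "(\<integral>\<^sup>+h. ennreal (?g h) * ennreal (weight h) \<partial>flat) =
      ennreal (sqrt 2 ^ card B) * (\<integral>\<^sup>+h. ennreal (?g (\<lambda>x\<in>B. 0 + sqrt 2 * h x)) * ennreal (weight (\<lambda>x\<in>B. 0 + sqrt 2 * h x)) \<partial>flat)"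
    by (subst nn_integral_PiM_lborel_affine[where c="sqrt 2" and v="\<lambda>_. 0"]) (simp_all add: finite_B)
  also have "(\<lambda>h. ennreal (?g (\<lambda>x\<in>B. 0 + sqrt 2 * h x)) * ennreal (weight (\<lambda>x\<in>B. 0 + sqrt 2 * h x))) = (\<lambda>h. ennreal (weight h))"
  proof
    fix h :: "'a \<Rightarrow> real"
    have "energy (\<lambda>x\<in>B. 0 + sqrt 2 * h x) = 2 * energy h"
      using energy_scale[of "sqrt 2" h] energy_cong[of "\<lambda>x\<in>B. sqrt 2 * h x" "\<lambda>x. sqrt 2 * h x"] by simp
    then show "ennreal (?g (\<lambda>x\<in>B. 0 + sqrt 2 * h x)) * ennreal (weight (\<lambda>x\<in>B. 0 + sqrt 2 * h x)) = ennreal (weight h)"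
      unfolding w by (simp add: weight_def ennreal_mult[symmetric] exp_add[symmetric])
  qed
  finally have "(\<integral>\<^sup>+h. ennreal (?g h) \<partial>gibbs) = ennreal (sqrt 2 ^ card B)"
    using partition_fun_finite partition_fun_pos
    by (subst nn_integral_gibbs) (simp_all add: partition_fun_def[symmetric] ennreal_mult_divide_eq)
  then have m: "(\<integral>\<^sup>+h. ennreal (exp (- (1 - \<mu>) * R / 4)) * ennreal (?g h) \<partial>gibbs) = ennreal (exp (- (1 - \<mu>) * R / 4) * sqrt 2 ^ card B)"
    by (subst nn_integral_cmult) (simp_all add: ennreal_mult)
  have "emeasure gibbs {h \<in> space fields. R \<le> norm_sq h} = (\<integral>\<^sup>+h. indicator {h \<in> space fields. R \<le> norm_sq h} h \<partial>gibbs)"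
    by (subst nn_integral_indicator) simp_all
  also have "\<dots> \<le> (\<integral>\<^sup>+h. ennreal (exp (- (1 - \<mu>) * R / 4)) * ennreal (?g h) \<partial>gibbs)"
  proof (intro nn_integral_mono)
    fix h
    have "1 \<le> ennreal (exp (- (1 - \<mu>) * R / 4 + energy h / 4))" if "R \<le> norm_sq h"
    proof -
      have "(1 - \<mu>) * R \<le> (1 - \<mu>) * norm_sq h" using that \<mu>_less_1 by (intro mult_left_mono) auto
      with energy_ge[of h] have "(1 - \<mu>) * R \<le> energy h" by simp
      then show ?thesis by (simp add: minus_mult_left[symmetric] del: minus_diff_eq)
    qed
    then show "indicator {h \<in> space fields. R \<le> norm_sq h} h \<le> ennreal (exp (- (1 - \<mu>) * R / 4)) * ennreal (?g h)"
      by (auto simp: indicator_def ennreal_mult[symmetric] exp_add[symmetric])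
  qed
  finally show ?thesis using m by simp
qed

section \<open>The heat-bath dynamics along a word of sites\<close>

definition resample :: "'a \<Rightarrow> real \<Rightarrow> ('a \<Rightarrow> real) \<Rightarrow> ('a \<Rightarrow> real)" where
  "resample x z h = h(x := avg h x + z)"

text \<open>The operator of the dynamics along a fixed word, the first letter being the earliest
  update. Acting on functions by recursion, it makes every comparison of two starting fields an
  induction on the word.\<close>

primrec transition :: "'a list \<Rightarrow> (('a \<Rightarrow> real) \<Rightarrow> ennreal) \<Rightarrow> ('a \<Rightarrow> real) \<Rightarrow> ennreal" where
  "transition [] f h = f h"
| "transition (x # w) f h = (\<integral>\<^sup>+z. transition w f (resample x z h) \<partial>std_gauss)"

lemma resample_measurable:
  assumes "x \<in> B"
  shows "(\<lambda>(z, h). resample x z h) \<in> measurable (borel \<Otimes>\<^sub>M fields) fields"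
proof -
  have "(\<lambda>w. (snd w)(x := avg (snd w) x + fst w)) \<in> measurable (borel \<Otimes>\<^sub>M fields) fields"
    by (rule measurable_fun_upd[where J=B]) (use assms in auto)
  then show ?thesis by (simp add: resample_def case_prod_beta')
qed

lemma resample_measurable': "x \<in> B \<Longrightarrow> h \<in> space fields \<Longrightarrow> (\<lambda>z. resample x z h) \<in> measurable borel fields"
  using measurable_compose[OF measurable_Pair2' resample_measurable, of h x] by simp

lemma resample_space: "x \<in> B \<Longrightarrow> h \<in> space fields \<Longrightarrow> resample x z h \<in> space fields"
  by (auto simp: resample_def space_PiM PiE_def extensional_def)

lemma transition_measurable:
  assumes "set w \<subseteq> B" "f \<in> borel_measurable fields"
  shows "transition w f \<in> borel_measurable fields"
  using assms(1)
proof (induction w)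
  case (Cons x w)
  interpret prob_space std_gauss by (rule prob_space_std_gauss)
  have m: "(\<lambda>(z, h). transition w f (resample x z h)) \<in> borel_measurable (std_gauss \<Otimes>\<^sub>M fields)"
    using measurable_compose[OF resample_measurable, of x "transition w f"] Cons
    by (simp add: case_prod_beta')
  have "(\<lambda>h. \<integral>\<^sup>+z. transition w f (resample x z h) \<partial>std_gauss) \<in> borel_measurable fields"
    using measurable_compose[OF measurable_pair_swap' m]
    by (intro borel_measurable_nn_integral) (simp add: case_prod_beta')
  then show ?case by simp
qed (use assms(2) in \<open>simp add: transition_def\<close>)

lemma transition_section_measurable:
  assumes "x \<in> B" "set w \<subseteq> B" "f \<in> borel_measurable fields" "h \<in> space fields"
  shows "(\<lambda>z. transition w f (resample x z h)) \<in> borel_measurable borel"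
  by (rule measurable_compose[OF resample_measurable' transition_measurable]) (use assms in auto)

text \<open>Given the other heights, the height at \<open>x\<close> is normal with variance 1 around
  their average, and this is the law from which \<open>resample\<close> draws.\<close>

lemma gibbs_resample:
  assumes x: "x \<in> B" and f[measurable]: "f \<in> borel_measurable fields"
  shows "(\<integral>\<^sup>+h. \<integral>\<^sup>+z. f (resample x z h) \<partial>std_gauss \<partial>gibbs) = (\<integral>\<^sup>+h. f h \<partial>gibbs)"
proof -
  interpret product_sigma_finite "\<lambda>_::'a. lborel :: real measure" ..
  define J where "J = B - {x}"
  have B: "B = insert x J" "x \<notin> J" "finite J" using x finite_B by (auto simp: J_def)
  let ?F = "\<lambda>h. \<integral>\<^sup>+z. f (resample x z h) \<partial>std_gauss"
  have F[measurable]: "?F \<in> borel_measurable fields"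
    using transition_measurable[of "[x]" f] x by (simp add: transition_def)
  have split: "(\<integral>\<^sup>+h. g h \<partial>flat) = (\<integral>\<^sup>+h. \<integral>\<^sup>+y. g (h(x := y)) \<partial>lborel \<partial>PiM J (\<lambda>_. lborel))"
    if [measurable]: "g \<in> borel_measurable fields" for g
  proof -
    have "g \<in> borel_measurable (PiM (insert x J) (\<lambda>_. lborel))"
      using that by (simp add: B(1)[symmetric])
    then have "(\<integral>\<^sup>+h. g h \<partial>PiM (insert x J) (\<lambda>_. lborel)) =
        (\<integral>\<^sup>+h. \<integral>\<^sup>+y. g (h(x := y)) \<partial>lborel \<partial>PiM J (\<lambda>_. lborel))"
      by (intro product_nn_integral_insert B) simp_all
    then show ?thesis by (simp only: B(1)[symmetric])
  qed
  have "(\<integral>\<^sup>+y. ?F (h(x := y)) * ennreal (weight (h(x := y))) \<partial>lborel) =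
      (\<integral>\<^sup>+y. f (h(x := y)) * ennreal (weight (h(x := y))) \<partial>lborel)"
    if h: "h \<in> space (PiM J (\<lambda>_. lborel))" for h
  proof -
    define a where "a = avg h x"
    have avg: "avg (h(x := y)) x = a" for y
      using x by (simp add: avg_upd p_diag a_def)
    have e: "energy (h(x := y)) = energy (h(x := a)) + (y - a)\<^sup>2" for y
      using energy_upd[OF x, of "h(x := a)" "y - a"] by (simp add: avg)
    \<comment> \<open>The weight at the conditional mean, times the constant that normalises the
      density.\<close>
    define c where "c = ennreal (weight (h(x := a)) * sqrt (2 * pi))"
    have w: "ennreal (weight (h(x := y))) = c * ennreal (std_normal_density (y - a))" for y
    proof -
      have "weight (h(x := y)) = weight (h(x := a)) * exp (- ((y - a)\<^sup>2 / 2))"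
        unfolding weight_def e[of y] exp_add[symmetric] by (simp add: diff_divide_distrib)
      also have "\<dots> = weight (h(x := a)) * sqrt (2 * pi) * std_normal_density (y - a)"
        by (simp add: normal_density_def)
      finally show ?thesis by (simp add: c_def weight_def ennreal_mult)
    qed
    have r: "resample x z (h(x := y)) = h(x := a + z)" for y z
      by (simp add: resample_def avg)
    have [measurable]: "(\<lambda>y. f (h(x := y))) \<in> borel_measurable borel"
    proof -
      have "(\<lambda>y. h(x := y)) \<in> measurable borel fields"
        by (rule measurable_fun_upd[where J=J]) (use B h in \<open>auto simp: space_PiM\<close>)
      then show ?thesis by (rule measurable_compose) simp
    qed
    have "(\<integral>\<^sup>+y. f (h(x := y)) * ennreal (weight (h(x := y))) \<partial>lborel) =
        c * (\<integral>\<^sup>+y. f (h(x := y)) * ennreal (std_normal_density (y - a)) \<partial>lborel)"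
      unfolding w by (subst nn_integral_cmult[symmetric]) (auto simp: mult_ac)
    also have "(\<integral>\<^sup>+y. f (h(x := y)) * ennreal (std_normal_density (y - a)) \<partial>lborel) =
        (\<integral>\<^sup>+z. f (h(x := a + z)) * ennreal (std_normal_density z) \<partial>lborel)"
      by (subst nn_integral_real_affine[where c=1 and t=a]) auto
    \<comment> \<open>\<open>h\<close> is a configuration on \<open>J\<close> only. Since
      \<open>h(x := h x) = h\<close>, the instance of \<open>r\<close> says that resampling ignores
      whatever value stands at \<open>x\<close>.\<close>
    also have "\<dots> = ?F h"
      using r[of _ "h x"] by (simp add: nn_integral_density mult_ac)
    finally have R: "(\<integral>\<^sup>+y. f (h(x := y)) * ennreal (weight (h(x := y))) \<partial>lborel) = c * ?F h" .
    have FF: "?F (h(x := y)) = ?F h" for y using r[of _ y] r[of _ "h x"] by simp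
    have "(\<integral>\<^sup>+y. ?F (h(x := y)) * ennreal (weight (h(x := y))) \<partial>lborel) =
       (\<integral>\<^sup>+y. c * ?F h * ennreal (std_normal_density (y - a)) \<partial>lborel)"
      unfolding w FF by (simp add: mult_ac)
    also have "\<dots> = c * ?F h * (\<integral>\<^sup>+y. ennreal (std_normal_density (y - a)) \<partial>lborel)"
      by (rule nn_integral_cmult) simp
    also have "(\<integral>\<^sup>+y. ennreal (std_normal_density (y - a)) \<partial>lborel) = (\<integral>\<^sup>+z. ennreal (std_normal_density z) \<partial>lborel)"
      by (subst nn_integral_real_affine[where c=1 and t=a]) auto
    also have "\<dots> = 1"
      using emeasure_std_gauss_UNIV by (simp add: emeasure_density del: emeasure_std_gauss_UNIV)
    finally show ?thesis by (simp only: R mult_1_right)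
  qed
  then have "(\<integral>\<^sup>+h. ?F h * ennreal (weight h) \<partial>flat) = (\<integral>\<^sup>+h. f h * ennreal (weight h) \<partial>flat)"
    by (simp add: split cong: nn_integral_cong)
  then show ?thesis by (simp add: nn_integral_gibbs)
qed

lemma gibbs_transition:
  assumes "set w \<subseteq> B" "f \<in> borel_measurable fields"
  shows "(\<integral>\<^sup>+h. transition w f h \<partial>gibbs) = (\<integral>\<^sup>+h. f h \<partial>gibbs)"
  using assms(1)
proof (induction w)
  case (Cons x w)
  then show ?case
    using gibbs_resample[of x "transition w f"] transition_measurable[of w f] assms(2) by simp
qed (auto intro: nn_integral_cong)

lemma transition_const: "transition w (\<lambda>_. c) h = c"
proof -
  interpret prob_space std_gauss by (rule prob_space_std_gauss)
  show ?thesis by (induction w arbitrary: h) (simp_all add: emeasure_space_1)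
qed

lemma transition_affine:
  assumes "set w \<subseteq> B" "f \<in> borel_measurable fields" "h \<in> space fields"
  shows "transition w (\<lambda>h. a + c * f h) h = a + c * transition w f h"
  using assms(1,3)
proof (induction w arbitrary: h)
  case (Cons x w)
  interpret prob_space std_gauss by (rule prob_space_std_gauss)
  have [measurable]: "(\<lambda>z. transition w f (resample x z h)) \<in> borel_measurable borel"
    using Cons assms(2) by (intro transition_section_measurable) auto
  have "transition (x # w) (\<lambda>h. a + c * f h) h = (\<integral>\<^sup>+z. a + c * transition w f (resample x z h) \<partial>std_gauss)"
    using Cons by (simp add: resample_space)
  also have "\<dots> = a + c * (\<integral>\<^sup>+z. transition w f (resample x z h) \<partial>std_gauss)"
    by (simp add: nn_integral_add nn_integral_cmult emeasure_space_1)
  finally show ?case by simp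
qed simp

text \<open>With equal Gaussians the difference at \<open>x\<close> would become its average; the
  shift takes away the share \<open>1 - b\<close> of it.\<close>

lemma resample_diff:
  "(\<lambda>y. resample x (z - (1 - b) * avg (\<lambda>y. h' y - h y) x) h' y - resample x z h y) = damp b x (\<lambda>y. h' y - h y)"
proof -
  have "avg (\<lambda>y. h' y - h y) x = avg h' x - avg h x"
    using avg_linear[of 1 h' "-1" h x] by simp
  then show ?thesis by (auto simp: resample_def damp_def fun_eq_iff algebra_simps)
qed

text \<open>The synchronous coupling: with the same Gaussians the difference of the two fields
  evolves deterministically, so a comparison of final fields with this difference passes to the
  means.\<close>

lemma transition_coupling:
  assumes "h \<in> space fields" "h' \<in> space fields" "set w \<subseteq> B"
    and "\<And>g g'. g \<in> space fields \<Longrightarrow> g' \<in> space fields \<Longrightarrow>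
      (\<lambda>x. g' x - g x) = evolved w (\<lambda>x. h' x - h x) \<Longrightarrow> f g \<le> f' g'"
  shows "transition w f h \<le> transition w f' h'"
  using assms
proof (induction w arbitrary: h h')
  case (Cons x w)
  have "transition w f (resample x z h) \<le> transition w f' (resample x z h')" for z
  proof (rule Cons.IH)
    fix g g' assume "g \<in> space fields" "g' \<in> space fields"
      "(\<lambda>y. g' y - g y) = evolved w (\<lambda>y. resample x z h' y - resample x z h y)"
    then show "f g \<le> f' g'"
      using resample_diff[of x z 1 h' h] by (intro Cons.prems) simp_all
  qed (use Cons.prems in \<open>auto intro: resample_space\<close>)
  then show ?case by (auto intro: nn_integral_mono)
qed simp

text \<open>The difference of two fields is damped by shifting the Gaussian used at each update; the cost of
  the shifts is paid by Cauchy--Schwarz.\<close>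

lemma transition_harnack:
  assumes "h \<in> space fields" "h' \<in> space fields" "set (map fst cs) \<subseteq> B" "f \<in> borel_measurable fields"
    and "\<And>x. x \<in> B \<Longrightarrow> damped cs (\<lambda>x. h' x - h x) x = 0"
  shows "(transition (map fst cs) f h')\<^sup>2 \<le>
    ennreal (exp (cost cs (\<lambda>x. h' x - h x))) * transition (map fst cs) (\<lambda>h. (f h)\<^sup>2) h"
  using assms(1,2,3,5)
proof (induction cs arbitrary: h h')
  case Nil
  have "h = h'"
  proof
    fix x show "h x = h' x" using Nil by (cases "x \<in> B") (auto simp: space_PiM PiE_def extensional_def)
  qed
  then show ?case by simp
next
  case (Cons c cs)
  obtain x b where c: "c = (x, b)" by force
  define w where "w = map fst cs"
  have x: "x \<in> B" and w: "set w \<subseteq> B" using Cons.prems by (auto simp: c w_def)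
  define d where "d = (\<lambda>x. h' x - h x)"
  \<comment> \<open>The field \<open>h'\<close> is driven by \<open>z + u\<close> while
    \<open>h\<close> is driven by \<open>z\<close>; by \<open>resample_diff\<close> this damps the
    difference by \<open>b\<close>.\<close>
  define u where "u = - (1 - b) * avg d x"
  define C where "C = ennreal (exp (cost cs (damp b x d)))"
  have f2: "(\<lambda>h. (f h)\<^sup>2) \<in> borel_measurable fields" using assms(4) by measurable
  let ?L = "\<lambda>z. ennreal (exp (- u * z - u\<^sup>2 / 2))"
  let ?g = "\<lambda>z. transition w f (resample x z h')"
  have g[measurable]: "?g \<in> borel_measurable borel"
    using Cons.prems x w assms(4) by (intro transition_section_measurable) auto
  have g2[measurable]: "(\<lambda>z. transition w (\<lambda>h. (f h)\<^sup>2) (resample x z h)) \<in> borel_measurable borel"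
    using Cons.prems x w f2 by (intro transition_section_measurable) auto
  have IH: "(?g (z + u))\<^sup>2 \<le> C * transition w (\<lambda>h. (f h)\<^sup>2) (resample x z h)" for z
  proof -
    have e: "(\<lambda>y. resample x (z + u) h' y - resample x z h y) = damp b x d"
    proof -
      have "z + u = z - (1 - b) * avg d x" by (simp add: u_def algebra_simps)
      then show ?thesis using resample_diff[of x z b h' h] by (simp only: d_def)
    qed
    show ?thesis
      using Cons.IH[of "resample x z h" "resample x (z + u) h'"] Cons.prems x
      unfolding e C_def w_def by (simp add: resample_space c d_def)
  qed
  have "(transition (map fst (c # cs)) f h')\<^sup>2 = (\<integral>\<^sup>+z. ?g (z + u) * ?L z \<partial>std_gauss)\<^sup>2"
    by (simp add: c w_def[symmetric] nn_integral_std_gauss_shift[of ?g u] del: mult_minus_left)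
  \<comment> \<open>Cauchy--Schwarz separates the square of the function, to which the induction
    applies, from that of the likelihood ratio, whose mean \<open>exp (u^2)\<close> is the price of
    this step.\<close>
  also have "\<dots> \<le> (\<integral>\<^sup>+z. (?g (z + u))\<^sup>2 \<partial>std_gauss) * (\<integral>\<^sup>+z. (?L z)\<^sup>2 \<partial>std_gauss)"
    by (intro Cauchy_Schwarz_nn_integral) simp_all
  also have "\<dots> \<le> (\<integral>\<^sup>+z. C * transition w (\<lambda>h. (f h)\<^sup>2) (resample x z h) \<partial>std_gauss) * ennreal (exp (u\<^sup>2))"
    unfolding nn_integral_std_gauss_likelihood_square by (intro mult_right_mono nn_integral_mono IH) simp
  also have "\<dots> = ennreal (exp (u\<^sup>2)) * C * transition (map fst (c # cs)) (\<lambda>h. (f h)\<^sup>2) h"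
    by (subst nn_integral_cmult) (simp_all add: c w_def[symmetric] mult_ac)
  also have "ennreal (exp (u\<^sup>2)) * C = ennreal (exp (cost (c # cs) d))"
    by (simp add: C_def c u_def ennreal_mult[symmetric] exp_add[symmetric] power_mult_distrib power2_commute)
  finally show ?case by (simp add: d_def)
qed

lemma transition_le_1:
  assumes "\<And>h. f h \<le> 1"
  shows "transition w f h \<le> 1"
proof -
  have "transition w f h \<le> transition w (\<lambda>_. 1) h"
  proof (induction w arbitrary: h)
    case (Cons x w)
    then show ?case by (auto intro: nn_integral_mono)
  qed (simp add: assms)
  then show ?thesis by (simp add: transition_const)
qed

text \<open>Harnack's inequality is applied to \<open>1 + s * indicator A\<close>: for \<open>indicator A\<close> itself it does
  not bound the total variation distance.\<close>

lemma transition_close: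
  assumes h: "h \<in> space fields" "h' \<in> space fields" and cs: "set (map fst cs) \<subseteq> B" and A: "A \<in> sets fields"
    and z: "\<And>x. x \<in> B \<Longrightarrow> damped cs (\<lambda>x. h' x - h x) x = 0"
    and s: "0 < s" "s \<le> 1" and c: "cost cs (\<lambda>x. h' x - h x) \<le> s\<^sup>2 / 2"
  shows "transition (map fst cs) (indicator A) h' \<le> transition (map fst cs) (indicator A) h + ennreal (5 / 2 * s)"
proof -
  let ?w = "map fst cs" and ?f = "indicator A :: _ \<Rightarrow> ennreal"
  have f: "?f \<in> borel_measurable fields" using A by simp
  have "transition ?w ?f h' \<le> 1" "transition ?w ?f h \<le> 1"
    by (auto intro!: transition_le_1 simp: indicator_def)
  then obtain p' p where p: "transition ?w ?f h' = ennreal p'" "transition ?w ?f h = ennreal p" "0 \<le> p'" "p' \<le> 1" "0 \<le> p" "p \<le> 1"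
    by (cases "transition ?w ?f h'"; cases "transition ?w ?f h") (auto simp: top_unique)
  have sq: "(1 + ennreal s * ?f h)\<^sup>2 = 1 + ennreal (2 * s + s\<^sup>2) * ?f h" for h
  proof -
    have "(1 + ennreal s)\<^sup>2 = ennreal ((1 + s)\<^sup>2)" using s by (simp add: ennreal_power[symmetric])
    also have "(1 + s)\<^sup>2 = 1 + (2 * s + s\<^sup>2)" by (simp add: power2_eq_square algebra_simps)
    also have "ennreal \<dots> = 1 + ennreal (2 * s + s\<^sup>2)" using s by simp
    finally show ?thesis by (simp add: indicator_def)
  qed
  have "(transition ?w (\<lambda>h. 1 + ennreal s * ?f h) h')\<^sup>2 \<le>
      ennreal (exp (cost cs (\<lambda>x. h' x - h x))) * transition ?w (\<lambda>h. (1 + ennreal s * ?f h)\<^sup>2) h"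
    using h cs z f by (intro transition_harnack) auto
  then have "(1 + ennreal s * ennreal p')\<^sup>2 \<le> ennreal (exp (cost cs (\<lambda>x. h' x - h x))) * (1 + ennreal (2 * s + s\<^sup>2) * ennreal p)"
    unfolding sq transition_affine[OF cs f h(1)] transition_affine[OF cs f h(2)] p .
  then have "(1 + s * p')\<^sup>2 \<le> exp (cost cs (\<lambda>x. h' x - h x)) * (1 + (2 * s + s\<^sup>2) * p)"
    using s p by (simp add: ennreal_mult[symmetric] ennreal_power flip: ennreal_1 ennreal_plus)
  \<comment> \<open>For a cost \<open>c\<close> of at most \<open>s^2 / 2\<close>, hence at most
    1/2, \<open>1 + c + c^2\<close> lies below \<open>1 + s^2\<close>.\<close>
  also have "\<dots> \<le> (1 + s\<^sup>2) * (1 + (2 * s + s\<^sup>2) * p)"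
  proof (intro mult_right_mono)
    let ?c = "cost cs (\<lambda>x. h' x - h x)"
    have s2: "s\<^sup>2 \<le> 1" using s by (intro power_le_one) auto
    have "?c\<^sup>2 \<le> ?c * (1 / 2)"
      unfolding power2_eq_square using c s2 by (intro mult_left_mono cost_nonneg) auto
    with c have "1 + ?c + ?c\<^sup>2 \<le> 1 + s\<^sup>2" using zero_le_power2[of s] by linarith
    moreover have "exp ?c \<le> 1 + ?c + ?c\<^sup>2" using c s2 by (intro exp_bound cost_nonneg) auto
    ultimately show "exp ?c \<le> 1 + s\<^sup>2" by simp
  qed (use s p in auto)
  finally have i: "1 + 2 * s * p' + (s * p')\<^sup>2 \<le> (1 + s\<^sup>2) * (1 + (2 * s + s\<^sup>2) * p)"
    by (simp add: power2_eq_square algebra_simps)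
  have "(2 * s + s\<^sup>2) * p \<le> 2 * s * p + s\<^sup>2"
    using mult_left_mono[OF p(6), of "s\<^sup>2"] by (simp add: algebra_simps)
  moreover have "(2 * s + s\<^sup>2) * p \<le> 3 * 1"
  proof (intro mult_mono)
    show "2 * s + s\<^sup>2 \<le> 3" using s power_le_one[of s 2] by simp
  qed (use p s in auto)
  then have "s\<^sup>2 * ((2 * s + s\<^sup>2) * p) \<le> s\<^sup>2 * 3" by (intro mult_left_mono) auto
  moreover have "(1 + s\<^sup>2) * (1 + (2 * s + s\<^sup>2) * p) = 1 + s\<^sup>2 + (2 * s + s\<^sup>2) * p + s\<^sup>2 * ((2 * s + s\<^sup>2) * p)"
    by (simp add: algebra_simps)
  \<comment> \<open>The probabilities enter at first order in \<open>s\<close>, all errors at second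
    order. Of the five squares one comes from the cost, one from \<open>s^2 * p\<close>, and three
    from the product, where \<open>(2 * s + s^2) * p\<close> is at most 3. Division by
    \<open>2 * s\<close> explains 5/2.\<close>
  ultimately have "2 * s * p' \<le> 2 * s * p + 5 * s\<^sup>2"
    using i zero_le_power2[of "s * p'"] by linarith
  then have "2 * s * p' \<le> 2 * s * (p + 5 / 2 * s)" by (simp add: power2_eq_square algebra_simps)
  then have "p' \<le> p + 5 / 2 * s" using s by simp
  then show ?thesis using p s by (simp flip: ennreal_plus)
qed

section \<open>The overlap of a field started far from equilibrium\<close>

lemma damped_measurable:
  assumes "\<And>x. x \<in> B \<Longrightarrow> (\<lambda>h. d h x) \<in> borel_measurable M" "x \<in> B"
  shows "(\<lambda>h. damped cs (d h) x) \<in> borel_measurable M"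
  using assms(1)
proof (induction cs arbitrary: d)
  case (Cons c cs)
  have "(\<lambda>h. damp (snd c) (fst c) (d h) y) \<in> borel_measurable M" if "y \<in> B" for y
    unfolding damp_def avg_def fun_upd_def using Cons.prems that
    by (cases "y = fst c") (auto intro!: borel_measurable_sum)
  then show ?case by (simp add: Cons.IH)
qed (use assms(2) in simp)

lemma overlap_cong: "(\<And>x. x \<in> B \<Longrightarrow> d x = d' x) \<Longrightarrow> overlap d = overlap d'"
  by (simp add: overlap_def)

lemma overlap_linear: "overlap (\<lambda>x. a * d x + c * d' x) = a * overlap d + c * overlap d'"
  by (simp add: overlap_def sum.distrib sum_distrib_left algebra_simps)

lemma damped_cong: "(\<And>x. x \<in> B \<Longrightarrow> d x = d' x) \<Longrightarrow> x \<in> B \<Longrightarrow> damped cs d x = damped cs d' x"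
proof (induction cs arbitrary: d d')
  case (Cons c cs)
  have *: "damp b z d y = damp b z d' y" if "y \<in> B" for b z y
    using avg_cong[of d d'] Cons.prems(1) that by (simp add: damp_def)
  show ?case unfolding damped.simps by (rule Cons.IH[OF * Cons.prems(2)])
qed simp

text \<open>The reflection \<open>h \<mapsto> - h\<close> exchanges this half space with the
  opposite one, and the two cover everything. It supplies the comparison fields for the next
  lemma.\<close>

lemma gibbs_half_space:
  "ennreal (1 / 2) \<le> emeasure gibbs {h \<in> space fields. overlap (damped cs h) \<le> 0}"
proof -
  interpret prob_space gibbs by (rule prob_space_gibbs)
  let ?P = "{h \<in> space fields. overlap (damped cs h) \<le> 0}" and ?N = "{h \<in> space fields. 0 \<le> overlap (damped cs h)}"
  have m[measurable]: "(\<lambda>h. overlap (damped cs h)) \<in> borel_measurable fields"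
    unfolding overlap_def by (intro borel_measurable_sum borel_measurable_times damped_measurable) auto
  have "overlap (damped cs (\<lambda>x\<in>B. - h x)) = - overlap (damped cs h)" for h
  proof -
    have "overlap (damped cs (\<lambda>x\<in>B. - h x)) = overlap (damped cs (\<lambda>x. - 1 * h x + 0 * h x))"
      by (intro overlap_cong damped_cong) auto
    then show ?thesis by (simp only: damped_linear overlap_linear)
  qed
  then have "indicator ?N (\<lambda>x\<in>B. - h x) = (indicator ?P h :: ennreal)" if "h \<in> space fields" for h
    using that by (simp add: indicator_def space_PiM)
  then have "(\<integral>\<^sup>+h. indicator ?N (\<lambda>x\<in>B. - h x) \<partial>gibbs) = (\<integral>\<^sup>+h. indicator ?P h \<partial>gibbs)"
    by (intro nn_integral_cong) simp
  moreover have "(\<integral>\<^sup>+h. indicator ?N h \<partial>gibbs) = (\<integral>\<^sup>+h. indicator ?N (\<lambda>x\<in>B. - h x) \<partial>gibbs)"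
    by (rule gibbs_symmetric) measurable
  ultimately have "emeasure gibbs ?N = emeasure gibbs ?P"
    by (subst (asm) (1 2) nn_integral_indicator) simp_all
  then have "prob ?N = prob ?P" by (simp add: measure_def)
  moreover have "1 \<le> prob ?P + prob ?N"
  proof -
    have "space gibbs = ?P \<union> ?N" by auto
    then have "1 = prob (?P \<union> ?N)" using prob_space by simp
    also have "\<dots> \<le> prob ?P + prob ?N" by (intro measure_Un_le) simp_all
    finally show ?thesis .
  qed
  ultimately have "1 / 2 \<le> prob ?P" by simp
  then show ?thesis by (simp only: emeasure_eq_measure ennreal_leI)
qed

text \<open>Couple with a stationary field \<open>h\<close> for which
  \<open>overlap (evolved w h)\<close> is at most 0, an event of probability at least 1/2. The final
  overlaps then differ by at least \<open>2 * K\<close>, so if the one started at \<open>h0\<close>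
  ends below \<open>K\<close>, the stationary one ends below \<open>- K\<close>. Stationarity thus
  bounds the Gaussian fluctuations along every word, and the factor 2 pays for the half
  space.\<close>

lemma transition_overlap_small:
  assumes h0: "h0 \<in> space fields" and w: "set w \<subseteq> B"
    and K: "0 \<le> K" "2 * K \<le> overlap (evolved w h0)"
  shows "transition w (indicator {h \<in> space fields. overlap h < K}) h0 \<le> ennreal (2 * exp (- (K\<^sup>2 / (2 * overlap_var))))"
proof -
  let ?D = "evolved w"
  let ?b = "exp (- (K\<^sup>2 / (2 * overlap_var)))"
  let ?P = "{h \<in> space fields. overlap (?D h) \<le> 0}"
  let ?f = "indicator {h \<in> space fields. overlap h < K} :: _ \<Rightarrow> ennreal"
  let ?f' = "indicator {h \<in> space fields. K \<le> - 1 * overlap h} :: _ \<Rightarrow> ennreal"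
  have [measurable]: "(\<lambda>h. overlap (?D h)) \<in> borel_measurable fields"
    unfolding overlap_def by (intro borel_measurable_sum borel_measurable_times damped_measurable) auto
  have P: "?P \<in> sets fields" by measurable
  have f': "?f' \<in> borel_measurable fields" by measurable
  have le: "transition w ?f h0 * indicator ?P h \<le> transition w ?f' h" if h: "h \<in> space fields" for h
  proof (cases "h \<in> ?P")
    case True
    have "transition w ?f h0 \<le> transition w ?f' h"
    proof (rule transition_coupling[OF h0 h w])
      fix g g' assume g: "g \<in> space fields" "g' \<in> space fields" "(\<lambda>x. g' x - g x) = ?D (\<lambda>x. h x - h0 x)"
      have "(\<lambda>x. 1 * g' x + (- 1) * g x) = ?D (\<lambda>x. 1 * h x + (- 1) * h0 x)" using g(3) by simp
      then have "overlap (\<lambda>x. 1 * g' x + (- 1) * g x) = overlap (\<lambda>x. 1 * ?D h x + (- 1) * ?D h0 x)"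
        by (simp only: damped_linear)
      then have "overlap g' - overlap g = overlap (?D h) - overlap (?D h0)"
        by (simp only: overlap_linear)
      with True K g show "?f g \<le> ?f' g'" by (auto simp: indicator_def)
    qed
    then show ?thesis using True by simp
  qed simp
  have "transition w ?f h0 * emeasure gibbs ?P = (\<integral>\<^sup>+h. transition w ?f h0 * indicator ?P h \<partial>gibbs)"
    using P by (subst nn_integral_cmult_indicator) simp_all
  also have "\<dots> \<le> (\<integral>\<^sup>+h. transition w ?f' h \<partial>gibbs)"
    by (intro nn_integral_mono le) simp
  also have "\<dots> = (\<integral>\<^sup>+h. ?f' h \<partial>gibbs)"
    by (rule gibbs_transition[OF w f'])
  also have "\<dots> = emeasure gibbs {h \<in> space fields. K \<le> - 1 * overlap h}"
    by (subst nn_integral_indicator) simp_all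
  also have "\<dots> \<le> ennreal ?b"
    by (rule gibbs_overlap_tail) (use K in auto)
  finally have 1: "transition w ?f h0 * emeasure gibbs ?P \<le> ennreal ?b" .
  have "transition w ?f h0 = transition w ?f h0 * ennreal (1 / 2) * ennreal 2"
  proof -
    have "ennreal (1 / 2) * ennreal 2 = 1" by (subst ennreal_mult[symmetric]) auto
    then show ?thesis by (simp only: mult.assoc mult_1_right)
  qed
  also have "\<dots> \<le> transition w ?f h0 * emeasure gibbs ?P * ennreal 2"
    by (intro mult_right_mono mult_left_mono gibbs_half_space) auto
  also have "\<dots> \<le> ennreal ?b * ennreal 2"
    by (intro mult_right_mono 1) auto
  finally show ?thesis by (simp add: ennreal_mult' mult.commute)
qed

section \<open>Mixing along words\<close>

text \<open>The stages take \<open>k\<close> letters without damping, \<open>m\<close> with factor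
  \<open>1 - \<delta>\<close> and \<open>g\<close> with removal; \<open>R\<close> bounds the initial
  squared norm. The summands are the distance for cost at most \<open>s^2 / 2\<close>, Markov's
  bound for a larger cost, and the chance that removal misses a site.\<close>

definition coupling_error :: "nat \<Rightarrow> nat \<Rightarrow> nat \<Rightarrow> real \<Rightarrow> real \<Rightarrow> real \<Rightarrow> real" where
  "coupling_error k m g s \<delta> R =
    5 / 2 * s + 2 / s\<^sup>2 * ((\<delta>\<^sup>2 * m / card B + contraction (1 - \<delta>) ^ m * g / card B) * contraction 1 ^ k * R)
      + card B * (1 - 1 / card B) ^ g"

lemma coupling_error_nonneg:
  assumes "0 < s" "0 \<le> \<delta>" "\<delta> \<le> 1" "0 \<le> R"
  shows "0 \<le> coupling_error k m g s \<delta> R"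
  unfolding coupling_error_def
  using assms contraction_bounds(1)[of "1 - \<delta>"] contraction_bounds(1)[of 1] card_B_pos
  by (intro add_nonneg_nonneg mult_nonneg_nonneg divide_nonneg_nonneg) auto

text \<open>The error is bounded word by word by a sum of nonnegative functions and then averaged
  stage by stage. The last \<open>r\<close> letters are arbitrary, since a vanished difference stays
  zero; so one choice of stages serves all longer words.\<close>

lemma words_close:
  assumes h: "h \<in> space fields" "h' \<in> space fields" and A: "A \<in> sets fields"
    and R: "norm_sq (\<lambda>x. h' x - h x) \<le> R"
    and s: "0 < s" "s \<le> 1" and \<delta>: "0 \<le> \<delta>" "\<delta> \<le> 1"
  shows "mean_words (k + (m + (g + r))) (\<lambda>w. transition w (indicator A) h') \<le>
    mean_words (k + (m + (g + r))) (\<lambda>w. transition w (indicator A) h) +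
    ennreal (coupling_error k m g s \<delta> R)"
proof -
  define d where "d = (\<lambda>x. h' x - h x)"
  let ?D1 = "\<lambda>u. damped (const_damping 1 u) d"
  let ?D2 = "\<lambda>u v. damped (const_damping (1 - \<delta>) v) (?D1 u)"
  let ?c1 = "\<lambda>u v. cost (const_damping (1 - \<delta>) v) (?D1 u)"
  let ?c2 = "\<lambda>u v w. cost (const_damping 0 w) (?D2 u v)"
  let ?T = "\<lambda>h w. transition w (indicator A) h"
  let ?E = mean_words and ?n = "k + (m + (g + r))"
  let ?bad = "indicator {w. \<not> B \<subseteq> set w} :: 'a list \<Rightarrow> ennreal"
  let ?cost = "?E k (\<lambda>u. ?E m (\<lambda>v. ?E g (\<lambda>w. ennreal (?c1 u v) + ennreal (?c2 u v w))))"
  let ?r = "\<delta>\<^sup>2 * m / card B + contraction (1 - \<delta>) ^ m * g / card B"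
  let ?err = "\<lambda>u v w. ennreal (5 / 2 * s) + ennreal (2 / s\<^sup>2) * (ennreal (?c1 u v) + ennreal (?c2 u v w)) + ?bad w"
  have pt: "?T h' (u @ v @ w @ q) \<le> ?T h (u @ v @ w @ q) + (?err u v w)"
    if B: "set u \<subseteq> B" "set v \<subseteq> B" "set w \<subseteq> B" "set q \<subseteq> B" for u v w q
  proof -
    have T1: "?T h' (u @ v @ w @ q) \<le> 1" by (rule transition_le_1) (simp add: indicator_def)
    let ?cs = "const_damping 1 u @ const_damping (1 - \<delta>) v @ const_damping 0 w @ const_damping 1 q"
    have fst: "map fst ?cs = u @ v @ w @ q" by (simp add: comp_def)
    have cost: "cost ?cs d = ?c1 u v + ?c2 u v w"
      by (simp add: cost_append damped_append cost_undamped)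
    consider "\<not> B \<subseteq> set w" | "cost ?cs d > s\<^sup>2 / 2" | "B \<subseteq> set w" "cost ?cs d \<le> s\<^sup>2 / 2" by force
    then show ?thesis
    proof cases
      case 1
      have "?T h' (u @ v @ w @ q) \<le> 0 + (0 + ?bad w)" using T1 1 by simp
      also have "\<dots> \<le> ?T h (u @ v @ w @ q) + (?err u v w)"
        by (intro add_mono) auto
      finally show ?thesis .
    next
      case 2
      \<comment> \<open>Markov's inequality, pointwise: here the scaled cost exceeds 1, which
        already bounds a probability.\<close>
      have "?T h' (u @ v @ w @ q) \<le> ennreal (2 / s\<^sup>2 * (?c1 u v + ?c2 u v w))"
        using 2 s by (intro order.trans[OF T1]) (simp add: cost field_simps)
      also have "\<dots> = 0 + (0 + ennreal (2 / s\<^sup>2) * (ennreal (?c1 u v) + ennreal (?c2 u v w)) + 0)"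
        using s by (simp add: ennreal_mult add_nonneg_nonneg cost_nonneg del: times_divide_eq_left)
      also have "\<dots> \<le> ?T h (u @ v @ w @ q) + (?err u v w)"
        by (intro add_mono) auto
      finally show ?thesis .
    next
      case 3
      \<comment> \<open>The removal stage visits all sites, and the letters of \<open>q\<close>
        average zeros.\<close>
      have "damped ?cs d x = 0" if "x \<in> B" for x
        unfolding damped_append using that 3(1) by (intro damped_zero[of "damped (const_damping 0 w) _"]) (auto simp: damped_0)
      then have "?T h' (map fst ?cs) \<le> ?T h (map fst ?cs) + ennreal (5 / 2 * s)"
        using B h A s 3(2) unfolding d_def by (intro transition_close) auto
      also have "\<dots> = ?T h (map fst ?cs) + (ennreal (5 / 2 * s) + 0 + 0)" by simp
      also have "\<dots> \<le> ?T h (map fst ?cs) + (?err u v w)"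
        by (intro add_left_mono add_mono) auto
      finally show ?thesis unfolding fst .
    qed
  qed
  have B: "set w \<subseteq> B" if "w \<in> set_pmf (words k)" for w k
    using that finite_B B_nonempty by (auto simp: set_replicate_pmf)
  have E1: "?E k (\<lambda>u. ennreal (norm_sq (?D1 u))) \<le> ennreal (contraction 1 ^ k * R)"
  proof -
    have "?E k (\<lambda>u. ennreal (norm_sq (?D1 u))) \<le> ennreal (contraction 1 ^ k * norm_sq d)"
      by (rule expected_norm_sq) auto
    also have "\<dots> \<le> ennreal (contraction 1 ^ k * R)"
      using R by (intro ennreal_leI mult_left_mono zero_le_power contraction_bounds) (auto simp: d_def)
    finally show ?thesis .
  qed
  have "?cost \<le>
      ?E k (\<lambda>u. ennreal ?r * ennreal (norm_sq (?D1 u)))"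
  proof (intro nn_integral_mono)
    fix u
    have "?E m (\<lambda>v. ?E g (\<lambda>w. ennreal (?c1 u v) + ennreal (?c2 u v w))) =
       ?E m (\<lambda>v. ennreal (?c1 u v) + ?E g (\<lambda>w. ennreal (?c2 u v w)))"
      by (simp add: nn_integral_add)
    also have "\<dots> \<le> ?E m (\<lambda>v. ennreal (?c1 u v) + ennreal (g / card B) * ennreal (norm_sq (?D2 u v)))"
    proof (intro nn_integral_mono add_left_mono)
      fix v
      show "?E g (\<lambda>w. ennreal (?c2 u v w)) \<le> ennreal (g / card B) * ennreal (norm_sq (?D2 u v))"
        using expected_cost[where b=0 and d="?D2 u v" and k=g] by (simp add: ennreal_mult norm_sq_nonneg del: times_divide_eq_left)
    qed
    also have "\<dots> = ?E m (\<lambda>v. ennreal (?c1 u v)) + ennreal (g / card B) * ?E m (\<lambda>v. ennreal (norm_sq (?D2 u v)))"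
      by (simp add: nn_integral_add nn_integral_cmult)
    also have "\<dots> \<le> ennreal (\<delta>\<^sup>2 * m / card B * norm_sq (?D1 u)) + ennreal (g / card B) * ennreal (contraction (1 - \<delta>) ^ m * norm_sq (?D1 u))"
      using expected_cost[where b="1 - \<delta>" and d="?D1 u" and k=m] expected_norm_sq[where b="1 - \<delta>" and d="?D1 u" and k=m] \<delta>
      by (intro add_mono mult_left_mono) auto
    also have "\<dots> = ennreal ?r * ennreal (norm_sq (?D1 u))"
      using contraction_bounds(1)[of "1 - \<delta>"] \<delta> norm_sq_nonneg[of "?D1 u"]
      by (simp add: ennreal_mult[symmetric] mult_ac add_divide_distrib distrib_left distrib_right flip: ennreal_plus)
    finally show "?E m (\<lambda>v. ?E g (\<lambda>w. ennreal (?c1 u v) + ennreal (?c2 u v w))) \<le>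
        ennreal ?r * ennreal (norm_sq (?D1 u))" .
  qed
  also have "\<dots> \<le> ennreal ?r * ennreal (contraction 1 ^ k * R)"
    by (subst nn_integral_cmult) (auto intro!: mult_left_mono E1)
  also have "\<dots> = ennreal (?r * contraction 1 ^ k * R)"
    using contraction_bounds(1)[of "1 - \<delta>"] contraction_bounds(1)[of 1] \<delta> R norm_sq_nonneg[of "\<lambda>x. h' x - h x"]
    by (subst ennreal_mult[symmetric]) (auto simp: mult_ac intro!: add_nonneg_nonneg mult_nonneg_nonneg divide_nonneg_nonneg)
  finally have cost: "?cost \<le> \<dots>" .
  have "?E ?n (?T h') = ?E k (\<lambda>u. ?E m (\<lambda>v. ?E g (\<lambda>w. ?E r (\<lambda>q. ?T h' (u @ v @ w @ q)))))"
    by (simp only: nn_integral_words_add)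
  also have "\<dots> \<le> ?E k (\<lambda>u. ?E m (\<lambda>v. ?E g (\<lambda>w. ?E r (\<lambda>q. ?T h (u @ v @ w @ q) + (?err u v w)))))"
    by (intro nn_integral_mono_AE AE_pmfI pt B)
  also have "\<dots> = ?E k (\<lambda>u. ?E m (\<lambda>v. ?E g (\<lambda>w. ?E r (\<lambda>q. ?T h (u @ v @ w @ q))))) +
      (ennreal (5 / 2 * s) + ennreal (2 / s\<^sup>2) * ?cost +
       emeasure (measure_pmf (words g)) {w. \<not> B \<subseteq> set w})"
    by (simp add: nn_integral_add nn_integral_cmult add_ac)
  also have "?E k (\<lambda>u. ?E m (\<lambda>v. ?E g (\<lambda>w. ?E r (\<lambda>q. ?T h (u @ v @ w @ q))))) = ?E ?n (?T h)"
    by (simp only: nn_integral_words_add)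
  also have "?E ?n (?T h) + (ennreal (5 / 2 * s) + ennreal (2 / s\<^sup>2) * ?cost +
       emeasure (measure_pmf (words g)) {w. \<not> B \<subseteq> set w}) \<le>
      ?E ?n (?T h) + (ennreal (5 / 2 * s) + ennreal (2 / s\<^sup>2) *
        ennreal (?r * contraction 1 ^ k * R) +
       ennreal (card B * (1 - 1 / card B) ^ g))"
    by (intro add_left_mono add_mono mult_left_mono cost noncover_prob) auto
  also have "ennreal (5 / 2 * s) + ennreal (2 / s\<^sup>2) *
        ennreal (?r * contraction 1 ^ k * R) +
       ennreal (card B * (1 - 1 / card B) ^ g) =
     ennreal (5 / 2 * s + 2 / s\<^sup>2 * (?r * contraction 1 ^ k * R)
      + card B * (1 - 1 / card B) ^ g)"
  proof -
    have "0 \<le> ?r * contraction 1 ^ k * R"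
      using contraction_bounds(1)[of "1 - \<delta>"] contraction_bounds(1)[of 1] \<delta> R norm_sq_nonneg[of "\<lambda>x. h' x - h x"]
      by (intro mult_nonneg_nonneg add_nonneg_nonneg divide_nonneg_nonneg) auto
    moreover have "0 \<le> card B * (1 - 1 / card B) ^ g" using card_B_pos by simp
    ultimately show ?thesis using s by (simp flip: ennreal_mult ennreal_plus)
  qed
  finally show ?thesis unfolding coupling_error_def .
qed

lemma gibbs_words:
  assumes f: "f \<in> borel_measurable fields"
  shows "(\<integral>\<^sup>+h. mean_words k (\<lambda>w. transition w f h) \<partial>gibbs) = (\<integral>\<^sup>+h. f h \<partial>gibbs)"
    and "(\<lambda>h. mean_words k (\<lambda>w. transition w f h)) \<in> borel_measurable fields"
proof -
  have set: "set_pmf (words k) = {w. set w \<subseteq> B \<and> length w = k}"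
    using finite_B B_nonempty by (auto simp: set_replicate_pmf)
  have fin: "finite (set_pmf (words k))"
    unfolding set by (rule finite_lists_length_eq[OF finite_B])
  have wB: "set w \<subseteq> B" if "w \<in> set_pmf (words k)" for w using that set by auto
  have m: "transition w f \<in> borel_measurable fields" if "w \<in> set_pmf (words k)" for w
    by (rule transition_measurable[OF wB[OF that] f])
  have eq: "mean_words k (\<lambda>w. transition w f h) = (\<Sum>w\<in>set_pmf (words k). transition w f h * ennreal (pmf (words k) w))" for h
    by (rule nn_integral_measure_pmf_finite[OF fin]) simp
  show "(\<lambda>h. mean_words k (\<lambda>w. transition w f h)) \<in> borel_measurable fields"
    unfolding eq using m by (intro borel_measurable_sum) simp
  have "(\<integral>\<^sup>+h. mean_words k (\<lambda>w. transition w f h) \<partial>gibbs) =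
      (\<Sum>w\<in>set_pmf (words k). (\<integral>\<^sup>+h. transition w f h \<partial>gibbs) * ennreal (pmf (words k) w))"
    unfolding eq using m by (subst nn_integral_sum) (auto simp: nn_integral_multc)
  also have "\<dots> = (\<Sum>w\<in>set_pmf (words k). (\<integral>\<^sup>+h. f h \<partial>gibbs) * ennreal (pmf (words k) w))"
    using gibbs_transition[OF wB f] by (intro sum.cong refl) simp
  also have "\<dots> = mean_words k (\<lambda>w. (\<integral>\<^sup>+h. f h \<partial>gibbs))"
    by (rule nn_integral_measure_pmf_finite[OF fin, symmetric]) simp
  finally show "(\<integral>\<^sup>+h. mean_words k (\<lambda>w. transition w f h) \<partial>gibbs) = (\<integral>\<^sup>+h. f h \<partial>gibbs)" by simp
qed

lemma norm_sq_diff: "norm_sq (\<lambda>x. d x - d' x) \<le> 2 * norm_sq d + 2 * norm_sq d'"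
proof -
  have "(a - b)\<^sup>2 \<le> 2 * a\<^sup>2 + 2 * b\<^sup>2" for a b :: real
    using zero_le_power2[of "a + b"] by (simp add: power2_eq_square algebra_simps)
  then show ?thesis
    unfolding norm_sq_def sum_distrib_left sum.distrib[symmetric] by (intro sum_mono)
qed

text \<open>The factor 4 makes the exponential in the tail bound \<open>exp (- card B)\<close>,
  which beats the Jacobian \<open>sqrt 2 ^ card B\<close>, at most
  \<open>exp (card B / 2)\<close>.\<close>

lemma gibbs_norm_typical:
  "emeasure gibbs {h \<in> space fields. 4 * real (card B) / (1 - \<mu>) \<le> norm_sq h} \<le> ennreal (exp (- (card B / 2)))"
proof -
  have "sqrt 2 \<le> exp (1 / 2)"
  proof (rule real_le_lsqrt)
    have "(exp (1 / 2 :: real))\<^sup>2 = exp 1" by (simp add: exp_double[symmetric])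
    then show "2 \<le> (exp (1 / 2 :: real))\<^sup>2" using exp_ge_add_one_self[of 1] by simp
  qed auto
  then have "sqrt 2 ^ card B \<le> exp (1 / 2) ^ card B" by (intro power_mono) auto
  also have "\<dots> = exp (card B / 2)" by (simp add: exp_of_nat_mult[symmetric])
  finally have "exp (- card B) * sqrt 2 ^ card B \<le> exp (- card B) * exp (card B / 2)" by simp
  also have "\<dots> = exp (- (card B / 2))" by (simp add: exp_add[symmetric])
  moreover have "- (1 - \<mu>) * (4 * real (card B) / (1 - \<mu>)) / 4 = - card B" using \<mu>_less_1 by (simp add: field_simps)
  ultimately show ?thesis
    using gibbs_norm_tail[of "4 * real (card B) / (1 - \<mu>)"] by (metis (no_types, lifting) ennreal_leI order_trans)
qed

text \<open>Averaged over a stationary second field, its side becomes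
  \<open>emeasure gibbs A\<close> by invariance. Stationary fields of atypically large norm are
  charged their probability; for the others \<open>norm_sq_diff\<close> doubles both bounds.\<close>

lemma words_mixing:
  assumes h: "h \<in> space fields" and A: "A \<in> sets fields" and Q: "norm_sq h \<le> Q"
    and s: "0 < s" "s \<le> 1" and \<delta>: "0 \<le> \<delta>" "\<delta> \<le> 1"
  shows "mean_words (k + (m + (g + r))) (\<lambda>w. transition w (indicator A) h) \<le> emeasure gibbs A +
    ennreal (coupling_error k m g s \<delta> (2 * Q + 8 * real (card B) / (1 - \<mu>)) + exp (- (card B / 2)))"
proof -
  interpret prob_space gibbs by (rule prob_space_gibbs)
  let ?k = "k + (m + (g + r))"
  define G where "G = (\<lambda>h. mean_words ?k (\<lambda>w. transition w (indicator A) h))"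
  define e where "e = coupling_error k m g s \<delta> (2 * Q + 8 * real (card B) / (1 - \<mu>))"
  let ?L = "{h \<in> space fields. 4 * real (card B) / (1 - \<mu>) \<le> norm_sq h}"
  have Gm[measurable]: "G \<in> borel_measurable fields"
    unfolding G_def using A by (intro gibbs_words) simp
  have G1: "G h \<le> 1" for h
  proof -
    have "G h \<le> mean_words ?k (\<lambda>w. 1)"
      unfolding G_def by (intro nn_integral_mono transition_le_1) (simp add: indicator_def)
    then show ?thesis by simp
  qed
  have Q0: "0 \<le> Q" using Q norm_sq_nonneg[of h] by linarith
  have e0: "0 \<le> e"
    unfolding e_def using s \<delta> Q0 \<mu>_less_1 by (intro coupling_error_nonneg) auto
  have pt: "G h \<le> G h' + (ennreal e + indicator ?L h')" if h': "h' \<in> space fields" for h'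
  proof (cases "h' \<in> ?L")
    case True
    have "G h \<le> 0 + (0 + indicator ?L h')" using True G1 by simp
    also have "\<dots> \<le> G h' + (ennreal e + indicator ?L h')" by (intro add_mono) auto
    finally show ?thesis .
  next
    case False
    then have "norm_sq h' \<le> 4 * real (card B) / (1 - \<mu>)" using h' by auto
    then have "norm_sq (\<lambda>x. h x - h' x) \<le> 2 * Q + 8 * real (card B) / (1 - \<mu>)"
      using norm_sq_diff[of h h'] Q by simp
    from words_close[OF h' h A this s \<delta>, of k m g r]
    have "G h \<le> G h' + ennreal e" by (simp add: G_def e_def)
    then show ?thesis using False by simp
  qed
  have "G h = (\<integral>\<^sup>+h'. G h \<partial>gibbs)" using emeasure_space_1 by simp
  also have "\<dots> \<le> (\<integral>\<^sup>+h'. G h' + (ennreal e + indicator ?L h') \<partial>gibbs)"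
    by (intro nn_integral_mono pt) simp
  also have "\<dots> = (\<integral>\<^sup>+h'. G h' \<partial>gibbs) + (ennreal e + emeasure gibbs ?L)"
    using emeasure_space_1 by (simp add: nn_integral_add)
  also have "(\<integral>\<^sup>+h'. G h' \<partial>gibbs) = emeasure gibbs A"
    unfolding G_def using A by (subst gibbs_words) simp_all
  also have "emeasure gibbs A + (ennreal e + emeasure gibbs ?L) \<le> emeasure gibbs A + (ennreal e + ennreal (exp (- (card B / 2))))"
    by (intro add_left_mono gibbs_norm_typical)
  finally show ?thesis using e0 by (simp add: G_def e_def ennreal_plus[symmetric] del: ennreal_plus)
qed

end

section \<open>The clocks\<close>

abbreviation waiting :: "real measure" where
  "waiting \<equiv> density lborel (\<lambda>z. ennreal (exponential_density 1 z))"

lemma prob_space_waiting: "prob_space waiting"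
  by (rule prob_space_exponential_density) simp

lemma emeasure_waiting_greater:
  assumes "0 \<le> a"
  shows "emeasure waiting {a<..} = ennreal (exp (- a))"
proof -
  have "emeasure waiting {a<..} = (\<integral>\<^sup>+z. ennreal (exponential_density 1 z) * indicator {a<..} z \<partial>lborel)"
    by (rule emeasure_density) simp_all
  also have "\<dots> = (\<integral>\<^sup>+z. ennreal (exp (- z)) * indicator {a..} z \<partial>lborel)"
    using AE_lborel_singleton[of a] assms
    by (intro nn_integral_cong_AE) (auto simp: exponential_density_def indicator_def elim!: eventually_mono)
  also have "\<dots> = ennreal (0 - (- exp (- a)))"
  proof (rule nn_integral_FTC_atLeast)
    show "((\<lambda>x::real. - exp (- x)) \<longlongrightarrow> 0) at_top" by real_asymp
  qed (auto intro!: derivative_eq_intros)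
  finally show ?thesis by simp
qed

lemma lat_box_finite: "finite (lat_box n)"
  by (simp add: lat_box_def)

lemma waiting_times_eq: "waiting_times n = PiM (lat_box n \<times> UNIV) (\<lambda>_. waiting)"
  by (simp add: waiting_times_def)

text \<open>Restores the ring numbers in a word of sites: \<open>c x\<close> is the number of the
  next ring at \<open>x\<close>. Forgetting the numbers inverts it, so words and histories determine
  each other.\<close>

primrec rings_of :: "(site \<Rightarrow> nat) \<Rightarrow> site list \<Rightarrow> ring list" where
  "rings_of c [] = []"
| "rings_of c (x # w) = (x, c x) # rings_of (c(x := Suc (c x))) w"

lemma map_fst_rings_of[simp]: "map fst (rings_of c w) = w"
  by (induction w arbitrary: c) auto

text \<open>\<open>\<sigma> x\<close> is the time of the last of the \<open>c x\<close> rings at \<open>x\<close> so far, and \<open>s\<close> the time of the last ring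
  anywhere: then \<open>w\<close> lists the sites of the remaining rings until time \<open>t\<close>.\<close>

primrec remaining_rings ::
  "site set \<Rightarrow> real \<Rightarrow> (ring \<Rightarrow> real) \<Rightarrow> site list \<Rightarrow> (site \<Rightarrow> nat) \<Rightarrow> (site \<Rightarrow> real) \<Rightarrow> real \<Rightarrow> bool" where
  "remaining_rings B t \<tau> [] c \<sigma> s \<longleftrightarrow> (\<forall>x\<in>B. t < \<sigma> x + \<tau> (x, c x))"
| "remaining_rings B t \<tau> (x # w) c \<sigma> s \<longleftrightarrow> s < \<sigma> x + \<tau> (x, c x) \<and> \<sigma> x + \<tau> (x, c x) \<le> t \<and>
    remaining_rings B t \<tau> w (c(x := Suc (c x))) (\<sigma>(x := \<sigma> x + \<tau> (x, c x))) (\<sigma> x + \<tau> (x, c x))"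

text \<open>The last conjunct, that all later rings come after \<open>s\<close>, is what carries
  sortedness through the induction. Positive waiting times make the first ring after
  \<open>t\<close> at a site exclude all its later ones.\<close>

lemma remaining_rings_history:
  assumes pos: "\<And>e. e \<in> B \<times> UNIV \<Longrightarrow> 0 < \<tau> e"
    and "\<And>x. x \<in> B \<Longrightarrow> \<sigma> x = (\<Sum>j<c x. \<tau> (x, j))" "set w \<subseteq> B"
    and "remaining_rings B t \<tau> w c \<sigma> s"
  shows "set (rings_of c w) = {e \<in> B \<times> UNIV. c (fst e) \<le> snd e \<and> ring_time \<tau> e \<le> t} \<and>
    sorted_wrt (\<lambda>e e'. ring_time \<tau> e < ring_time \<tau> e') (rings_of c w) \<and>
    (\<forall>e\<in>set (rings_of c w). s < ring_time \<tau> e)"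
  using assms(2-)
proof (induction w arbitrary: c \<sigma> s)
  case Nil
  have "t < ring_time \<tau> (x, j)" if "x \<in> B" "c x \<le> j" for x j
  proof -
    have "t < \<sigma> x + \<tau> (x, c x)" using Nil that by simp
    also have "\<dots> = (\<Sum>j\<le>c x. \<tau> (x, j))" using Nil that by (simp add: lessThan_Suc_atMost[symmetric])
    also have "\<dots> \<le> (\<Sum>j\<le>j. \<tau> (x, j))" using that by (intro sum_mono2) (auto intro!: less_imp_le pos)
    finally show ?thesis by (simp add: ring_time_def)
  qed
  then show ?case by fastforce
next
  case (Cons x w)
  let ?v = "\<sigma> x + \<tau> (x, c x)" and ?c = "c(x := Suc (c x))"
  have x: "x \<in> B" using Cons.prems by simp
  have v: "?v = ring_time \<tau> (x, c x)"
    using Cons.prems(1)[OF x] by (simp add: ring_time_def lessThan_Suc_atMost[symmetric])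
  have IH: "set (rings_of ?c w) = {e \<in> B \<times> UNIV. ?c (fst e) \<le> snd e \<and> ring_time \<tau> e \<le> t} \<and>
    sorted_wrt (\<lambda>e e'. ring_time \<tau> e < ring_time \<tau> e') (rings_of ?c w) \<and>
    (\<forall>e\<in>set (rings_of ?c w). ?v < ring_time \<tau> e)"
  proof (rule Cons.IH[where \<sigma>="\<sigma>(x := ?v)"])
    show "(\<sigma>(x := ?v)) y = (\<Sum>j<?c y. \<tau> (y, j))" if "y \<in> B" for y
      using Cons.prems(1)[OF that] by (cases "y = x") simp_all
    show "set w \<subseteq> B" using Cons.prems(2) by simp
    show "remaining_rings B t \<tau> w ?c (\<sigma>(x := ?v)) ?v" using Cons.prems(3) by (simp only: remaining_rings.simps)
  qed
  have s: "s < ?v" "?v \<le> t" using Cons.prems by auto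
  have "{e \<in> B \<times> UNIV. c (fst e) \<le> snd e \<and> ring_time \<tau> e \<le> t} =
      insert (x, c x) {e \<in> B \<times> UNIV. ?c (fst e) \<le> snd e \<and> ring_time \<tau> e \<le> t}"
    using x \<open>?v \<le> t\<close> v by (auto simp: Suc_le_eq order.order_iff_strict)
  moreover have "\<forall>e\<in>set (rings_of ?c w). s < ring_time \<tau> e"
    using IH s(1) by (meson less_trans)
  ultimately show ?case using IH s(1) unfolding v by simp
qed

text \<open>Only waiting times from index \<open>c x\<close> on are read. This independence of the
  past is what peeling off one waiting time requires.\<close>

lemma remaining_rings_upd:
  "j < c x \<Longrightarrow> remaining_rings B t (\<tau>((x, j) := a)) w c \<sigma> s = remaining_rings B t \<tau> w c \<sigma> s"
proof (induction w arbitrary: c \<sigma> s)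
  case (Cons y w)
  have "(\<tau>((x, j) := a)) (y, c y) = \<tau> (y, c y)" using Cons.prems by auto
  moreover have "j < (c(y := Suc (c y))) x" using Cons.prems by (auto intro: less_SucI)
  ultimately show ?case unfolding remaining_rings.simps by (simp only: Cons.IH)
qed auto

lemma remaining_rings_measurable:
  assumes "finite B" "set w \<subseteq> B"
    and \<tau>[measurable]: "\<And>e. e \<in> B \<times> UNIV \<Longrightarrow> (\<lambda>\<omega>. \<tau> \<omega> e) \<in> borel_measurable M"
    and "\<And>x. x \<in> B \<Longrightarrow> (\<lambda>\<omega>. \<sigma> \<omega> x) \<in> borel_measurable M" "s \<in> borel_measurable M"
  shows "Measurable.pred M (\<lambda>\<omega>. remaining_rings B t (\<tau> \<omega>) w c (\<sigma> \<omega>) (s \<omega>))"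
  using assms(2,4,5)
proof (induction w arbitrary: c \<sigma> s)
  case Nil
  have "Measurable.pred M (\<lambda>\<omega>. t < \<sigma> \<omega> x + \<tau> \<omega> (x, c x))" if "x \<in> B" for x
    using Nil(2)[OF that] \<tau>[of "(x, c x)"] that by simp
  then show ?case using assms(1) by (simp add: pred_intros_finite)
next
  case (Cons x w)
  have x: "x \<in> B" using Cons by simp
  note [measurable] = Cons.prems(2)[OF x] \<tau>[of "(x, c x)"] Cons.prems(3)
  have m[measurable]: "(\<lambda>\<omega>. \<sigma> \<omega> x + \<tau> \<omega> (x, c x)) \<in> borel_measurable M" using x by simp
  have [measurable]: "Measurable.pred M (\<lambda>\<omega>. remaining_rings B t (\<tau> \<omega>) w (c(x := Suc (c x))) ((\<sigma> \<omega>)(x := \<sigma> \<omega> x + \<tau> \<omega> (x, c x))) (\<sigma> \<omega> x + \<tau> \<omega> (x, c x)))"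
  proof (rule Cons.IH)
    fix y assume "y \<in> B"
    then show "(\<lambda>\<omega>. ((\<sigma> \<omega>)(x := \<sigma> \<omega> x + \<tau> \<omega> (x, c x))) y) \<in> borel_measurable M"
      using Cons.prems(2)[of y] m by (cases "y = x") simp_all
  qed (use Cons.prems m in auto)
  show ?case unfolding remaining_rings.simps by measurable
qed

lemma nn_integral_power_interval:
  assumes "a \<le> (b :: real)"
  shows "(\<integral>\<^sup>+v. ennreal ((b - v) ^ k / fact k) * indicator {a..b} v \<partial>lborel) = ennreal ((b - a) ^ Suc k / fact (Suc k))"
proof -
  have "(\<integral>\<^sup>+v. ennreal ((b - v) ^ k / fact k) * indicator {a..b} v \<partial>lborel) =
      ennreal (- ((b - b) ^ Suc k / fact (Suc k)) - (- ((b - a) ^ Suc k / fact (Suc k))))"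
  proof (rule nn_integral_FTC_Icc[where F="\<lambda>v. - ((b - v) ^ Suc k / fact (Suc k))"])
    fix v
    have "((\<lambda>v. (b - v) ^ Suc k) has_real_derivative - (real (Suc k) * (b - v) ^ k)) (at v)"
      by (auto intro!: derivative_eq_intros simp del: power_Suc)
    then have "((\<lambda>v. - ((b - v) ^ Suc k / fact (Suc k))) has_real_derivative - (- (real (Suc k) * (b - v) ^ k) / fact (Suc k))) (at v)"
      by (intro DERIV_minus DERIV_cdivide)
    then show "((\<lambda>v. - ((b - v) ^ Suc k / fact (Suc k))) has_real_derivative (b - v) ^ k / fact k) (at v)"
      by simp
  qed (use assms in auto)
  then show ?thesis by simp
qed

text \<open>Peel off the waiting time of the first letter. Its density \<open>exp (- v)\<close>
  cancels against the shorter survival time of that clock, so only the integral of a power over the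
  time of the next ring remains. The power over the factorial is the volume of the simplex of
  ordered ring times.\<close>

lemma emeasure_remaining_rings:
  assumes B: "finite B" and "set w \<subseteq> B" "\<And>x. x \<in> B \<Longrightarrow> \<sigma> x \<le> s" "s \<le> t"
  shows "emeasure (PiM (B \<times> UNIV) (\<lambda>_. waiting)) {\<tau> \<in> space (PiM (B \<times> UNIV) (\<lambda>_. waiting)). remaining_rings B t \<tau> w c \<sigma> s} =
    ennreal (exp (- (\<Sum>x\<in>B. t - \<sigma> x)) * ((t - s) ^ length w / fact (length w)))"
  using assms(2-)
proof (induction w arbitrary: c \<sigma> s)
  case Nil
  interpret product_prob_space "\<lambda>_. waiting" "B \<times> (UNIV :: nat set)"
    by (intro product_prob_spaceI prob_space_waiting)
  let ?M = "PiM (B \<times> (UNIV :: nat set)) (\<lambda>_. waiting)"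
  let ?ev = "{\<tau> \<in> space ?M. remaining_rings B t \<tau> [] c \<sigma> s}"
  let ?J = "(\<lambda>x. (x, c x)) ` B"
  have inj: "inj_on (\<lambda>x. (x, c x)) B" by (auto intro: inj_onI)
  have "?ev =
      {\<tau> \<in> space ?M. \<forall>e\<in>?J. \<tau> e \<in> {t - \<sigma> (fst e)<..}}"
    by (auto simp: algebra_simps)
  then have "emeasure ?M ?ev =
      (\<Prod>e\<in>?J. emeasure waiting {t - \<sigma> (fst e)<..})"
    using B by (simp only:) (intro emeasure_PiM_Collect, auto)
  also have "\<dots> = (\<Prod>x\<in>B. emeasure waiting {t - \<sigma> x<..})"
    by (simp add: prod.reindex[OF inj])
  also have "\<dots> = (\<Prod>x\<in>B. ennreal (exp (- (t - \<sigma> x))))"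
    using Nil by (intro prod.cong refl emeasure_waiting_greater) force
  also have "\<dots> = ennreal (exp (- (\<Sum>x\<in>B. t - \<sigma> x)))"
    using B by (simp add: prod_ennreal exp_sum sum_negf[symmetric])
  finally show ?case by simp
next
  case (Cons x w)
  let ?M = "PiM (B \<times> (UNIV :: nat set)) (\<lambda>_. waiting)"
  let ?c = "c(x := Suc (c x))"
  let ?ev = "{\<tau> \<in> space ?M. remaining_rings B t \<tau> (x # w) c \<sigma> s}"
  let ?S = "\<Sum>x\<in>B. t - \<sigma> x"
  have x: "x \<in> B" and w: "set w \<subseteq> B" using Cons.prems by auto
  \<comment> \<open>\<open>v\<close> takes the place of the waiting time
    \<open>\<tau> (x, c x)\<close>; the rest of the event reads that clock from index
    \<open>Suc (c x)\<close> on.\<close>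
  define P where "P = (\<lambda>v \<tau>. s < \<sigma> x + v \<and> \<sigma> x + v \<le> t \<and> remaining_rings B t \<tau> w ?c (\<sigma>(x := \<sigma> x + v)) (\<sigma> x + v))"
  define f where "f = (\<lambda>(v, \<tau>). indicator {\<tau>. P v \<tau>} \<tau> :: ennreal)"
  have PM: "Measurable.pred (waiting \<Otimes>\<^sub>M ?M) (\<lambda>\<omega>. P (fst \<omega>) (snd \<omega>))"
  proof -
    have comp: "(\<lambda>\<omega>. snd \<omega> e) \<in> borel_measurable (waiting \<Otimes>\<^sub>M ?M)" if "e \<in> B \<times> UNIV" for e
      using measurable_compose[OF measurable_snd measurable_component_singleton[OF that, of "\<lambda>_. waiting"]] by simp
    have [measurable]: "fst \<in> borel_measurable (waiting \<Otimes>\<^sub>M ?M)"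
      using measurable_fst[of waiting ?M] by (simp cong: measurable_cong_sets)
    have [measurable]: "Measurable.pred (waiting \<Otimes>\<^sub>M ?M) (\<lambda>\<omega>. remaining_rings B t (snd \<omega>) w ?c (\<sigma>(x := \<sigma> x + fst \<omega>)) (\<sigma> x + fst \<omega>))"
    proof (rule remaining_rings_measurable[OF B w comp])
      fix y assume "y \<in> B"
      show "(\<lambda>\<omega>. (\<sigma>(x := \<sigma> x + fst \<omega>)) y) \<in> borel_measurable (waiting \<Otimes>\<^sub>M ?M)"
        by (cases "y = x") simp_all
    qed simp_all
    show ?thesis unfolding P_def by measurable
  qed
  have fm: "f \<in> borel_measurable (waiting \<Otimes>\<^sub>M ?M)"
  proof -
    have "f = (\<lambda>\<omega>. indicator {\<omega>. P (fst \<omega>) (snd \<omega>)} \<omega>)"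
      by (auto simp: f_def indicator_def fun_eq_iff)
    then show ?thesis using PM by simp
  qed
  have PM2: "Measurable.pred ?M (\<lambda>\<tau>. P v \<tau>)" for v
    using measurable_compose[OF measurable_Pair1' PM, of v] by simp
  have ev: "?ev \<in> sets ?M"
    using remaining_rings_measurable[OF B Cons.prems(1), of "\<lambda>\<tau>. \<tau>" ?M "\<lambda>_. \<sigma>" "\<lambda>_. s" t c]
      measurable_component_singleton[of _ "B \<times> (UNIV :: nat set)" "\<lambda>_. waiting"] by simp
  have "emeasure ?M ?ev =
      (\<integral>\<^sup>+\<tau>. indicator ?ev \<tau> \<partial>?M)"
    using ev by simp
  also have "\<dots> = (\<integral>\<^sup>+\<tau>. f (\<tau> (x, c x), \<tau>) \<partial>?M)"
    by (intro nn_integral_cong) (auto simp: f_def P_def indicator_def)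
  also have "\<dots> = (\<integral>\<^sup>+v. \<integral>\<^sup>+\<tau>. f (v, \<tau>) \<partial>?M \<partial>waiting)"
    by (rule nn_integral_PiM_peel[OF prob_space_waiting _ fm])
      (use x in \<open>auto simp: f_def P_def indicator_def remaining_rings_upd\<close>)
  also have "\<dots> = (\<integral>\<^sup>+v. ennreal (exp (- ?S) * exp v * ((t - (\<sigma> x + v)) ^ length w / fact (length w))) * indicator {s - \<sigma> x<..t - \<sigma> x} v \<partial>waiting)"
  proof (intro nn_integral_cong)
    fix v
    show "(\<integral>\<^sup>+\<tau>. f (v, \<tau>) \<partial>?M) = ennreal (exp (- ?S) * exp v * ((t - (\<sigma> x + v)) ^ length w / fact (length w))) * indicator {s - \<sigma> x<..t - \<sigma> x} v"
    proof (cases "s < \<sigma> x + v \<and> \<sigma> x + v \<le> t")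
      case True
      \<comment> \<open>Moving the last ring at \<open>x\<close> forward by \<open>v\<close>
        shortens the total survival time by \<open>v\<close>.\<close>
      have S: "(\<Sum>y\<in>B. t - (\<sigma>(x := \<sigma> x + v)) y) = ?S - v"
        using B x by (simp add: sum.remove[of B x])
      have "(\<integral>\<^sup>+\<tau>. f (v, \<tau>) \<partial>?M) = (\<integral>\<^sup>+\<tau>. indicator {\<tau> \<in> space ?M. P v \<tau>} \<tau> \<partial>?M)"
        by (intro nn_integral_cong) (simp add: f_def indicator_def)
      also have "\<dots> = emeasure ?M {\<tau> \<in> space ?M. P v \<tau>}"
        using PM2[of v] by simp
      also have "{\<tau> \<in> space ?M. P v \<tau>} = {\<tau> \<in> space ?M. remaining_rings B t \<tau> w ?c (\<sigma>(x := \<sigma> x + v)) (\<sigma> x + v)}"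
        using True by (simp add: P_def)
      also have "emeasure ?M \<dots> = ennreal (exp (- (?S - v)) * ((t - (\<sigma> x + v)) ^ length w / fact (length w)))"
        unfolding S[symmetric]
      proof (intro Cons.IH w)
        show "(\<sigma>(x := \<sigma> x + v)) y \<le> \<sigma> x + v" if "y \<in> B" for y
          using Cons.prems(2)[of y] that True by (cases "y = x") auto
      qed (use True in auto)
      also have "exp (- (?S - v)) = exp (- ?S) * exp v" by (simp add: exp_add[symmetric])
      finally show ?thesis using True by (simp add: indicator_def algebra_simps)
    next
      case False
      then show ?thesis by (auto simp: f_def P_def indicator_def)
    qed
  qed
  also have "\<dots> = (\<integral>\<^sup>+v. ennreal (exp (- ?S)) * (ennreal (((t - \<sigma> x) - v) ^ length w / fact (length w)) * indicator {s - \<sigma> x..t - \<sigma> x} v) \<partial>lborel)"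
  proof (subst nn_integral_density, goal_cases)
    case 3
    \<comment> \<open>Passing from the half-open to the closed interval changes the integrand only
      at this point, a null set.\<close>
    have e: "ennreal (exponential_density 1 v) * (ennreal (exp (- ?S) * exp v * ((t - (\<sigma> x + v)) ^ length w / fact (length w))) * indicator {s - \<sigma> x<..t - \<sigma> x} v)
        = ennreal (exp (- ?S)) * (ennreal (((t - \<sigma> x) - v) ^ length w / fact (length w)) * indicator {s - \<sigma> x..t - \<sigma> x} v)"
      if "v \<noteq> s - \<sigma> x" for v
    proof (cases "v \<in> {s - \<sigma> x<..t - \<sigma> x}")
      case True
      then have "0 \<le> v" "0 \<le> t - \<sigma> x - v" using Cons.prems(2)[OF x] by auto
      then have "exponential_density 1 v * (exp (- ?S) * exp v * ((t - (\<sigma> x + v)) ^ length w / fact (length w))) =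
          exp (- ?S) * (((t - \<sigma> x) - v) ^ length w / fact (length w))"
        by (simp add: exponential_density_def exp_minus diff_diff_eq field_simps)
      then show ?thesis using True \<open>0 \<le> t - \<sigma> x - v\<close> \<open>0 \<le> v\<close>
        by (simp add: ennreal_mult[symmetric] exponential_density_nonneg diff_diff_eq)
    qed (use that in \<open>auto simp: indicator_def\<close>)
    show ?case
      by (intro nn_integral_cong_AE eventually_mono[OF AE_lborel_singleton[of "s - \<sigma> x"]] e)
  qed auto
  also have "\<dots> = ennreal (exp (- ?S)) * (\<integral>\<^sup>+v. ennreal (((t - \<sigma> x) - v) ^ length w / fact (length w)) * indicator {s - \<sigma> x..t - \<sigma> x} v \<partial>lborel)"
    by (rule nn_integral_cmult) simp
  also have "\<dots> = ennreal (exp (- ?S)) * ennreal ((t - \<sigma> x - (s - \<sigma> x)) ^ Suc (length w) / fact (Suc (length w)))"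
    using Cons.prems(3) by (subst nn_integral_power_interval) auto
  finally show ?case using Cons.prems(3) by (simp add: ennreal_mult[symmetric])
qed

section \<open>The ring history and its law\<close>

lemma is_ring_history_unique:
  assumes "is_ring_history n \<tau> t es" "is_ring_history n \<tau> t es'"
  shows "es = es'"
proof -
  have s: "sorted_wrt (<) (map (ring_time \<tau>) es)" "sorted_wrt (<) (map (ring_time \<tau>) es')"
    using assms by (auto simp: is_ring_history_def sorted_wrt_map)
  have set: "set es = set es'" using assms by (simp add: is_ring_history_def)
  have "map (ring_time \<tau>) es = map (ring_time \<tau>) es'"
    using strict_sorted_equal[OF s] set by auto
  moreover have "inj_on (ring_time \<tau>) (set es)"
    using s(1) by (simp add: strict_sorted_iff distinct_map)
  ultimately show ?thesis using set by (metis inj_on_map_eq_map sup.idem)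
qed

lemma ring_history_eqI: "is_ring_history n \<tau> t es \<Longrightarrow> ring_history n \<tau> t = es"
  by (metis is_ring_history_unique ring_history_def the_equality)

lemma ring_history_cases: "is_ring_history n \<tau> t (ring_history n \<tau> t) \<or> ring_history n \<tau> t = []"
  using ring_history_eqI[of n \<tau> t] by (cases "\<exists>es. is_ring_history n \<tau> t es") (force, simp add: ring_history_def)

lemma ring_history_distinct: "distinct (ring_history n \<tau> t)"
proof -
  have "distinct es" if "is_ring_history n \<tau> t es" for es
  proof -
    have "sorted_wrt (<) (map (ring_time \<tau>) es)" using that by (simp add: is_ring_history_def sorted_wrt_map)
    then show ?thesis using strict_sorted_iff distinct_map by blast
  qed
  then show ?thesis using ring_history_cases[of n \<tau> t] by auto
qed

lemma ring_history_subset: "set (ring_history n \<tau> t) \<subseteq> lat_box n \<times> UNIV"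
  using ring_history_cases[of n \<tau> t] by (auto simp: is_ring_history_def rings_until_def)

lemma is_ring_history_measurable:
  "Measurable.pred (waiting_times n) (\<lambda>\<tau>. is_ring_history n \<tau> t es)"
proof (cases "set es \<subseteq> lat_box n \<times> UNIV")
  case False
  then have "\<not> is_ring_history n \<tau> t es" for \<tau> by (auto simp: is_ring_history_def rings_until_def)
  then show ?thesis by simp
next
  case True
  have rt: "(\<lambda>\<tau>. ring_time \<tau> e) \<in> borel_measurable (waiting_times n)" if "e \<in> lat_box n \<times> UNIV" for e
  proof -
    have "(\<lambda>\<tau>. \<tau> (fst e, j)) \<in> borel_measurable (waiting_times n)" for j
      using measurable_component_singleton[of "(fst e, j)" "lat_box n \<times> UNIV" "\<lambda>_. waiting"] that
      by (auto simp: waiting_times_eq)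
    then show ?thesis by (simp add: ring_time_def case_prod_beta)
  qed
  have 1: "Measurable.pred (waiting_times n) (\<lambda>\<tau>. e \<in> set es \<longleftrightarrow> e \<in> lat_box n \<times> UNIV \<and> ring_time \<tau> e \<le> t)" for e
    using rt[of e] by (cases "e \<in> lat_box n \<times> UNIV") simp_all
  have 2: "Measurable.pred (waiting_times n) (\<lambda>\<tau>. ring_time \<tau> (es ! i) < ring_time \<tau> (es ! j))" if "i < j" "j < length es" for i j
  proof -
    have "es ! i \<in> lat_box n \<times> UNIV" "es ! j \<in> lat_box n \<times> UNIV" using True that nth_mem[of i es] nth_mem[of j es] by auto
    from this[THEN rt] show ?thesis by simp
  qed
  have "is_ring_history n \<tau> t es \<longleftrightarrow> (\<forall>e. e \<in> set es \<longleftrightarrow> e \<in> lat_box n \<times> UNIV \<and> ring_time \<tau> e \<le> t) \<and>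
      (\<forall>j\<in>{..<length es}. \<forall>i\<in>{..<j}. ring_time \<tau> (es ! i) < ring_time \<tau> (es ! j))" for \<tau>
    unfolding is_ring_history_def rings_until_def sorted_wrt_iff_nth_less by (auto simp: set_eq_iff)
  moreover have [measurable]: "Measurable.pred (waiting_times n) (\<lambda>\<tau>. \<forall>e. e \<in> set es \<longleftrightarrow> e \<in> lat_box n \<times> UNIV \<and> ring_time \<tau> e \<le> t)"
    by (rule pred_intros_countable) (rule 1)
  moreover have [measurable]: "Measurable.pred (waiting_times n) (\<lambda>\<tau>. \<forall>j\<in>{..<length es}. \<forall>i\<in>{..<j}. ring_time \<tau> (es ! i) < ring_time \<tau> (es ! j))"
    by (intro pred_intros_finite 2) auto
  ultimately show ?thesis by (simp only: pred_intros_logic)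
qed

text \<open>Ring lists are countable, so single histories suffice. The default value adds the event
  that no list is a history, again a countable condition.\<close>

lemma ring_history_measurable:
  "(\<lambda>\<tau>. ring_history n \<tau> t) \<in> measurable (waiting_times n) (count_space {es. set es \<subseteq> lat_box n \<times> UNIV})"
proof (subst measurable_count_space_eq2_countable)
  have "{\<tau> \<in> space (waiting_times n). ring_history n \<tau> t = es} \<in> sets (waiting_times n)" for es
  proof -
    have eq: "ring_history n \<tau> t = es \<longleftrightarrow> is_ring_history n \<tau> t es \<or> es = [] \<and> (\<forall>es'. \<not> is_ring_history n \<tau> t es')" for \<tau>
    proof (cases "\<exists>es. is_ring_history n \<tau> t es")
      case True
      then obtain es' where "is_ring_history n \<tau> t es'" by blast
      then show ?thesis using ring_history_eqI is_ring_history_unique by metis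
    qed (auto simp: ring_history_def)
    have "Measurable.pred (waiting_times n) (\<lambda>\<tau>. is_ring_history n \<tau> t es \<or> es = [] \<and> (\<forall>es'. \<not> is_ring_history n \<tau> t es'))"
      using is_ring_history_measurable by (cases "es = []") (simp_all add: pred_intros_countable pred_intros_logic)
    then show ?thesis unfolding eq by simp
  qed
  moreover have "(\<lambda>\<tau>. ring_history n \<tau> t) -` {es} \<inter> space (waiting_times n) = {\<tau> \<in> space (waiting_times n). ring_history n \<tau> t = es}" for es
    by auto
  ultimately show "(\<lambda>\<tau>. ring_history n \<tau> t) \<in> space (waiting_times n) \<rightarrow> {es. set es \<subseteq> lat_box n \<times> UNIV} \<and>
      (\<forall>es\<in>{es. set es \<subseteq> lat_box n \<times> UNIV}. (\<lambda>\<tau>. ring_history n \<tau> t) -` {es} \<inter> space (waiting_times n) \<in> sets (waiting_times n))"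
    using ring_history_subset by (auto simp del: vimage_eq)
qed

lemma prob_space_waiting_times: "prob_space (waiting_times n)"
  unfolding waiting_times_eq by (intro prob_space_PiM prob_space_waiting)

definition ring_sites :: "nat \<Rightarrow> real \<Rightarrow> site list pmf" where
  "ring_sites n t = bind_pmf (poisson_pmf (real (card (lat_box n)) * t)) (\<lambda>k. replicate_pmf k (pmf_of_set (lat_box n)))"

text \<open>The uniform letters cancel the power of the number of clocks in the Poisson weight. What
  remains depends only on the length and agrees with \<open>emeasure_remaining_rings\<close> at
  \<open>\<sigma> = 0\<close>, \<open>s = 0\<close>.\<close>

lemma pmf_ring_sites:
  fixes t :: real
  assumes "lat_box n \<noteq> {}" "0 < t" "set w \<subseteq> lat_box n"
  shows "pmf (ring_sites n t) w = exp (- (card (lat_box n) * t)) * (t ^ length w / fact (length w))"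
proof -
  let ?N = "card (lat_box n)"
  have N: "0 < ?N" using assms(1) lat_box_finite by (simp add: card_gt_0_iff)
  have "ennreal (pmf (ring_sites n t) w) =
      (\<integral>\<^sup>+k. ennreal (pmf (replicate_pmf k (pmf_of_set (lat_box n))) w) \<partial>measure_pmf (poisson_pmf (?N * t)))"
    unfolding ring_sites_def by (rule ennreal_pmf_bind)
  also have "\<dots> = (\<integral>\<^sup>+k. ennreal ((1 / ?N) ^ length w) * indicator {length w} k \<partial>measure_pmf (poisson_pmf (?N * t)))"
    using assms lat_box_finite by (intro nn_integral_cong) (auto simp: pmf_replicate_uniform indicator_def)
  also have "\<dots> = ennreal ((1 / ?N) ^ length w) * ennreal (pmf (poisson_pmf (?N * t)) (length w))"
    by (simp add: nn_integral_cmult_indicator emeasure_pmf_single)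
  also have "\<dots> = ennreal (exp (- (?N * t)) * (t ^ length w / fact (length w)))"
    using N assms by (simp add: ennreal_mult[symmetric] power_mult_distrib power_divide field_simps)
  finally show ?thesis using assms by (subst (asm) ennreal_inj) auto
qed

text \<open>Every word of ring sites has at least its Poisson probability; as these probabilities add up to 1,
  almost surely a history exists and nothing else can occur.\<close>

lemma distr_ring_history:
  assumes "lat_box n \<noteq> {}" "0 < t"
  shows "distr (waiting_times n) (count_space UNIV) (\<lambda>\<tau>. ring_history n \<tau> t) =
    measure_pmf (map_pmf (rings_of (\<lambda>_. 0)) (ring_sites n t))"
proof (rule prob_dominating_pmf)
  let ?B = "lat_box n"
  interpret prob_space "waiting_times n" by (rule prob_space_waiting_times)
  have m: "(\<lambda>\<tau>. ring_history n \<tau> t) \<in> measurable (waiting_times n) (count_space UNIV)"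
    by (rule measurable_compose[OF ring_history_measurable, where g="\<lambda>x. x"]) simp
  show "prob_space (distr (waiting_times n) (count_space UNIV) (\<lambda>\<tau>. ring_history n \<tau> t))"
    by (rule prob_space_distr[OF m])
  show "ennreal (pmf (map_pmf (rings_of (\<lambda>_. 0)) (ring_sites n t)) es)
      \<le> emeasure (distr (waiting_times n) (count_space UNIV) (\<lambda>\<tau>. ring_history n \<tau> t)) {es}" for es
  proof (cases "es \<in> set_pmf (map_pmf (rings_of (\<lambda>_. 0)) (ring_sites n t))")
    case False
    then have "pmf (map_pmf (rings_of (\<lambda>_. 0)) (ring_sites n t)) es = 0" by (simp only: set_pmf_iff simp_thms)
    then show ?thesis by simp
  next
    case True
    then obtain w where w: "w \<in> set_pmf (ring_sites n t)" and es: "es = rings_of (\<lambda>_. 0) w" by auto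
    have wB: "set w \<subseteq> ?B"
      using w assms lat_box_finite[of n] by (auto simp: ring_sites_def set_replicate_pmf)
    have inj: "inj (rings_of (\<lambda>_. 0))" by (metis injI map_fst_rings_of)
    have "pmf (map_pmf (rings_of (\<lambda>_. 0)) (ring_sites n t)) es = pmf (ring_sites n t) w"
      unfolding es by (rule pmf_map_inj'[OF inj])
    also have "ennreal \<dots> = emeasure (waiting_times n) {\<tau> \<in> space (waiting_times n). remaining_rings ?B t \<tau> w (\<lambda>_. 0) (\<lambda>_. 0) 0}"
      unfolding waiting_times_eq pmf_ring_sites[OF assms wB]
      using assms by (subst emeasure_remaining_rings[OF lat_box_finite wB]) auto
    also have "\<dots> \<le> emeasure (waiting_times n) ((\<lambda>\<tau>. ring_history n \<tau> t) -` {es} \<inter> space (waiting_times n))"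
    proof (rule emeasure_mono_AE)
      \<comment> \<open>Almost surely all waiting times are positive, as
        \<open>remaining_rings_history\<close> requires; off this null set the event forces the
        history \<open>es\<close>.\<close>
      have "AE z in waiting. 0 < z"
        using AE_lborel_singleton[of "0 :: real"]
        by (subst AE_density) (auto simp: exponential_density_def elim!: eventually_mono)
      then have "AE \<tau> in waiting_times n. 0 < \<tau> e" if "e \<in> ?B \<times> UNIV" for e
        unfolding waiting_times_eq by (intro AE_PiM_component prob_space_waiting that)
      then have "AE \<tau> in waiting_times n. \<forall>e\<in>?B \<times> UNIV. 0 < \<tau> e"
        by (subst AE_ball_countable) auto
      then show "AE \<tau> in waiting_times n. \<tau> \<in> {\<tau> \<in> space (waiting_times n). remaining_rings ?B t \<tau> w (\<lambda>_. 0) (\<lambda>_. 0) 0} \<longrightarrow>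
          \<tau> \<in> (\<lambda>\<tau>. ring_history n \<tau> t) -` {es} \<inter> space (waiting_times n)"
      proof (rule eventually_mono, intro impI)
        fix \<tau> :: "ring \<Rightarrow> real" assume pos: "\<forall>e\<in>?B \<times> UNIV. 0 < \<tau> e"
          and \<tau>: "\<tau> \<in> {\<tau> \<in> space (waiting_times n). remaining_rings ?B t \<tau> w (\<lambda>_. 0) (\<lambda>_. 0) 0}"
        have "is_ring_history n \<tau> t es"
          using remaining_rings_history[of ?B \<tau> "\<lambda>_. 0" "\<lambda>_. 0" w t 0] pos \<tau> wB
          by (auto simp: is_ring_history_def rings_until_def es)
        then show "\<tau> \<in> (\<lambda>\<tau>. ring_history n \<tau> t) -` {es} \<inter> space (waiting_times n)"
          using \<tau> by (simp add: ring_history_eqI)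
      qed
      show "(\<lambda>\<tau>. ring_history n \<tau> t) -` {es} \<inter> space (waiting_times n) \<in> sets (waiting_times n)"
        using m by (rule measurable_sets) simp
    qed
    finally show ?thesis using m by (simp add: emeasure_distr)
  qed
qed simp

section \<open>The box\<close>

definition edge_weight :: "site \<Rightarrow> site \<Rightarrow> real" where
  "edge_weight x y = (if x \<sim>\<^sub>\<int> y then 1 / 4 else 0)"

definition sine :: "nat \<Rightarrow> site \<Rightarrow> real" where
  "sine n x = sin (pi * fst x / n) * sin (pi * snd x / n)"

lemma adj_commute: "x \<sim>\<^sub>\<int> y \<longleftrightarrow> y \<sim>\<^sub>\<int> x"
  by (simp add: adj_def lat_dist_def abs_minus_commute)

lemma neighbours: "{y. y \<sim>\<^sub>\<int> (a, b)} = {(a - 1, b), (a + 1, b), (a, b - 1), (a, b + 1)}"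
  by (auto simp: adj_def lat_dist_def abs_if split: if_splits)

lemma finite_neighbours: "finite {y. y \<sim>\<^sub>\<int> x}"
  by (cases x) (simp add: neighbours)

lemma sum_neighbours: "(\<Sum>y\<in>{y. y \<sim>\<^sub>\<int> (a, b)}. f y) = f (a - 1, b) + f (a + 1, b) + f (a, b - 1) + f (a, b + 1)"
  unfolding neighbours by (simp add: add.assoc)

lemma sum_edge_weight:
  "(\<Sum>y\<in>lat_box n. edge_weight x y * h y) = 1 / 4 * (\<Sum>y\<in>{y. y \<sim>\<^sub>\<int> x}. zero_ext n h y)"
proof -
  have "(\<Sum>y\<in>{y. y \<sim>\<^sub>\<int> x}. zero_ext n h y) = (\<Sum>y\<in>{y. y \<sim>\<^sub>\<int> x} \<inter> lat_box n. h y)"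
    unfolding zero_ext_def using finite_neighbours by (simp add: sum.inter_restrict)
  also have "\<dots> = (\<Sum>y\<in>lat_box n. if y \<sim>\<^sub>\<int> x then h y else 0)"
    using lat_box_finite[of n] by (subst sum.inter_filter[symmetric]) (auto intro!: sum.cong)
  finally show ?thesis
    by (simp add: edge_weight_def adj_commute[of x] sum_distrib_left if_distrib if_distribR cong: if_cong)
qed

text \<open>A neighbour outside the box has a coordinate 0 or \<open>n\<close>, where one of the
  sines vanishes: \<open>sine\<close> satisfies the zero boundary condition by itself.\<close>

lemma sine_zero_ext:
  assumes "x \<in> lat_box n" "y \<sim>\<^sub>\<int> x"
  shows "zero_ext n (sine n) y = sine n y"
proof (cases "y \<in> lat_box n")
  case False
  obtain a b where x: "x = (a, b)" by force
  obtain c d where y: "y = (c, d)" by force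
  have ab: "1 \<le> a" "a \<le> int n - 1" "1 \<le> b" "b \<le> int n - 1" using assms(1) by (auto simp: lat_box_def x)
  have "(c, d) \<in> {(a - 1, b), (a + 1, b), (a, b - 1), (a, b + 1)}"
    using assms(2) neighbours unfolding x y by blast
  then have "c = 0 \<or> c = int n \<or> d = 0 \<or> d = int n"
    using ab False unfolding y lat_box_def by auto
  moreover have "0 < n" using ab by simp
  ultimately have "sine n y = 0" by (auto simp: sine_def y)
  with False show ?thesis by (simp add: zero_ext_def)
qed (simp add: zero_ext_def)

lemma sine_neighbours:
  "(\<Sum>y\<in>{y. y \<sim>\<^sub>\<int> x}. sine n y) = 4 * cos (pi / n) * sine n x"
proof -
  obtain a b where x: "x = (a, b)" by force
  have s: "sin (pi * real_of_int (c - 1) / n) + sin (pi * real_of_int (c + 1) / n) = 2 * cos (pi / n) * sin (pi * c / n)" for c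
    by (simp add: ring_distribs diff_divide_distrib add_divide_distrib sin_add sin_diff)
  have "(\<Sum>y\<in>{y. y \<sim>\<^sub>\<int> x}. sine n y) =
      (sin (pi * real_of_int (a - 1) / n) + sin (pi * real_of_int (a + 1) / n)) * sin (pi * b / n) +
      sin (pi * a / n) * (sin (pi * real_of_int (b - 1) / n) + sin (pi * real_of_int (b + 1) / n))"
    unfolding x sum_neighbours sine_def by (simp add: ring_distribs)
  also have "\<dots> = 4 * cos (pi / n) * sine n x"
    unfolding s by (simp add: sine_def x)
  finally show ?thesis .
qed

lemma sin_box_pos:
  assumes "1 \<le> i" "i \<le> int n - 1"
  shows "0 < sin (pi * real_of_int i / n)"
proof (rule sin_gt_zero)
  have "real_of_int i < real n" using assms by linarith
  then show "pi * real_of_int i / n < pi" using assms by (simp add: divide_less_eq)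
qed (use assms in simp)

locale box =
  fixes n :: nat
  assumes n_ge_2: "2 \<le> n"
begin

lemma cos_bounds: "0 \<le> cos (pi / n)" "cos (pi / n) < 1"
proof -
  have "pi / n \<le> pi / 2" using n_ge_2 by (intro divide_left_mono) auto
  moreover have "0 < pi / n" using n_ge_2 by simp
  ultimately show "0 \<le> cos (pi / n)" by (intro cos_ge_zero) auto
  show "cos (pi / n) < 1"
  proof -
    have "pi / n \<le> pi" using \<open>pi / n \<le> pi / 2\<close> pi_gt_zero by linarith
    then show ?thesis using \<open>0 < pi / n\<close> cos_monotone_0_pi[of 0 "pi / n"] by simp
  qed
qed

sublocale heat_bath_kernel "lat_box n" edge_weight "sine n" "cos (pi / n)"
proof
  show "finite (lat_box n)" by (rule lat_box_finite)
  show "lat_box n \<noteq> {}" using n_ge_2 by (auto simp: lat_box_def)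
  show "edge_weight x y = edge_weight y x" for x y by (simp add: edge_weight_def adj_commute)
  show "0 \<le> edge_weight x y" for x y by (simp add: edge_weight_def)
  show "edge_weight x x = 0" for x by (simp add: edge_weight_def adj_def lat_dist_def)
  show "0 < sine n x" "sine n x \<le> 1" if "x \<in> lat_box n" for x
  proof -
    have pos: "0 < sin (pi * fst x / n)" "0 < sin (pi * snd x / n)"
      using that by (auto simp: lat_box_def intro: sin_box_pos)
    then show "0 < sine n x" by (simp add: sine_def)
    show "sine n x \<le> 1" unfolding sine_def using pos by (intro mult_le_one) auto
  qed
  show "(\<Sum>y\<in>lat_box n. edge_weight x y * sine n y) = cos (pi / n) * sine n x" if "x \<in> lat_box n" for x
    unfolding sum_edge_weight using sine_zero_ext[OF that] by (simp add: sine_neighbours)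
qed (rule cos_bounds)+

lemma heat_bath_eq: "heat_bath n x z h = resample x z h"
  by (simp add: heat_bath_def resample_def avg_def sum_edge_weight)

section \<open>The free field as the Gibbs measure of the kernel\<close>

lemma finite_bdry: "finite (bdry n)"
proof (rule finite_subset)
  show "bdry n \<subseteq> (\<Union>x\<in>lat_box n. {v. v \<sim>\<^sub>\<int> x})" by (auto simp: bdry_def adj_def)
qed (simp add: lat_box_finite finite_neighbours)

text \<open>Every site of the box has four edges, each of weight 1/4 in the kernel. With the
  prefactor 1/8 of \<open>gibbs_weight\<close> this gives the exponent \<open>- energy h / 2\<close>
  of \<open>weight\<close>.\<close>

lemma dirichlet_energy_eq: "dirichlet_energy n h = 4 * energy h"
proof -
  let ?B = "lat_box n" and ?V = "lat_box n \<union> bdry n" and ?z = "zero_ext n h"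
  let ?a = "\<lambda>x y. if x \<sim>\<^sub>\<int> y then 1 else 0 :: real"
  have fin: "finite ?V" using lat_box_finite finite_bdry by simp
  have restrict: "(\<Sum>x\<in>?V. ?z x * g x) = (\<Sum>x\<in>?B. h x * g x)" for g
    using fin by (intro sum.mono_neutral_cong_right) (auto simp: zero_ext_def)
  \<comment> \<open>All four neighbours of a site lie in the box or in \<open>bdry n\<close>, so the
    degree is 4 near the boundary too.\<close>
  have deg: "(\<Sum>y\<in>?V. ?a x y) = 4" if "x \<in> ?B" for x
  proof -
    have "(\<Sum>y\<in>?V. ?a x y) = card {y \<in> ?V. x \<sim>\<^sub>\<int> y}"
      using fin by (simp add: sum.inter_filter[symmetric])
    also have "{y \<in> ?V. x \<sim>\<^sub>\<int> y} = {y. y \<sim>\<^sub>\<int> x}"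
      using that by (auto simp: bdry_def adj_commute[of x]) (auto simp: adj_def)
    also have "card \<dots> = 4" by (cases x) (simp add: neighbours)
    finally show ?thesis by simp
  qed
  have sq: "(\<Sum>x\<in>?V. \<Sum>y\<in>?V. ?a x y * (?z x)\<^sup>2) = 4 * (\<Sum>x\<in>?B. (h x)\<^sup>2)"
  proof -
    have "(\<Sum>x\<in>?V. \<Sum>y\<in>?V. ?a x y * (?z x)\<^sup>2) = (\<Sum>x\<in>?V. ?z x * (?z x * (\<Sum>y\<in>?V. ?a x y)))"
      by (simp add: sum_distrib_left power2_eq_square mult_ac)
    also have "\<dots> = (\<Sum>x\<in>?B. h x * (?z x * (\<Sum>y\<in>?V. ?a x y)))" by (rule restrict)
    also have "\<dots> = 4 * (\<Sum>x\<in>?B. (h x)\<^sup>2)"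
      by (simp add: deg zero_ext_def sum_distrib_left power2_eq_square mult_ac)
    finally show ?thesis .
  qed
  have "(\<Sum>x\<in>?V. \<Sum>y\<in>?V. ?a x y * (?z y)\<^sup>2) = (\<Sum>x\<in>?V. \<Sum>y\<in>?V. ?a x y * (?z x)\<^sup>2)"
    by (subst sum.swap) (simp add: adj_commute)
  note sq' = this[unfolded sq]
  have cross: "(\<Sum>x\<in>?V. \<Sum>y\<in>?V. ?a x y * (?z x * ?z y)) = 4 * (\<Sum>x\<in>?B. h x * avg h x)"
  proof -
    have "(\<Sum>x\<in>?V. \<Sum>y\<in>?V. ?a x y * (?z x * ?z y)) = (\<Sum>x\<in>?V. ?z x * (\<Sum>y\<in>?V. ?z y * ?a x y))"
      by (simp add: sum_distrib_left mult_ac)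
    also have "\<dots> = (\<Sum>x\<in>?B. h x * (\<Sum>y\<in>?B. h y * ?a x y))" by (simp only: restrict)
    also have "\<dots> = (\<Sum>x\<in>?B. h x * (4 * avg h x))"
      by (intro sum.cong refl) (auto simp: avg_def edge_weight_def sum_distrib_left intro!: sum.cong)
    finally show ?thesis by (simp add: sum_distrib_left mult_ac)
  qed
  have "dirichlet_energy n h = (\<Sum>x\<in>?V. \<Sum>y\<in>?V. ?a x y * (?z x - ?z y)\<^sup>2) / 2"
    unfolding dirichlet_energy_def sum.inter_filter[OF fin]
    by (intro arg_cong2[where f="(/)"] sum.cong refl) auto
  also have "(\<Sum>x\<in>?V. \<Sum>y\<in>?V. ?a x y * (?z x - ?z y)\<^sup>2) =
      (\<Sum>x\<in>?V. \<Sum>y\<in>?V. ?a x y * (?z x)\<^sup>2 + ?a x y * (?z y)\<^sup>2 - 2 * (?a x y * (?z x * ?z y)))"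
    by (intro sum.cong refl) (simp add: power2_eq_square algebra_simps)
  also have "\<dots> = 4 * (\<Sum>x\<in>?B. (h x)\<^sup>2) + 4 * (\<Sum>x\<in>?B. (h x)\<^sup>2) - 2 * (4 * (\<Sum>x\<in>?B. h x * avg h x))"
    unfolding sum.distrib sum_subtractf sum_distrib_left[symmetric] sq sq' cross ..
  finally show ?thesis
    by (simp add: energy_def right_diff_distrib sum_subtractf power2_eq_square)
qed

lemma dgff_eq: "dgff n = gibbs"
  by (simp add: dgff_def gibbs_def gibbs_weight_def[abs_def] weight_def partition_fun_def dirichlet_energy_eq)

section \<open>The law at time t as a Poisson mixture over words\<close>

lemma noise_eq: "noise n = PiM (lat_box n \<times> UNIV) (\<lambda>_. std_gauss)"
  by (simp add: noise_def)

lemma prob_space_noise: "prob_space (noise n)"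
  unfolding noise_eq by (intro prob_space_PiM prob_space_std_gauss)

lemma updates_measurable:
  assumes "g \<in> measurable M fields" "set es \<subseteq> lat_box n \<times> UNIV"
    and "\<And>e. e \<in> lat_box n \<times> UNIV \<Longrightarrow> (\<lambda>\<omega>. \<zeta> \<omega> e) \<in> borel_measurable M"
  shows "(\<lambda>\<omega>. fold (\<lambda>e h. heat_bath n (fst e) (\<zeta> \<omega> e) h) es (g \<omega>)) \<in> measurable M fields"
  using assms(1,2)
proof (induction es arbitrary: g)
  case (Cons e es)
  have m: "(\<lambda>\<omega>. (\<zeta> \<omega> e, g \<omega>)) \<in> measurable M (borel \<Otimes>\<^sub>M fields)"
    using Cons.prems assms(3)[of e] by simp
  have x: "fst e \<in> lat_box n" using Cons.prems by auto
  have "(\<lambda>\<omega>. heat_bath n (fst e) (\<zeta> \<omega> e) (g \<omega>)) \<in> measurable M fields"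
    using measurable_compose[OF m resample_measurable[OF x]] by (simp add: heat_bath_eq)
  then show ?case using Cons by simp
qed simp

text \<open>Distinct rings use distinct Gaussians, so the one of the first ring can be peeled off
  and integrated last.\<close>

lemma nn_integral_noise_updates:
  assumes "distinct es" "set es \<subseteq> lat_box n \<times> UNIV" "h \<in> space fields" and f: "f \<in> borel_measurable fields"
  shows "(\<integral>\<^sup>+\<zeta>. f (fold (\<lambda>e h. heat_bath n (fst e) (\<zeta> e) h) es h) \<partial>noise n) = transition (map fst es) f h"
  using assms(1-3)
proof (induction es arbitrary: h)
  case Nil
  then show ?case using prob_space.emeasure_space_1[OF prob_space_noise] by simp
next
  case (Cons e es)
  define F where "F = (\<lambda>(z, \<zeta>). f (fold (\<lambda>e h. heat_bath n (fst e) (\<zeta> e) h) es (heat_bath n (fst e) z h)))"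
  have e: "e \<in> lat_box n \<times> UNIV" "fst e \<in> lat_box n" using Cons.prems by auto
  have "(\<lambda>\<omega>. fold (\<lambda>e h. heat_bath n (fst e) (snd \<omega> e) h) es (heat_bath n (fst e) (fst \<omega>) h)) \<in> measurable (std_gauss \<Otimes>\<^sub>M noise n) fields"
  proof (rule updates_measurable)
    show "(\<lambda>\<omega>. heat_bath n (fst e) (fst \<omega>) h) \<in> measurable (std_gauss \<Otimes>\<^sub>M noise n) fields"
      unfolding heat_bath_eq
      by (rule measurable_compose[OF _ resample_measurable'[OF e(2) Cons.prems(3)]])
        (use measurable_fst[of std_gauss "noise n"] in \<open>simp cong: measurable_cong_sets\<close>)
    show "(\<lambda>\<omega>. snd \<omega> e') \<in> borel_measurable (std_gauss \<Otimes>\<^sub>M noise n)" if "e' \<in> lat_box n \<times> UNIV" for e'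
      using measurable_compose[OF measurable_snd measurable_component_singleton[OF that, of "\<lambda>_. std_gauss"]]
      unfolding noise_eq by simp
  qed (use Cons.prems in auto)
  then have F: "F \<in> borel_measurable (std_gauss \<Otimes>\<^sub>M noise n)"
    unfolding F_def case_prod_beta' by (rule measurable_compose[OF _ f])
  have "(\<integral>\<^sup>+\<zeta>. f (fold (\<lambda>e h. heat_bath n (fst e) (\<zeta> e) h) (e # es) h) \<partial>noise n) = (\<integral>\<^sup>+\<zeta>. F (\<zeta> e, \<zeta>) \<partial>noise n)"
    by (simp add: F_def)
  also have "\<dots> = (\<integral>\<^sup>+z. \<integral>\<^sup>+\<zeta>. F (z, \<zeta>) \<partial>noise n \<partial>std_gauss)"
    unfolding noise_eq
  proof (rule nn_integral_PiM_peel[OF prob_space_std_gauss e(1) F[unfolded noise_eq]])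
    fix z a \<zeta>
    have "fold (\<lambda>e' h. heat_bath n (fst e') ((\<zeta>(e := a)) e') h) es g = fold (\<lambda>e' h. heat_bath n (fst e') (\<zeta> e') h) es g" for g
      using Cons.prems(1) by (intro fold_cong) auto
    then show "F (z, \<zeta>(e := a)) = F (z, \<zeta>)" by (simp add: F_def)
  qed
  also have "\<dots> = (\<integral>\<^sup>+z. transition (map fst es) f (resample (fst e) z h) \<partial>std_gauss)"
  proof (intro nn_integral_cong)
    fix z
    show "(\<integral>\<^sup>+\<zeta>. F (z, \<zeta>) \<partial>noise n) = transition (map fst es) f (resample (fst e) z h)"
      unfolding F_def prod.case heat_bath_eq[of "fst e" z]
      by (rule Cons.IH) (use Cons.prems e in \<open>auto intro: resample_space\<close>)
  qed
  finally show ?case by simp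
qed

lemma glauber_state_measurable:
  assumes "h \<in> space fields"
  shows "(\<lambda>(\<tau>, \<zeta>). glauber_state n h \<tau> \<zeta> t) \<in> measurable (waiting_times n \<Otimes>\<^sub>M noise n) fields"
proof -
  have "(\<lambda>\<omega>. fold (\<lambda>e h. heat_bath n (fst e) (snd \<omega> e) h) (ring_history n (fst \<omega>) t) h)
      \<in> measurable (waiting_times n \<Otimes>\<^sub>M noise n) fields"
  proof (rule measurable_compose_countable'[where I="{es. set es \<subseteq> lat_box n \<times> UNIV}" and
        f="\<lambda>es \<omega>. fold (\<lambda>e h. heat_bath n (fst e) (snd \<omega> e) h) es h"])
    show "(\<lambda>\<omega>. ring_history n (fst \<omega>) t) \<in> measurable (waiting_times n \<Otimes>\<^sub>M noise n) (count_space {es. set es \<subseteq> lat_box n \<times> UNIV})"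
      by (rule measurable_compose[OF measurable_fst ring_history_measurable])
    fix es :: "ring list" assume "es \<in> {es. set es \<subseteq> lat_box n \<times> UNIV}"
    then show "(\<lambda>\<omega>. fold (\<lambda>e h. heat_bath n (fst e) (snd \<omega> e) h) es h) \<in> measurable (waiting_times n \<Otimes>\<^sub>M noise n) fields"
    proof (intro updates_measurable)
      show "(\<lambda>\<omega>. snd \<omega> e) \<in> borel_measurable (waiting_times n \<Otimes>\<^sub>M noise n)" if "e \<in> lat_box n \<times> UNIV" for e
        using measurable_compose[OF measurable_snd measurable_component_singleton[OF that, of "\<lambda>_. std_gauss"]]
        unfolding noise_eq by simp
    qed (use assms in auto)
  qed simp
  then show ?thesis by (simp add: glauber_state_def case_prod_beta')
qed

text \<open>Fubini with the clocks outside: the noise integral is a transition along the sites of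
  the history, and the history is then replaced by its law.\<close>

lemma emeasure_glauber_law:
  assumes h: "h \<in> space fields" and t: "0 < t" and A: "A \<in> sets fields"
  shows "emeasure (glauber_law n h t) A = (\<integral>\<^sup>+w. transition w (indicator A) h \<partial>measure_pmf (ring_sites n t))"
proof -
  interpret W: prob_space "waiting_times n" by (rule prob_space_waiting_times)
  interpret Z: prob_space "noise n" by (rule prob_space_noise)
  interpret P: pair_sigma_finite "waiting_times n" "noise n" ..
  note m = glauber_state_measurable[OF h, of t]
  have m': "(\<lambda>\<omega>. indicator A (glauber_state n h (fst \<omega>) (snd \<omega>) t) :: ennreal) \<in> borel_measurable (waiting_times n \<Otimes>\<^sub>M noise n)"
    using measurable_compose[OF m, of "indicator A :: _ \<Rightarrow> ennreal" borel] A by (simp add: case_prod_beta')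
  have "emeasure (glauber_law n h t) A = (\<integral>\<^sup>+h. indicator A h \<partial>glauber_law n h t)"
    using A by (simp add: glauber_law_def)
  also have "\<dots> = (\<integral>\<^sup>+\<omega>. indicator A (glauber_state n h (fst \<omega>) (snd \<omega>) t) \<partial>(waiting_times n \<Otimes>\<^sub>M noise n))"
    unfolding glauber_law_def using A by (subst nn_integral_distr[OF m]) (auto simp: case_prod_beta')
  also have "\<dots> = (\<integral>\<^sup>+\<tau>. \<integral>\<^sup>+\<zeta>. indicator A (glauber_state n h \<tau> \<zeta> t) \<partial>noise n \<partial>waiting_times n)"
    using Z.nn_integral_fst[OF m'] by simp
  also have "\<dots> = (\<integral>\<^sup>+\<tau>. transition (map fst (ring_history n \<tau> t)) (indicator A) h \<partial>waiting_times n)"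
    unfolding glauber_state_def using h A
    by (intro nn_integral_cong nn_integral_noise_updates ring_history_distinct ring_history_subset) auto
  also have "\<dots> = (\<integral>\<^sup>+es. transition (map fst es) (indicator A) h \<partial>distr (waiting_times n) (count_space UNIV) (\<lambda>\<tau>. ring_history n \<tau> t))"
    by (subst nn_integral_distr) (auto intro: measurable_compose[OF ring_history_measurable, where g="\<lambda>x. x", simplified])
  also have "\<dots> = (\<integral>\<^sup>+w. transition w (indicator A) h \<partial>measure_pmf (ring_sites n t))"
    using B_nonempty t by (simp add: distr_ring_history)
  finally show ?thesis .
qed

lemma nn_integral_ring_sites:
  "(\<integral>\<^sup>+w. f w \<partial>measure_pmf (ring_sites n t)) =
    (\<integral>\<^sup>+k. mean_words k (\<lambda>w. f w) \<partial>measure_pmf (poisson_pmf (real (card (lat_box n)) * t)))"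
  by (simp add: ring_sites_def)

lemma sets_glauber_law[simp]: "sets (glauber_law n h t) = sets fields"
  by (simp add: glauber_law_def)

lemma prob_space_glauber_law:
  assumes "h \<in> space fields"
  shows "prob_space (glauber_law n h t)"
proof -
  interpret W: prob_space "waiting_times n" by (rule prob_space_waiting_times)
  interpret Z: prob_space "noise n" by (rule prob_space_noise)
  interpret P: pair_prob_space "waiting_times n" "noise n" ..
  show ?thesis unfolding glauber_law_def by (rule P.prob_space_distr[OF glauber_state_measurable[OF assms]])
qed

lemma card_box: "card (lat_box n) = (n - 1)\<^sup>2"
proof -
  have "nat (int n - 1) = n - 1" by arith
  then show ?thesis by (simp add: lat_box_def power2_eq_square)
qed

lemma prob_space_dgff: "prob_space (dgff n)"
  unfolding dgff_eq by (rule prob_space_gibbs)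

lemma bounded_heights_space: "h \<in> bounded_heights n \<Longrightarrow> h \<in> space fields"
  by (simp add: bounded_heights_def)

lemma bounded_heights_nonempty: "bounded_heights n \<noteq> {}"
proof -
  have "(\<lambda>x\<in>lat_box n. 0) \<in> bounded_heights n" by (auto simp: bounded_heights_def space_PiM)
  then show ?thesis by blast
qed

lemma d_TV_bdd: "bdd_above ((\<lambda>h. tv_dist (glauber_law n h t) (dgff n)) ` bounded_heights n)"
  using tv_dist_bounds(2)[OF prob_space_glauber_law[OF bounded_heights_space] prob_space_dgff]
  by (intro bdd_aboveI[where M=1]) auto

lemma d_TV_upper: "h \<in> bounded_heights n \<Longrightarrow> tv_dist (glauber_law n h t) (dgff n) \<le> d_TV n t"
  unfolding d_TV_def by (intro cSUP_upper d_TV_bdd)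

lemma d_TV_bounds: "0 \<le> d_TV n t" "d_TV n t \<le> 1"
proof -
  obtain h where h: "h \<in> bounded_heights n" using bounded_heights_nonempty by blast
  show "0 \<le> d_TV n t"
    using d_TV_upper[OF h, of t] tv_dist_bounds(1)[OF prob_space_glauber_law[OF bounded_heights_space[OF h]] prob_space_dgff, of t]
    by linarith
  show "d_TV n t \<le> 1"
    unfolding d_TV_def using bounded_heights_nonempty
    by (intro cSUP_least tv_dist_bounds prob_space_glauber_law bounded_heights_space prob_space_dgff)
qed

section \<open>Bounds at a fixed box size\<close>

text \<open>A Poisson number of at least \<open>k + m + g\<close> updates leaves a harmless surplus
  \<open>r\<close>; fewer are charged to the lower tail. The term \<open>N * n^2\<close> bounds the
  squared norm of heights at most \<open>n\<close>.\<close>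

lemma d_TV_le:
  fixes N :: real
  defines "N \<equiv> real (card (lat_box n))"
  assumes t: "0 < t" and s: "0 < s" "s \<le> 1" and \<delta>: "0 \<le> \<delta>" "\<delta> \<le> 1" and \<theta>: "0 \<le> \<theta>"
  shows "d_TV n t \<le> coupling_error k m g s \<delta> (2 * (N * (real n)\<^sup>2) + 8 * N / (1 - cos (pi / n))) + exp (- (N / 2)) + exp (\<theta> * real (k + m + g) - \<theta> * (N * t) + \<theta>\<^sup>2 * (N * t) / 2)"
    (is "_ \<le> ?e + ?p")
proof -
  have N: "0 < N" using card_B_pos by (simp add: N_def)
  have e0: "0 \<le> ?e"
    using s \<delta> cos_bounds N by (intro add_nonneg_nonneg coupling_error_nonneg) auto
  have "tv_dist (glauber_law n h t) (dgff n) \<le> ?e + ?p" if h: "h \<in> bounded_heights n" for h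
  proof (rule tv_dist_le)
    note hs = bounded_heights_space[OF h]
    show "prob_space (glauber_law n h t)" "prob_space (dgff n)"
      by (rule prob_space_glauber_law[OF hs], rule prob_space_dgff)
    show "sets (glauber_law n h t) = sets (dgff n)" by (simp add: dgff_eq)
    show "0 \<le> ?e + ?p" using e0 by simp
    fix A assume "A \<in> sets (glauber_law n h t)"
    then have A: "A \<in> sets fields" by simp
    have Q: "norm_sq h \<le> N * (real n)\<^sup>2"
    proof -
      have "norm_sq h \<le> (\<Sum>x\<in>lat_box n. (real n)\<^sup>2)"
        unfolding norm_sq_def using h by (intro sum_mono) (auto simp: bounded_heights_def abs_le_square_iff[symmetric])
      then show ?thesis by (simp add: N_def)
    qed
    have "emeasure (glauber_law n h t) A =
       (\<integral>\<^sup>+j. mean_words j (\<lambda>w. transition w (indicator A) h) \<partial>measure_pmf (poisson_pmf (N * t)))"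
      by (simp add: emeasure_glauber_law[OF hs t A] nn_integral_ring_sites N_def)
    also have "\<dots> \<le> (\<integral>\<^sup>+j. emeasure (dgff n) A + ennreal ?e + indicator {..<k + m + g} j \<partial>measure_pmf (poisson_pmf (N * t)))"
    proof (intro nn_integral_mono)
      fix j
      show "mean_words j (\<lambda>w. transition w (indicator A) h) \<le> emeasure (dgff n) A + ennreal ?e + indicator {..<k + m + g} j"
      proof (cases "j < k + m + g")
        case True
        have "mean_words j (\<lambda>w. transition w (indicator A) h) \<le> mean_words j (\<lambda>w. 1)"
          by (intro nn_integral_mono transition_le_1) (simp add: indicator_def)
        also have "\<dots> = 0 + 0 + indicator {..<k + m + g} j" using True by simp
        also have "\<dots> \<le> emeasure (dgff n) A + ennreal ?e + indicator {..<k + m + g} j" by (intro add_mono) auto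
        finally show ?thesis .
      next
        case False
        then obtain r where r: "j = k + (m + (g + r))" by (metis add.assoc le_iff_add not_less)
        have "mean_words j (\<lambda>w. transition w (indicator A) h) \<le> emeasure (dgff n) A + ennreal ?e"
          using words_mixing[OF hs A Q s \<delta>, of k m g r] unfolding r dgff_eq N_def .
        then show ?thesis using False by simp
      qed
    qed
    also have "\<dots> = emeasure (dgff n) A + ennreal ?e + emeasure (measure_pmf (poisson_pmf (N * t))) {..<k + m + g}"
      by (simp add: nn_integral_add)
    also have "\<dots> \<le> emeasure (dgff n) A + ennreal ?e + ennreal ?p"
      using poisson_lower_tail[of "N * t" \<theta> "k + m + g"] N t \<theta> by (intro add_left_mono) simp
    finally show "emeasure (glauber_law n h t) A \<le> emeasure (dgff n) A + ennreal (?e + ?p)"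
      by (simp only: ennreal_plus[OF e0 exp_ge_zero] add.assoc[symmetric])
  qed
  then show ?thesis unfolding d_TV_def using bounded_heights_nonempty by (intro cSUP_least)
qed

text \<open>Multiplied by \<open>sin (pi / n)\<close> the sum telescopes, and its two ends differ by
  a full period.\<close>

lemma sum_cos_double: "(\<Sum>i<n. cos (2 * (pi * real i / n))) = 0"
proof -
  let ?a = "pi / n"
  have n: "0 < n" using n_ge_2 by simp
  have "sin ?a * (\<Sum>i<n. cos (2 * (pi * real i / n))) = (\<Sum>i<n. (sin ((2 * real (Suc i) - 1) * ?a) - sin ((2 * real i - 1) * ?a)) / 2)"
    unfolding sum_distrib_left
  proof (intro sum.cong refl)
    fix i
    have "(2 * real (Suc i) - 1) * ?a = 2 * (pi * real i / n) + ?a" "(2 * real i - 1) * ?a = 2 * (pi * real i / n) - ?a"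
      using n by (simp_all add: field_simps)
    then show "sin ?a * cos (2 * (pi * real i / n)) = (sin ((2 * real (Suc i) - 1) * ?a) - sin ((2 * real i - 1) * ?a)) / 2"
      by (simp add: sin_add sin_diff)
  qed
  also have "\<dots> = (\<Sum>i<n. sin ((2 * real (Suc i) - 1) * ?a) - sin ((2 * real i - 1) * ?a)) / 2"
    by (simp add: sum_divide_distrib)
  also have "\<dots> = (sin ((2 * real n - 1) * ?a) - sin ((2 * real 0 - 1) * ?a)) / 2"
    by (subst sum_lessThan_telescope) simp
  also have "(2 * real n - 1) * ?a = - ?a + 2 * pi" using n by (simp add: field_simps)
  also have "(sin (- ?a + 2 * pi) - sin ((2 * real 0 - 1) * ?a)) / 2 = 0" by simp
  finally show ?thesis using sin_box_pos[of 1 n] n_ge_2 by simp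
qed

lemma norm_sq_sine: "norm_sq (sine n) = (real n)\<^sup>2 / 4"
proof -
  let ?S = "\<Sum>i\<in>{1..int n - 1}. (sin (pi * real_of_int i / n))\<^sup>2"
  have "?S = (\<Sum>i\<in>{1..<n}. (sin (pi * real i / n))\<^sup>2)"
    by (rule sum.reindex_bij_witness[of _ int nat]) auto
  also have "\<dots> = (\<Sum>i<n. (sin (pi * real i / n))\<^sup>2)"
    using n_ge_2 by (subst lessThan_atLeast0, subst sum.atLeast_Suc_lessThan) auto
  also have "\<dots> = (\<Sum>i<n. 1 / 2 - 1 / 2 * cos (2 * (pi * real i / n)))"
    by (intro sum.cong refl) (subst cos_double_sin, simp add: field_simps)
  also have "\<dots> = n / 2"
    unfolding sum_subtractf sum_distrib_left[symmetric] sum_cos_double by simp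
  finally have S: "?S = n / 2" .
  have "norm_sq (sine n) = ?S * ?S"
    unfolding norm_sq_def unfolding lat_box_def sine_def power_mult_distrib
    unfolding sum_product sum.cartesian_product by (simp add: case_prod_beta)
  then show ?thesis unfolding S by (simp add: power2_eq_square)
qed

text \<open>Chebyshev's inequality. Averaging over the Poisson length turns the decay of the second
  moment into exactly the square of the decay of the mean, so the variance is at most the initial
  energy, whatever \<open>t\<close>.\<close>

lemma overlap_concentration:
  assumes t: "0 < t" and n3: "3 \<le> n" and d: "\<And>x. x \<in> lat_box n \<Longrightarrow> 0 \<le> d x" and pos: "0 < overlap d"
  defines "M \<equiv> exp (- (1 - cos (pi / n)) * t) * overlap d"
  shows "emeasure (measure_pmf (ring_sites n t)) {w. overlap (evolved w d) < M / 2} \<le> ennreal (4 * energy d / M\<^sup>2)"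
proof -
  let ?W = "measure_pmf (ring_sites n t)"
  let ?N = "real (card (lat_box n))" and ?X = "\<lambda>w. overlap (evolved w d)"
  let ?l = "1 - cos (pi / n)"
  have N: "0 < ?N" using card_B_pos by simp
  have N2: "2 \<le> card (lat_box n)"
  proof -
    have "2 * 2 \<le> (n - 1) * (n - 1)" using n3 by (intro mult_le_mono) auto
    then show ?thesis by (simp add: card_box power2_eq_square)
  qed
  have M: "0 < M" using pos by (simp add: M_def)
  have X0: "0 \<le> ?X w" for w
    unfolding overlap_def using damped_nonneg[OF d] \<phi>_pos by (intro sum_nonneg mult_nonneg_nonneg) (auto intro: less_imp_le)
  have c: "0 \<le> 1 - ?l / ?N" "0 \<le> 1 - 2 * ?l / ?N"
    using N2 cos_bounds by (auto simp: divide_le_eq)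
  have mean: "(\<integral>\<^sup>+w. ennreal (?X w) \<partial>?W) = ennreal M"
  proof -
    have "(\<integral>\<^sup>+w. ennreal (?X w) \<partial>?W) =
        (\<integral>\<^sup>+k. ennreal ((1 - ?l / ?N) ^ k) * ennreal (overlap d) \<partial>measure_pmf (poisson_pmf (?N * t)))"
      unfolding nn_integral_ring_sites
      by (simp only: expected_overlap[OF d] ennreal_mult[OF zero_le_power[OF c(1)] less_imp_le[OF pos]])
    also have "\<dots> = ennreal (exp (?N * t * (1 - ?l / ?N - 1))) * ennreal (overlap d)"
      using N t c by (subst nn_integral_multc) (simp_all add: nn_integral_power_poisson)
    also have "?N * t * (1 - ?l / ?N - 1) = - ?l * t" using N by (simp add: field_simps)
    finally show ?thesis using pos by (simp add: M_def ennreal_mult)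
  qed
  have second: "(\<integral>\<^sup>+w. ennreal ((?X w)\<^sup>2) \<partial>?W) \<le> ennreal (M\<^sup>2 + energy d)"
  proof -
    have "(\<integral>\<^sup>+w. ennreal ((?X w)\<^sup>2) \<partial>?W) \<le>
        (\<integral>\<^sup>+k. ennreal ((1 - 2 * ?l / ?N) ^ k) * ennreal ((overlap d)\<^sup>2) + ennreal (energy d) \<partial>measure_pmf (poisson_pmf (?N * t)))"
      unfolding nn_integral_ring_sites
    proof (intro nn_integral_mono)
      fix k
      have "mean_words k (\<lambda>w. ennreal ((?X w)\<^sup>2)) \<le>
          mean_words k (\<lambda>w. ennreal ((?X w)\<^sup>2 + energy (evolved w d)))"
        using energy_nonneg by (intro nn_integral_mono ennreal_leI) simp
      also have "\<dots> \<le> ennreal ((1 - 2 * ?l / ?N) ^ k * (overlap d)\<^sup>2 + energy d)"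
        by (rule expected_overlap_sq[OF N2])
      also have "\<dots> = ennreal ((1 - 2 * ?l / ?N) ^ k) * ennreal ((overlap d)\<^sup>2) + ennreal (energy d)"
        using c energy_nonneg[of d] by (simp add: ennreal_mult)
      finally show "mean_words k (\<lambda>w. ennreal ((?X w)\<^sup>2)) \<le> \<dots>" .
    qed
    also have "\<dots> = ennreal (exp (?N * t * (1 - 2 * ?l / ?N - 1))) * ennreal ((overlap d)\<^sup>2) + ennreal (energy d)"
      using N t c by (subst nn_integral_add) (simp_all add: nn_integral_multc nn_integral_power_poisson)
    also have "?N * t * (1 - 2 * ?l / ?N - 1) = 2 * (- ?l * t)" using N by (simp add: field_simps)
    also have "ennreal (exp (2 * (- ?l * t))) * ennreal ((overlap d)\<^sup>2) + ennreal (energy d) = ennreal (M\<^sup>2 + energy d)"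
      using energy_nonneg[of d] by (simp only: M_def exp_double power_mult_distrib ennreal_mult[symmetric] zero_le_power2 ennreal_plus[symmetric] mult_nonneg_nonneg)
    finally show ?thesis .
  qed
  \<comment> \<open>The variance expansion without subtraction, as the integrals take values in
    \<open>ennreal\<close>; the term \<open>2 * M^2\<close> is cancelled afterwards.\<close>
  have sq: "ennreal ((M - x)\<^sup>2) + ennreal (2 * M) * ennreal x = ennreal (M\<^sup>2) + ennreal (x\<^sup>2)" if "0 \<le> x" for x
  proof -
    have "ennreal ((M - x)\<^sup>2) + ennreal (2 * M) * ennreal x = ennreal ((M - x)\<^sup>2 + 2 * M * x)"
      using that M by (simp add: ennreal_mult)
    also have "(M - x)\<^sup>2 + 2 * M * x = M\<^sup>2 + x\<^sup>2" by (simp add: power2_eq_square algebra_simps)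
    finally show ?thesis by simp
  qed
  have "(\<integral>\<^sup>+w. ennreal ((M - ?X w)\<^sup>2) \<partial>?W) + ennreal (2 * M\<^sup>2) =
      (\<integral>\<^sup>+w. ennreal ((M - ?X w)\<^sup>2) + ennreal (2 * M) * ennreal (?X w) \<partial>?W)"
    using M by (simp add: nn_integral_add nn_integral_cmult mean ennreal_mult[symmetric] power2_eq_square mult_ac)
  also have "\<dots> = (\<integral>\<^sup>+w. ennreal (M\<^sup>2) + ennreal ((?X w)\<^sup>2) \<partial>?W)"
    by (simp only: sq X0)
  also have "\<dots> = ennreal (M\<^sup>2) + (\<integral>\<^sup>+w. ennreal ((?X w)\<^sup>2) \<partial>?W)"
    by (simp add: nn_integral_add)
  also have "\<dots> \<le> ennreal (M\<^sup>2) + ennreal (M\<^sup>2 + energy d)" by (intro add_left_mono second)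
  also have "\<dots> = ennreal (energy d) + ennreal (2 * M\<^sup>2)"
    using energy_nonneg[of d] by (simp add: ennreal_plus[symmetric] del: ennreal_plus)
  finally have var: "(\<integral>\<^sup>+w. ennreal ((M - ?X w)\<^sup>2) \<partial>?W) \<le> ennreal (energy d)"
    by simp
  have "emeasure ?W {w. ?X w < M / 2} = (\<integral>\<^sup>+w. indicator {w. ?X w < M / 2} w \<partial>?W)"
    by simp
  also have "\<dots> \<le> (\<integral>\<^sup>+w. ennreal (4 / M\<^sup>2) * ennreal ((M - ?X w)\<^sup>2) \<partial>?W)"
  proof (intro nn_integral_mono)
    fix w
    have "1 \<le> 4 / M\<^sup>2 * (M - ?X w)\<^sup>2" if "?X w < M / 2"
    proof -
      have "(M / 2)\<^sup>2 \<le> (M - ?X w)\<^sup>2" using that M by (intro power_mono) auto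
      then show ?thesis using M by (simp add: power_divide field_simps)
    qed
    then show "indicator {w. ?X w < M / 2} w \<le> ennreal (4 / M\<^sup>2) * ennreal ((M - ?X w)\<^sup>2)"
      by (auto simp: indicator_def ennreal_mult[symmetric] ennreal_1[symmetric] simp del: ennreal_1 times_divide_eq_left)
  qed
  also have "\<dots> \<le> ennreal (4 / M\<^sup>2) * ennreal (energy d)"
    by (subst nn_integral_cmult) (auto intro: mult_left_mono var)
  also have "\<dots> = ennreal (4 * energy d / M\<^sup>2)"
    using energy_nonneg[of d] by (simp add: ennreal_mult[symmetric] del: times_divide_eq_left) (simp add: field_simps)
  finally show ?thesis .
qed

text \<open>Up to constants and the bounds on the gap, \<open>X\<close> is the squared mean of the
  overlap over its stationary variance. One exponential comes from the free field, two from the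
  Gaussian noise of the dynamics; the last term comes from the clocks, as \<open>16 * l / X\<close>
  with \<open>l\<close> at most 2.\<close>

lemma d_TV_ge:
  assumes t: "0 < t" and n3: "3 \<le> n" and gap: "2 / (real n)\<^sup>2 \<le> 1 - cos (pi / n)"
  defines "X \<equiv> exp (- 2 * (1 - cos (pi / n)) * t) * (real n)\<^sup>2"
  shows "1 - 3 * exp (- X / 64) - 32 / X \<le> d_TV n t"
proof -
  define l where "l = 1 - cos (pi / n)"
  define h where "h = (\<lambda>x\<in>lat_box n. real n * sine n x)"
  define M where "M = exp (- (1 - cos (pi / n)) * t) * overlap h"
  \<comment> \<open>A quarter of the mean: the clocks keep the noiseless overlap above
    \<open>M / 2 = 2 * K\<close>, and the noise spends one \<open>K\<close> on each of the two
    coupled fields.\<close>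
  define K where "K = M / 4"
  let ?W = "measure_pmf (ring_sites n t)"
  let ?tail = "exp (- (K\<^sup>2 / (2 * overlap_var)))"
  let ?b = "exp (- X / 64)"
  let ?A = "{h \<in> space fields. K \<le> overlap h}"
  have n: "0 < real n" using n3 by simp
  have l: "0 < l" "l \<le> 2" using cos_bounds by (auto simp: l_def)
  have X: "0 < X" using n by (simp add: X_def)
  have hB: "h \<in> bounded_heights n"
  proof -
    have "\<bar>real n * sine n x\<bar> \<le> real n" if "x \<in> lat_box n" for x
      using \<phi>_le_1[OF that] \<phi>_pos[OF that] n by (simp add: abs_mult)
    then show ?thesis by (auto simp: bounded_heights_def h_def space_PiM)
  qed
  note hs = bounded_heights_space[OF hB]
  have ov: "overlap h = (real n)^3 / 4"
  proof -
    have "overlap h = real n * norm_sq (sine n)"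
      unfolding overlap_def norm_sq_def sum_distrib_left
      by (intro sum.cong refl) (simp add: h_def power2_eq_square)
    then show ?thesis by (simp add: norm_sq_sine power2_eq_square power3_eq_cube)
  qed
  have en: "energy h = l * (real n)^4 / 4"
  proof -
    have "energy h = energy (\<lambda>x. real n * sine n x + 0)"
      by (intro energy_cong) (simp add: h_def)
    also have "\<dots> = (1 - cos (pi / n)) * ((real n)\<^sup>2 * norm_sq (sine n))"
      using energy_add_eigen[of "real n" "\<lambda>_. 0"] by (simp add: energy_def overlap_def avg_def)
    finally show ?thesis by (simp add: l_def norm_sq_sine power2_eq_square power4_eq_xxxx)
  qed
  have M2: "M\<^sup>2 = X * (real n)^4 / 16"
  proof -
    have e: "(exp (- (1 - cos (pi / n)) * t))\<^sup>2 = exp (- 2 * (1 - cos (pi / n)) * t)"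
      by (simp add: exp_double[symmetric] algebra_simps)
    show ?thesis
      unfolding M_def X_def ov power_mult_distrib e
      by (simp add: power_divide power_mult[symmetric] power_add[symmetric] mult.assoc)
  qed
  have M: "0 < M" using n by (simp add: M_def ov)
  have V: "overlap_var = (real n)\<^sup>2 / (4 * l)" by (simp add: overlap_var_def norm_sq_sine l_def)
  have tail: "X / 64 \<le> K\<^sup>2 / (2 * overlap_var)"
  proof -
    have "K\<^sup>2 / (2 * overlap_var) = X * ((real n)\<^sup>2 * l) / 128"
      unfolding K_def V power_divide M2 using n l by (simp add: field_simps power2_eq_square power4_eq_xxxx)
    moreover have "2 \<le> (real n)\<^sup>2 * l" using gap n by (simp add: l_def field_simps)
    then have "X * 2 \<le> X * ((real n)\<^sup>2 * l)" using X by (intro mult_left_mono) auto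
    ultimately show ?thesis by simp
  qed
  have exp_le: "?tail \<le> ?b" using tail by simp
  have cheb: "4 * energy h / M\<^sup>2 \<le> 32 / X"
  proof -
    have "4 * energy h / M\<^sup>2 = 16 * l / X"
      unfolding en M2 using n X by (simp add: field_simps)
    also have "\<dots> \<le> 32 / X" using l X by (intro divide_right_mono) auto
    finally show ?thesis .
  qed
  interpret G: prob_space "glauber_law n h t" by (rule prob_space_glauber_law[OF hs])
  interpret D: prob_space "dgff n" by (rule prob_space_dgff)
  have A: "?A \<in> sets fields" by measurable
  have dg: "measure (dgff n) ?A \<le> ?b"
  proof -
    have "emeasure gibbs {h \<in> space fields. K \<le> 1 * overlap h} \<le> ennreal ?tail"
      using M by (intro gibbs_overlap_tail) (auto simp: K_def)
    also have "\<dots> \<le> ennreal ?b" by (intro ennreal_leI exp_le)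
    finally show ?thesis by (simp add: dgff_eq[symmetric] D.emeasure_eq_measure)
  qed
  let ?C = "{h \<in> space fields. overlap h < K}" and ?S = "{w. overlap (evolved w h) < M / 2}"
  have C: "?C \<in> sets fields" by measurable
  have "emeasure (glauber_law n h t) ?C = (\<integral>\<^sup>+w. transition w (indicator ?C) h \<partial>?W)"
    by (rule emeasure_glauber_law[OF hs t C])
  also have "\<dots> \<le> (\<integral>\<^sup>+w. ennreal (2 * ?b) + indicator ?S w \<partial>?W)"
  proof (intro nn_integral_mono_AE AE_pmfI)
    fix w assume w: "w \<in> set_pmf (ring_sites n t)"
    have wB: "set w \<subseteq> lat_box n"
      using w finite_B B_nonempty by (auto simp: ring_sites_def set_replicate_pmf)
    show "transition w (indicator ?C) h \<le> ennreal (2 * ?b) + indicator ?S w"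
    proof (cases "w \<in> ?S")
      case True
      have "transition w (indicator ?C) h \<le> 0 + indicator ?S w"
        using True transition_le_1[of "indicator ?C" w h] by (simp add: indicator_def)
      also have "\<dots> \<le> ennreal (2 * ?b) + indicator ?S w" by (intro add_mono) auto
      finally show ?thesis .
    next
      case False
      have "transition w (indicator ?C) h \<le> ennreal (2 * ?tail)"
        using False M by (intro transition_overlap_small[OF hs wB]) (auto simp: K_def)
      also have "\<dots> \<le> ennreal (2 * ?b)" using exp_le by (intro ennreal_leI) simp
      finally show ?thesis using False by simp
    qed
  qed
  also have "\<dots> = ennreal (2 * ?b) + emeasure ?W ?S"
    by (simp add: nn_integral_add)
  also have "emeasure ?W ?S \<le> ennreal (4 * energy h / M\<^sup>2)"
    unfolding M_def
  proof (rule overlap_concentration[OF t n3])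
    show "0 \<le> h x" if "x \<in> lat_box n" for x using that \<phi>_pos[OF that] by (simp add: h_def)
    show "0 < overlap h" using n by (simp add: ov)
  qed
  also have "\<dots> \<le> ennreal (32 / X)" by (intro ennreal_leI cheb)
  finally have "emeasure (glauber_law n h t) ?C \<le> ennreal (2 * ?b) + ennreal (32 / X)"
    by (simp add: add_left_mono)
  then have GC: "measure (glauber_law n h t) ?C \<le> 2 * ?b + 32 / X"
    using X by (simp add: G.emeasure_eq_measure flip: ennreal_plus)
  have "measure (glauber_law n h t) ?A = 1 - measure (glauber_law n h t) ?C"
  proof -
    have "space (glauber_law n h t) - ?C = ?A" by (auto simp: glauber_law_def)
    then show ?thesis using G.prob_compl[of ?C] C by simp
  qed
  then have "1 - 3 * ?b - 32 / X \<le> measure (glauber_law n h t) ?A - measure (dgff n) ?A"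
    using GC dg by linarith
  also have "\<dots> \<le> tv_dist (glauber_law n h t) (dgff n)"
    using A by (intro tv_dist_bounds) (auto intro: G.prob_space_axioms D.prob_space_axioms)
  also have "\<dots> \<le> d_TV n t" by (rule d_TV_upper[OF hB])
  finally show ?thesis .
qed

end

section \<open>Asymptotics\<close>

text \<open>In order: the threshold \<open>s\<close>, the mean cost over \<open>s^2 / 2\<close>,
  sites missed by removal, an atypical stationary norm, and too few updates. The second summand is
  of order 1 / ln n.\<close>

definition tv_bound :: "nat \<Rightarrow> real" where
  "tv_bound n = 5 / 2 / sqrt (ln n) +
    2 * ln n * ((4 * (ln n)\<^sup>2 + 8 * ln n + 1) / (real n)\<^sup>2 * (exp 1 / ((real n)\<^sup>2 * (ln n)^4)) * (6 * (real n)^4)) +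
    (real n)\<^sup>2 * exp (- 8 * ln n) + exp (- ((real n - 1)\<^sup>2 / 2)) + exp (- ((real n - 1)\<^sup>2 * n / 2))"

lemma tv_bound_tendsto: "tv_bound \<longlonglongrightarrow> 0"
  unfolding tv_bound_def by real_asymp

text \<open>The time budget is \<open>t_star n + n^2 * L\<close> for free contraction,
  \<open>n^2\<close> for damping and \<open>8 * ln n\<close> for removal. Another \<open>n^2\<close>
  is slack against Poisson fluctuations, and 2 pays for rounding the numbers of letters.\<close>

lemma (in box) d_TV_le_tv_bound:
  fixes t :: real
  defines "L \<equiv> ln (ln (real n))"
  assumes n: "3 \<le> n" and x: "1 \<le> ln (real n)" "2 * ln (real n) \<le> (real n)\<^sup>2"
    and gap: "2 / (real n)\<^sup>2 \<le> 1 - cos (pi / n)"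
    and decay: "2 * ln n + 4 * L - 1 \<le> (sin (pi / n))\<^sup>2 * (t_star n + (real n)\<^sup>2 * L)"
    and t: "t \<le> (real n)^3" "t_star n + (real n)\<^sup>2 * L + 2 * (real n)\<^sup>2 + 8 * ln n + 2 \<le> t"
  shows "d_TV n t \<le> tv_bound n"
proof -
  define N where "N = real (card (lat_box n))"
  \<comment> \<open>Tends to 0, but slowly enough that division of the cost by \<open>s^2\<close>
    loses only a logarithm.\<close>
  define s where "s = 1 / sqrt (ln n)"
  \<comment> \<open>Over \<open>m / N = n^2\<close> units of time this damps the squared norm by at
    least \<open>exp (- \<delta> * n^2) = n^(-2)\<close>.\<close>
  define \<delta> where "\<delta> = 2 * ln n / (real n)\<^sup>2"
  define m where "m = card (lat_box n) * n\<^sup>2"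
  \<comment> \<open>Leaves a chance of at most \<open>n^2 * n^(-8)\<close> that a site is
    missed.\<close>
  define g where "g = nat \<lceil>8 * N * ln n\<rceil>"
  define k where "k = nat \<lceil>N * (t_star n + (real n)\<^sup>2 * L)\<rceil>"
  \<comment> \<open>With \<open>n^2\<close> of slack the Chernoff exponent is at most
    \<open>N * (- \<theta> * n^2 + \<theta>^2 * t / 2)\<close>, minimal here;
    \<open>t \<le> n^3\<close> then makes it at most \<open>- N * n / 2\<close>.\<close>
  define \<theta> where "\<theta> = (real n)\<^sup>2 / t"
  have n0: "0 < real n" using n by simp
  have N1: "1 \<le> N" using card_B_pos by (simp add: N_def)
  have Nn: "N = (real n - 1)\<^sup>2" using n_ge_2 by (simp add: N_def card_box of_nat_diff)
  have N_le: "N \<le> (real n)\<^sup>2" unfolding Nn using n by (intro power_mono) auto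
  have L: "0 \<le> L" using x by (simp add: L_def)
  have ts: "0 \<le> t_star n" using x by (simp add: t_star_def)
  have t0: "0 < t" using t(2) ts L x n0 by (smt (verit) mult_nonneg_nonneg zero_le_power2)
  have s: "0 < s" "s \<le> 1" using x by (auto simp: s_def)
  have \<delta>: "0 \<le> \<delta>" "\<delta> \<le> 1" using x n0 by (auto simp: \<delta>_def)
  have \<theta>: "0 \<le> \<theta>" using t0 by (simp add: \<theta>_def)
  have exp_L: "exp L = ln n" using x by (simp add: L_def)
  have exp_x: "exp (ln n) = real n" using n0 by simp
  have c1: "contraction 1 ^ k \<le> exp 1 / ((real n)\<^sup>2 * (ln n)^4)"
  proof -
    have e: "contraction 1 = 1 - (sin (pi / n))\<^sup>2 / N"
      by (simp add: contraction_def N_def sin_squared_eq)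
    have "contraction 1 ^ k \<le> exp (- ((sin (pi / n))\<^sup>2 / N)) ^ k"
      using contraction_bounds(1)[of 1] exp_ge_add_one_self[of "- ((sin (pi / n))\<^sup>2 / N)"]
      by (intro power_mono) (simp_all add: e)
    also have "\<dots> = exp (- ((sin (pi / n))\<^sup>2 * (k / N)))"
      by (simp add: exp_of_nat_mult[symmetric] mult_ac)
    also have "\<dots> \<le> exp (- (2 * ln n + 4 * L - 1))"
    proof -
      have "N * (t_star n + (real n)\<^sup>2 * L) \<le> k" unfolding k_def by (rule real_nat_ceiling_ge)
      then have "t_star n + (real n)\<^sup>2 * L \<le> k / N" using N1 by (simp add: field_simps)
      then have "(sin (pi / n))\<^sup>2 * (t_star n + (real n)\<^sup>2 * L) \<le> (sin (pi / n))\<^sup>2 * (k / N)"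
        by (intro mult_left_mono) auto
      with decay show ?thesis by simp
    qed
    also have "\<dots> = exp 1 / (exp (ln n) ^ 2 * exp L ^ 4)"
      unfolding exp_of_nat_mult[symmetric] exp_add[symmetric] exp_diff[symmetric] by simp
    finally show ?thesis unfolding exp_L exp_x .
  qed
  have c2: "contraction (1 - \<delta>) ^ m \<le> 1 / (real n)\<^sup>2"
  proof -
    have "(1 - \<delta>)\<^sup>2 * (cos (pi / n))\<^sup>2 \<le> (1 - \<delta>) * 1"
    proof (intro mult_mono)
      show "(1 - \<delta>)\<^sup>2 \<le> 1 - \<delta>" using \<delta> mult_right_mono[of "1 - \<delta>" 1 "1 - \<delta>"] by (simp add: power2_eq_square)
      show "(cos (pi / n))\<^sup>2 \<le> 1" using cos_bounds by (intro power_le_one) auto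
    qed (use \<delta> in auto)
    then have "contraction (1 - \<delta>) \<le> 1 - \<delta> / N"
      using N1 by (simp add: contraction_def N_def[symmetric] divide_right_mono)
    also have "\<dots> \<le> exp (- (\<delta> / N))" using exp_ge_add_one_self[of "- (\<delta> / N)"] by simp
    finally have "contraction (1 - \<delta>) ^ m \<le> exp (- (\<delta> / N)) ^ m"
      using contraction_bounds(1)[of "1 - \<delta>"] \<delta> by (intro power_mono) auto
    also have "\<dots> = exp (- (\<delta> * (m / N)))" by (simp add: exp_of_nat_mult[symmetric] mult_ac)
    also have "\<delta> * (m / N) = 2 * ln n" using N1 n0 by (simp add: \<delta>_def m_def N_def)
    also have "exp (- (2 * ln n)) = 1 / exp (ln n) ^ 2"
      unfolding exp_of_nat_mult[symmetric] by (simp add: exp_minus inverse_eq_divide)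
    finally show ?thesis unfolding exp_x .
  qed
  have g: "8 * N * ln n \<le> g" "g / N \<le> 8 * ln n + 1"
  proof -
    show "8 * N * ln n \<le> g" unfolding g_def by (rule real_nat_ceiling_ge)
    have "real g \<le> 8 * N * ln n + 1"
      unfolding g_def using N1 x by (intro nat_ceiling_le mult_nonneg_nonneg) auto
    also have "\<dots> \<le> (8 * ln n + 1) * N" using N1 by (simp add: algebra_simps)
    finally show "g / N \<le> 8 * ln n + 1" using N1 by (simp add: divide_le_eq)
  qed
  have R: "2 * (N * (real n)\<^sup>2) + 8 * N / (1 - cos (pi / n)) \<le> 6 * (real n)^4"
  proof -
    have l: "0 < 1 - cos (pi / n)" using cos_bounds by simp
    have "8 * N / (1 - cos (pi / n)) \<le> 8 * N / (2 / (real n)\<^sup>2)"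
      using gap N1 n0 l by (intro divide_left_mono mult_pos_pos) auto
    also have "\<dots> = 4 * (N * (real n)\<^sup>2)" by simp
    finally have "2 * (N * (real n)\<^sup>2) + 8 * N / (1 - cos (pi / n)) \<le> 6 * (N * (real n)\<^sup>2)" by simp
    also have "\<dots> \<le> 6 * ((real n)\<^sup>2 * (real n)\<^sup>2)" using N_le by (intro mult_left_mono mult_right_mono) auto
    finally show ?thesis by (simp add: power2_eq_square power4_eq_xxxx)
  qed
  have cost: "(\<delta>\<^sup>2 * m / N + contraction (1 - \<delta>) ^ m * g / N) * contraction 1 ^ k * (2 * (N * (real n)\<^sup>2) + 8 * N / (1 - cos (pi / n)))
      \<le> (4 * (ln n)\<^sup>2 + 8 * ln n + 1) / (real n)\<^sup>2 * (exp 1 / ((real n)\<^sup>2 * (ln n)^4)) * (6 * (real n)^4)"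
  proof (intro mult_mono c1 R)
    have "\<delta>\<^sup>2 * m / N = 4 * (ln n)\<^sup>2 / (real n)\<^sup>2"
      using N1 n0 by (simp add: \<delta>_def m_def N_def[symmetric] power2_eq_square field_simps)
    moreover have "contraction (1 - \<delta>) ^ m * g / N \<le> 1 / (real n)\<^sup>2 * (8 * ln n + 1)"
      unfolding times_divide_eq_right[symmetric] using c2 g N1 by (intro mult_mono) auto
    ultimately show "\<delta>\<^sup>2 * m / N + contraction (1 - \<delta>) ^ m * g / N \<le> (4 * (ln n)\<^sup>2 + 8 * ln n + 1) / (real n)\<^sup>2"
      by (simp add: add_divide_distrib)
    show "0 \<le> 2 * (N * (real n)\<^sup>2) + 8 * N / (1 - cos (pi / n))"
      using N1 cos_bounds by (intro add_nonneg_nonneg mult_nonneg_nonneg divide_nonneg_nonneg) auto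
  qed (use x contraction_bounds(1)[of 1] in \<open>auto intro!: divide_nonneg_nonneg mult_nonneg_nonneg add_nonneg_nonneg\<close>)
  have 1: "2 / s\<^sup>2 = 2 * ln n" using x by (simp add: s_def power_divide)
  have 2: "N * (1 - 1 / N) ^ g \<le> (real n)\<^sup>2 * exp (- 8 * ln n)"
  proof (intro mult_mono N_le)
    have "(1 - 1 / N) ^ g \<le> exp (- (1 / N)) ^ g"
      using exp_ge_add_one_self[of "- (1 / N)"] N1 by (intro power_mono) auto
    also have "\<dots> = exp (- (g / N))" by (simp add: exp_of_nat_mult[symmetric])
    also have "\<dots> \<le> exp (- 8 * ln n)" using g(1) N1 by (simp add: field_simps)
    finally show "(1 - 1 / N) ^ g \<le> exp (- 8 * ln n)" .
  qed (use N1 in auto)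
  have 3: "\<theta> * real (k + m + g) - \<theta> * (N * t) + \<theta>\<^sup>2 * (N * t) / 2 \<le> - (N * n / 2)"
  proof -
    have "real k \<le> N * (t_star n + (real n)\<^sup>2 * L) + 1"
      unfolding k_def using N1 ts L by (intro nat_ceiling_le mult_nonneg_nonneg add_nonneg_nonneg) auto
    moreover have "real g \<le> 8 * N * ln n + 1"
      unfolding g_def using N1 x by (intro nat_ceiling_le mult_nonneg_nonneg) auto
    ultimately have "real (k + m + g) \<le> N * (t_star n + (real n)\<^sup>2 * L + (real n)\<^sup>2 + 8 * ln n) + 2"
      by (simp add: m_def N_def[symmetric] algebra_simps)
    also have "\<dots> \<le> N * (t_star n + (real n)\<^sup>2 * L + (real n)\<^sup>2 + 8 * ln n + 2)"
      using N1 by (simp add: algebra_simps)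
    also have "\<dots> \<le> N * (t - (real n)\<^sup>2)" using N1 t(2) by (intro mult_left_mono) auto
    finally have "\<theta> * real (k + m + g) \<le> \<theta> * (N * (t - (real n)\<^sup>2))" using \<theta> by (rule mult_left_mono)
    moreover have "\<theta>\<^sup>2 * (N * t) / 2 = \<theta> * (N * (real n)\<^sup>2) / 2"
      using t0 by (simp add: \<theta>_def power2_eq_square)
    ultimately have "\<theta> * real (k + m + g) - \<theta> * (N * t) + \<theta>\<^sup>2 * (N * t) / 2 \<le> - (\<theta> * (N * (real n)\<^sup>2) / 2)"
      by (simp only: right_diff_distrib)
    also have "\<dots> \<le> - (N * n / 2)"
    proof -
      have "real n * t \<le> (real n)^4" using t(1) n0 by (simp add: power3_eq_cube power4_eq_xxxx)
      then have "real n \<le> \<theta> * (real n)\<^sup>2" using t0 by (simp add: \<theta>_def field_simps power2_eq_square power4_eq_xxxx)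
      then have "N * real n \<le> N * (\<theta> * (real n)\<^sup>2)" using N1 by (intro mult_left_mono) auto
      then show ?thesis by (simp add: mult_ac)
    qed
    finally show ?thesis by simp
  qed
  have "d_TV n t \<le> 5 / 2 * s + 2 / s\<^sup>2 * ((\<delta>\<^sup>2 * m / N + contraction (1 - \<delta>) ^ m * g / N) * contraction 1 ^ k * (2 * (N * (real n)\<^sup>2) + 8 * N / (1 - cos (pi / n))))
      + N * (1 - 1 / N) ^ g + exp (- (N / 2)) + exp (\<theta> * real (k + m + g) - \<theta> * (N * t) + \<theta>\<^sup>2 * (N * t) / 2)"
    using d_TV_le[OF t0 s \<delta> \<theta>, of k m g] unfolding coupling_error_def N_def .
  also have "\<dots> \<le> tv_bound n"
    unfolding tv_bound_def 1 using x 3 unfolding Nn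
    by (intro add_mono mult_left_mono cost[unfolded Nn] 2[unfolded Nn]) (auto simp: s_def)
  finally show ?thesis .
qed

section \<open>The window\<close>

definition window :: "nat \<Rightarrow> real" where
  "window n = (real n)\<^sup>2 * ln (ln (real n))"

lemma eventually_gap: "eventually (\<lambda>n. 2 / (real n)\<^sup>2 \<le> 1 - cos (pi / n)) sequentially"
proof -
  have "(\<lambda>n. (1 - cos (pi / real n)) * (real n)\<^sup>2) \<longlonglongrightarrow> pi\<^sup>2 / 2"
    by real_asymp (simp add: power2_eq_square)
  moreover have "2 < pi\<^sup>2 / 2" using power_strict_mono[OF pi_gt3, of 2] by simp
  ultimately have "eventually (\<lambda>n. 2 < (1 - cos (pi / real n)) * (real n)\<^sup>2) sequentially"
    by (rule order_tendstoD)
  then show ?thesis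
    using eventually_gt_at_top[of 0] by eventually_elim (simp add: divide_le_eq)
qed

text \<open>The squared sine times n^2 tends to pi^2 so fast that the deficit stays small even after
  multiplication by ln n: below pi^2 / 2, it costs 1 under the prefactor 2 / pi^2 of
  \<open>t_star\<close>. In the window part the limit pi^2 is simply replaced by 4.\<close>

lemma eventually_decay:
  "eventually (\<lambda>n. 2 * ln (real n) + 4 * ln (ln (real n)) - 1 \<le> (sin (pi / n))\<^sup>2 * (t_star n + (real n)\<^sup>2 * ln (ln (real n)))) sequentially"
proof -
  have "(\<lambda>n. (sin (pi / real n))\<^sup>2 * (real n)\<^sup>2) \<longlonglongrightarrow> pi\<^sup>2" by real_asymp
  moreover have "4 < pi\<^sup>2" using power_strict_mono[OF pi_gt3, of 2] by simp
  ultimately have "eventually (\<lambda>n. 4 < (sin (pi / real n))\<^sup>2 * (real n)\<^sup>2) sequentially"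
    by (rule order_tendstoD)
  moreover have "(\<lambda>n. (pi\<^sup>2 - (sin (pi / real n))\<^sup>2 * (real n)\<^sup>2) * ln (real n)) \<longlonglongrightarrow> 0" by real_asymp
  then have "eventually (\<lambda>n. (pi\<^sup>2 - (sin (pi / real n))\<^sup>2 * (real n)\<^sup>2) * ln (real n) < pi\<^sup>2 / 2) sequentially"
    by (rule order_tendstoD) simp
  moreover have "eventually (\<lambda>n. 0 \<le> ln (ln (real n))) sequentially" by real_asymp
  ultimately show ?thesis
  proof eventually_elim
    case (elim n)
    let ?q = "(sin (pi / real n))\<^sup>2 * (real n)\<^sup>2"
    have "2 * ln (real n) - 1 \<le> (sin (pi / n))\<^sup>2 * t_star n"
    proof -
      have "(2 * ln (real n) - 1) * pi\<^sup>2 \<le> ?q * 2 * ln (real n)" using elim(2) by (simp add: algebra_simps)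
      then show ?thesis by (simp add: t_star_def field_simps)
    qed
    moreover have "4 * ln (ln (real n)) \<le> ?q * ln (ln (real n))" using elim by (intro mult_right_mono) auto
    ultimately show ?case by (simp add: distrib_left mult_ac)
  qed
qed

text \<open>One window is spent on free contraction, and two absorb the remaining time budget of
  order n^2.\<close>

lemma d_TV_late:
  assumes c: "3 \<le> c"
  shows "(\<lambda>n. d_TV n (t_star n + c * window n)) \<longlonglongrightarrow> 0"
proof (rule tendsto_sandwich[OF _ _ tendsto_const tv_bound_tendsto])
  show "eventually (\<lambda>n. 0 \<le> d_TV n (t_star n + c * window n)) sequentially"
    using eventually_ge_at_top[of 2]
    by eventually_elim (rule box.d_TV_bounds, simp add: box_def)
  have "(\<lambda>n. (t_star n + c * window n) / (real n)^3) \<longlonglongrightarrow> 0"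
    unfolding t_star_def window_def by real_asymp
  then have "eventually (\<lambda>n. (t_star n + c * window n) / (real n)^3 < 1) sequentially"
    by (rule order_tendstoD) simp
  moreover have "eventually (\<lambda>n. 2 * (real n)\<^sup>2 + 8 * ln (real n) + 2 \<le> 2 * window n) sequentially"
    unfolding window_def by real_asymp
  moreover have "eventually (\<lambda>n. 1 \<le> ln (real n)) sequentially" "eventually (\<lambda>n. 2 * ln (real n) \<le> (real n)\<^sup>2) sequentially"
    "eventually (\<lambda>n. 0 \<le> window n) sequentially"
    unfolding window_def by real_asymp+
  ultimately show "eventually (\<lambda>n. d_TV n (t_star n + c * window n) \<le> tv_bound n) sequentially"
    using eventually_gap eventually_decay eventually_ge_at_top[of 3]
  proof eventually_elim
    case (elim n)
    interpret box n using elim by unfold_locales simp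
    have "3 * window n \<le> c * window n" using c elim by (intro mult_right_mono) auto
    then have "t_star n + window n + 2 * (real n)\<^sup>2 + 8 * ln (real n) + 2 \<le> t_star n + c * window n"
      using elim by linarith
    then show ?case
      using elim by (intro d_TV_le_tv_bound) (auto simp: window_def divide_less_eq)
  qed
qed

text \<open>At \<open>t_star\<close> the decay exponent of the mean is at most ln n, since
  \<open>1 - cos x\<close> is at most \<open>x^2 / 2\<close>. Going back one window lowers it by at
  least \<open>2 * ln (ln n)\<close>, so \<open>X\<close> exceeds ln n and both error terms
  vanish.\<close>

lemma d_TV_early:
  assumes c: "1 \<le> c"
  shows "(\<lambda>n. d_TV n (t_star n - c * window n)) \<longlonglongrightarrow> 1"
proof (rule tendsto_sandwich[OF _ _ _ tendsto_const])
  show "eventually (\<lambda>n. d_TV n (t_star n - c * window n) \<le> 1) sequentially"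
    using eventually_ge_at_top[of 2]
    by eventually_elim (rule box.d_TV_bounds, simp add: box_def)
  show "(\<lambda>n. 1 - 3 * exp (- ln (real n) / 64) - 32 / ln (real n)) \<longlonglongrightarrow> 1"
    by real_asymp
  have "eventually (\<lambda>n. 0 < t_star n - c * window n) sequentially"
  proof -
    have "(\<lambda>n. window n / t_star n) \<longlonglongrightarrow> 0" unfolding window_def t_star_def by real_asymp
    then have "(\<lambda>n. c * (window n / t_star n)) \<longlonglongrightarrow> c * 0" by (intro tendsto_intros)
    then have "eventually (\<lambda>n. c * (window n / t_star n) < 1) sequentially" by (rule order_tendstoD) simp
    moreover have "eventually (\<lambda>n. 0 < t_star n) sequentially" unfolding t_star_def by real_asymp
    ultimately show ?thesis by eventually_elim (simp add: divide_less_eq)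
  qed
  moreover have "eventually (\<lambda>n. 1 \<le> ln (real n)) sequentially" by real_asymp
  ultimately show "eventually (\<lambda>n. 1 - 3 * exp (- ln (real n) / 64) - 32 / ln (real n) \<le> d_TV n (t_star n - c * window n)) sequentially"
    using eventually_gap eventually_ge_at_top[of 3]
  proof eventually_elim
    case (elim n)
    interpret box n using elim by unfold_locales simp
    let ?l = "1 - cos (pi / n)" and ?t = "t_star n - c * window n"
    define X where "X = exp (- 2 * ?l * ?t) * (real n)\<^sup>2"
    have n: "0 < real n" using elim by simp
    have L: "0 \<le> ln (ln (real n))" using elim by simp
    have "?l * t_star n \<le> ln (real n)"
    proof -
      have "?l = 2 * (sin (pi / n / 2))\<^sup>2" using cos_double_sin[of "pi / n / 2"] by simp
      also have "\<dots> \<le> 2 * (pi / n / 2)\<^sup>2"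
        using abs_sin_x_le_abs_x[of "pi / n / 2"] by (intro mult_left_mono abs_le_square_iff[THEN iffD1]) auto
      also have "\<dots> = pi\<^sup>2 / (2 * (real n)\<^sup>2)" by (simp add: power_divide)
      finally have "?l * t_star n \<le> pi\<^sup>2 / (2 * (real n)\<^sup>2) * t_star n"
        using elim by (intro mult_right_mono) (auto simp: t_star_def)
      also have "\<dots> = ln (real n)" using n by (simp add: t_star_def)
      finally show ?thesis .
    qed
    moreover have "2 * ln (ln (real n)) \<le> ?l * (c * window n)"
    proof -
      have "2 / (real n)\<^sup>2 * (1 * window n) \<le> ?l * (c * window n)"
        using elim c L cos_bounds by (intro mult_mono mult_right_mono) (auto simp: window_def)
      then show ?thesis using n by (simp add: window_def)
    qed
    moreover have "- 2 * ?l * ?t = 2 * (?l * (c * window n)) - 2 * (?l * t_star n)"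
      by (simp add: algebra_simps)
    ultimately have "ln (ln (real n)) \<le> - 2 * ?l * ?t + 2 * ln (real n)"
      using L by linarith
    then have "exp (ln (ln (real n))) \<le> exp (- 2 * ?l * ?t + 2 * ln (real n))"
      by (simp only: exp_le_cancel_iff)
    also have "\<dots> = X"
      using n by (simp add: X_def exp_add exp_double)
    finally have X: "ln (real n) \<le> X" using elim by simp
    have "1 - 3 * exp (- ln (real n) / 64) - 32 / ln (real n) \<le> 1 - 3 * exp (- X / 64) - 32 / X"
      using X elim by (intro diff_mono mult_left_mono divide_left_mono) auto
    also have "\<dots> \<le> d_TV n ?t"
      unfolding X_def using elim by (intro d_TV_ge) auto
    finally show ?case .
  qed
qed

theorem theorem1p2:
  shows "\<exists>s :: nat \<Rightarrow> real. s \<in> O(\<lambda>n. (real n)\<^sup>2 * ln (ln (real n))) \<and> cutoff d_TV t_star s"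
proof (intro exI conjI)
  show "window \<in> O(\<lambda>n. (real n)\<^sup>2 * ln (ln (real n)))"
    unfolding window_def[abs_def] by simp
  show "cutoff d_TV t_star window"
    unfolding cutoff_def
  proof (intro conjI)
    show "window \<in> o(t_star)"
      unfolding window_def[abs_def] t_star_def[abs_def] by real_asymp
    \<comment> \<open>The limit is already 1 for each fixed \<open>c \<ge> 1\<close>, so the outer
      limit is that of an eventually constant function; likewise below from \<open>c = 3\<close>
      on.\<close>
    have "liminf (\<lambda>n. ereal (d_TV n (t_star n - c * window n))) = 1" if "1 \<le> c" for c
      using lim_imp_Liminf[OF _ tendsto_ereal[OF d_TV_early[OF that]]] by (simp add: one_ereal_def)
    then show "((\<lambda>c. liminf (\<lambda>n. ereal (d_TV n (t_star n - c * window n)))) \<longlongrightarrow> 1) at_top"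
      by (intro tendsto_eventually eventually_at_top_linorderI)
    have "limsup (\<lambda>n. ereal (d_TV n (t_star n + c * window n))) = 0" if "3 \<le> c" for c
      using lim_imp_Limsup[OF _ tendsto_ereal[OF d_TV_late[OF that]]] by (simp add: zero_ereal_def)
    then show "((\<lambda>c. limsup (\<lambda>n. ereal (d_TV n (t_star n + c * window n)))) \<longlongrightarrow> 0) at_top"
      by (intro tendsto_eventually eventually_at_top_linorderI)
  qed
qed

end
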